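(* Assume that $\ell:=\lim_{p\to\infty}q(p)/p\in[0,1)$ exists. Let $u_\infty$ be a uniform limit of nonnegative weak solutions $u_p$ of $$-\Delta_p u_p(x)+\lambda_0(x)\,(u_p)_+^{q(p)}(x)=0\ \text{ in }\Omega,\qquad u_p=g\ \text{ on }\partial\Omega,$$ with $g\in\mathrm{Lip}(\partial\Omega)$, and let $\Omega'\Subset\Omega$. Then for any $x_0\in\partial\{u_\infty>0\}\cap\Omega'$ and any $0<r\ll1$ (i.e. for all $0<r<r_0$, for some small $r_0>0$ not depending on $x_0$), $$\frac1{|B_r(x_0)|}\int_{B_r(x_0)}|\nabla u_\infty(x)|\,dx\ \le\ 2\cdot2^{\frac{\ell}{1-\ell}}(1-\ell)^{\frac1{1-\ell}}\,r^{\frac{\ell}{1-\ell}} .$$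
   Context: $\Omega\subset\mathbb R^N$ is a regular bounded domain; $\lambda_0$ is a bounded function on $\Omega$ which is bounded away from zero ($0<\inf_\Omega\lambda_0\le\sup_\Omega\lambda_0<\infty$); $g\ge0$; $p\ge2$ and $0\le q(p)<p-1$; $\lambda_0$ and $g$ do not depend on $p$. $\Delta_pu=\mathrm{div}(|\nabla u|^{p-2}\nabla u)$, $u_+=\max\{u,0\}$, and $u_+^0$ means $\chi_{\{u>0\}}$. A weak solution is $u\in W^{1,p}_{\rm loc}(\Omega)$ with $\int_\Omega|\nabla u|^{p-2}\nabla u\cdot\nabla\varphi\,dx=-\int_\Omega\lambda_0u_+^q\varphi\,dx$ for all $0\le\varphi\in C_0^1(\Omega)$, with $u=g$ on $\partial\Omega$. "$u_\infty$ is a uniform limit of the $u_p$" means that there is a sequence $p_j\to\infty$ with $u_{p_j}\to u_\infty$ uniformly in $\overline\Omega$ (such limits are Lipschitz, so $\nabla u_\infty$ exists a.e.). *)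

theory Defs
  imports "HOL-Analysis.Analysis"
begin

text \<open>The dimension \<open>N\<close> is \<open>DIM('a)\<close>. The gradient is extended by \<open>0\<close> to the points where
  the function is not differentiable (a null set for a locally Lipschitz function).\<close>

definition grad :: "('a::euclidean_space \<Rightarrow> real) \<Rightarrow> 'a \<Rightarrow> 'a" where
  "grad f x = (if f differentiable (at x) then (THE D. GDERIV f x :> D) else 0)"

lemma gderiv_imp_grad:
  fixes f :: "'a::euclidean_space \<Rightarrow> real"
  assumes "GDERIV f x :> D"
  shows "grad f x = D"
proof -
  have "f differentiable (at x)"
    using assms unfolding gderiv_def differentiable_def by blast
  moreover have "(THE D. GDERIV f x :> D) = D"
  proof (rule the_equality[where P = "\<lambda>D. GDERIV f x :> D", OF assms])
    fix D' assume "GDERIV f x :> D'"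
    then have "(\<lambda>h. h \<bullet> D') = (\<lambda>h. h \<bullet> D)"
      using assms unfolding gderiv_def by (rule has_derivative_unique)
    then show "D' = D"
      by (metis euclidean_eqI inner_commute)
  qed
  ultimately show ?thesis by (simp add: grad_def)
qed

lemma differentiable_imp_gderiv_grad:
  fixes f :: "'a::euclidean_space \<Rightarrow> real"
  assumes "f differentiable (at x)"
  shows "GDERIV f x :> grad f x"
proof -
  obtain f' where f': "(f has_derivative f') (at x)"
    using assms unfolding differentiable_def by blast
  interpret bounded_linear f' using f' by (rule has_derivative_bounded_linear)
  have "f' = (\<lambda>h. h \<bullet> (\<Sum>b\<in>Basis. f' b *\<^sub>R b))"
  proof
    fix h
    have "f' h = f' (\<Sum>b\<in>Basis. (h \<bullet> b) *\<^sub>R b)" by (simp add: euclidean_representation)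
    also have "\<dots> = (\<Sum>b\<in>Basis. (h \<bullet> b) * f' b)" by (simp add: sum scaleR)
    also have "\<dots> = h \<bullet> (\<Sum>b\<in>Basis. f' b *\<^sub>R b)"
      by (simp add: inner_sum_right mult.commute)
    finally show "f' h = h \<bullet> (\<Sum>b\<in>Basis. f' b *\<^sub>R b)" .
  qed
  then have "GDERIV f x :> (\<Sum>b\<in>Basis. f' b *\<^sub>R b)"
    using f' unfolding gderiv_def by simp
  then show ?thesis using gderiv_imp_grad by metis
qed

text \<open>A regular bounded domain is read as a bounded domain with Lipschitz boundary: near each
  boundary point it is the epigraph, in some direction \<open>\<nu>\<close>, of a Lipschitz function of the
  component orthogonal to \<open>\<nu>\<close>. (The values of \<open>\<gamma>\<close> off that hyperplane are irrelevant.)\<close>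

definition lipschitz_boundary :: "'a::euclidean_space set \<Rightarrow> bool" where
  "lipschitz_boundary \<Omega> \<longleftrightarrow>
     (\<forall>z\<in>frontier \<Omega>. \<exists>\<nu> \<gamma> L \<rho>. norm \<nu> = 1 \<and> L-lipschitz_on UNIV \<gamma> \<and> 0 < \<rho> \<and>
        (\<forall>y\<in>ball z \<rho>. y \<in> \<Omega> \<longleftrightarrow> \<gamma> (y - (y \<bullet> \<nu>) *\<^sub>R \<nu>) < y \<bullet> \<nu>))"

definition regular_bounded_domain :: "'a::euclidean_space set \<Rightarrow> bool" where
  "regular_bounded_domain \<Omega> \<longleftrightarrow>
     open \<Omega> \<and> connected \<Omega> \<and> \<Omega> \<noteq> {} \<and> bounded \<Omega> \<and> lipschitz_boundary \<Omega>"

definition compactly_contained :: "'a::euclidean_space set \<Rightarrow> 'a set \<Rightarrow> bool" where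
  "compactly_contained A \<Omega> \<longleftrightarrow> compact (closure A) \<and> closure A \<subseteq> \<Omega>"

text \<open>\<open>C\<^sub>0\<^sup>1(\<Omega>)\<close>: continuously differentiable functions with compact support in \<open>\<Omega>\<close>, extended by
  \<open>0\<close> to the whole space.\<close>

definition C01 :: "'a::euclidean_space set \<Rightarrow> ('a \<Rightarrow> real) set" where
  "C01 \<Omega> = {\<phi>. (\<forall>x. \<phi> differentiable (at x)) \<and> continuous_on UNIV (grad \<phi>) \<and>
               compactly_contained {x. \<phi> x \<noteq> 0} \<Omega>}"

definition Lp_loc :: "real \<Rightarrow> 'a::euclidean_space set \<Rightarrow> ('a \<Rightarrow> 'b::euclidean_space) set" where
  "Lp_loc p \<Omega> = {f. f \<in> borel_measurable (lebesgue_on \<Omega>) \<and>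
     (\<forall>K. compact K \<and> K \<subseteq> \<Omega> \<longrightarrow> integrable (lebesgue_on K) (\<lambda>x. norm (f x) powr p))}"

definition weak_gradient ::
  "'a::euclidean_space set \<Rightarrow> ('a \<Rightarrow> real) \<Rightarrow> ('a \<Rightarrow> 'a) \<Rightarrow> bool" where
  "weak_gradient \<Omega> u G \<longleftrightarrow> u \<in> Lp_loc 1 \<Omega> \<and> G \<in> Lp_loc 1 \<Omega> \<and>
     (\<forall>\<phi>\<in>C01 \<Omega>. (LINT x|lebesgue_on \<Omega>. u x *\<^sub>R grad \<phi> x)
               = - (LINT x|lebesgue_on \<Omega>. \<phi> x *\<^sub>R G x))"

text \<open>\<open>u \<in> W\<^sup>1\<^sup>,\<^sup>p\<^sub>l\<^sub>o\<^sub>c(\<Omega>)\<close>, with weak gradient \<open>G\<close> (unique up to null sets).\<close>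

definition W1p_loc_with_gradient ::
  "real \<Rightarrow> 'a::euclidean_space set \<Rightarrow> ('a \<Rightarrow> real) \<Rightarrow> ('a \<Rightarrow> 'a) \<Rightarrow> bool" where
  "W1p_loc_with_gradient p \<Omega> u G \<longleftrightarrow> u \<in> Lp_loc p \<Omega> \<and> G \<in> Lp_loc p \<Omega> \<and> weak_gradient \<Omega> u G"

text \<open>Weak solutions of \<open>-\<Delta>\<^sub>p u + lam u\<^sub>+\<^sup>q = 0\<close> in \<open>\<Omega>\<close>, \<open>u = g\<close> on \<open>\<partial>\<Omega>\<close>. Since \<^prop>\<open>0 powr (q::real) = (0::real)\<close> also
  for \<open>q = 0\<close>, the term \<^term>\<open>max (u x) 0 powr 0\<close> is the characteristic function of
  \<open>{u > 0}\<close>. The boundary condition is attained continuously: \<open>u\<close> is the representative that is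
  continuous on the closure of \<open>\<Omega>\<close>.\<close>

definition weak_solution ::
  "real \<Rightarrow> real \<Rightarrow> ('a::euclidean_space \<Rightarrow> real) \<Rightarrow> ('a \<Rightarrow> real) \<Rightarrow> 'a set \<Rightarrow> ('a \<Rightarrow> real) \<Rightarrow> bool"
where
  "weak_solution p q lam g \<Omega> u \<longleftrightarrow>
     (\<exists>G. W1p_loc_with_gradient p \<Omega> u G \<and>
        (\<forall>\<phi>\<in>C01 \<Omega>. (\<forall>x. 0 \<le> \<phi> x) \<longrightarrow>
           (LINT x|lebesgue_on \<Omega>. (norm (G x) powr (p - 2)) *\<^sub>R G x \<bullet> grad \<phi> x)
         = - (LINT x|lebesgue_on \<Omega>. lam x * max (u x) 0 powr q * \<phi> x))) \<and>
     continuous_on (closure \<Omega>) u \<and> (\<forall>x\<in>frontier \<Omega>. u x = g x)"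

end

theory Submission
  imports Defs
begin

text \<open>The theorem follows from two facts about the limit function \<open>u_inf\<close>, near a free boundary point \<open>x0\<close>.

\<^item> Growth: \<open>u_inf y \<le> ((1 - l) |y - x0|)\<close> to the power \<open>1 / (1 - l)\<close>. The right-hand side is the radial
  profile with \<open>|\<nabla>V| = V\<^sup>l\<close>, which is what the equation \<open>\<Delta>\<^sub>p u = \<lambda>\<^sub>0 u\<^sup>q\<close> degenerates to when the gradient and the
  absorption term, both raised to powers of order \<open>p\<close>, are in balance.
\<^item> Comparison with cones from above: a cone of slope \<open>m\<close> with vertex on the graph over \<open>x\<close> that lies
  above \<open>u_inf\<close> on a sphere around \<open>x\<close> lies above it inside. Hence \<open>|\<nabla>u_inf(x)| \<le> m\<close>.

If \<open>x\<close> is in the ball of radius \<open>r\<close> around \<open>x0\<close>, then on the sphere of radius \<open>r\<close> around \<open>x\<close> the growth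
bound gives \<open>u_inf \<le> (2 (1 - l) r)\<close> to the power \<open>1 / (1 - l)\<close>. So the slope \<open>m\<close> may be taken as this
number divided by \<open>r\<close>, which is exactly the asserted bound. It holds at every point of
differentiability in the ball, and therefore for the average.

Both facts are proved at the level of finite \<open>p\<close>, by comparing the weak solutions \<open>u\<^sub>p\<close> with explicit
radial barriers and then letting \<open>p\<close> tend to infinity. For the growth
bound, the solution is compared from below on an annulus around \<open>y\<close> with a decreasing profile slightly
steeper than \<open>V\<close>, a strict subsolution for large \<open>p\<close> (\<open>dead_core_growth\<close>); for the cones it is compared from
above with a slightly concave cone, which is strictly \<open>p\<close>-superharmonic for large \<open>p\<close> (\<open>cone_comparison\<close>).

Strictness keeps the comparison principle (\<open>weak_comparison\<close>) elementary, but its proof still needs the positive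
part of \<open>u\<^sub>p - V\<close> as a test function, while the weak formulation admits only \<open>C\<^sup>1\<close> functions. This gap
is closed by mollification: on compact sets a continuous Sobolev function is a uniform limit of
\<open>C\<^sup>1\<close> functions whose gradients converge in \<open>L\<^sup>p\<close> (\<open>smooth_approximation\<close>). The first part of the file
develops what this requires.\<close>

section \<open>Test functions\<close>

lemma C01_by_gradient:
  fixes \<phi> :: "'a::euclidean_space \<Rightarrow> real"
  assumes der: "\<And>x. GDERIV \<phi> x :> d\<phi> x" and cont: "continuous_on UNIV d\<phi>"
    and K: "compact K" "K \<subseteq> \<Omega>" and zero: "\<And>x. x \<notin> K \<Longrightarrow> \<phi> x = 0"
  shows "\<phi> \<in> C01 \<Omega>" and "grad \<phi> = d\<phi>"
proof -
  show eq: "grad \<phi> = d\<phi>"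
    using der by (auto intro: gderiv_imp_grad)
  have "closure {x. \<phi> x \<noteq> 0} \<subseteq> K"
    using K zero by (metis (mono_tags, lifting) closure_minimal compact_imp_closed mem_Collect_eq subsetI)
  then have "compactly_contained {x. \<phi> x \<noteq> 0} \<Omega>"
    unfolding compactly_contained_def using K
    by (meson closed_closure compact_closure closed_subset bounded_subset compact_eq_bounded_closed order_trans)
  moreover have "\<phi> differentiable (at x)" for x
    using der[of x] unfolding gderiv_def differentiable_def by blast
  ultimately show "\<phi> \<in> C01 \<Omega>"
    using cont by (simp add: C01_def eq)
qed

lemma gderiv_eq_0:
  fixes \<phi> :: "'a::euclidean_space \<Rightarrow> real"
  assumes "open U" "x \<in> U" "\<And>y. y \<in> U \<Longrightarrow> \<phi> y = 0"
  shows "GDERIV \<phi> x :> 0"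
proof -
  have "((\<lambda>x. 0::real) has_derivative (\<lambda>h. h \<bullet> 0)) (at x)" by simp
  then show ?thesis
    unfolding gderiv_def using assms(1,2) by (rule has_derivative_transform_within_open) (simp add: assms(3))
qed

lemma GDERIV_norm_diff:
  fixes x y :: "'a::euclidean_space"
  assumes "x \<noteq> y"
  shows "GDERIV (\<lambda>x. norm (x - y)) x :> sgn (x - y)"
proof -
  have "((\<lambda>x. x - y) has_derivative (\<lambda>h. h)) (at x)" by (auto intro!: derivative_eq_intros)
  moreover have "((\<lambda>x. norm x) has_derivative (\<lambda>h. h \<bullet> sgn (x - y))) (at (x - y))"
    using assms by (intro GDERIV_norm[unfolded gderiv_def]) simp
  ultimately show ?thesis unfolding gderiv_def by (rule has_derivative_compose)
qed

lemma C01_support: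
  fixes \<phi> :: "'a::euclidean_space \<Rightarrow> real"
  assumes "\<phi> \<in> C01 \<Omega>"
  obtains K where "compact K" "K \<subseteq> \<Omega>" "\<And>x. x \<notin> K \<Longrightarrow> \<phi> x = 0" "\<And>x. x \<notin> K \<Longrightarrow> grad \<phi> x = 0"
proof (rule that[of "closure {x. \<phi> x \<noteq> 0}"])
  show "compact (closure {x. \<phi> x \<noteq> 0})" "closure {x. \<phi> x \<noteq> 0} \<subseteq> \<Omega>"
    using assms by (auto simp: C01_def compactly_contained_def)
  show zero: "\<phi> x = 0" if "x \<notin> closure {x. \<phi> x \<noteq> 0}" for x
    using that by (meson closure_subset mem_Collect_eq subsetD)
  show "grad \<phi> x = 0" if "x \<notin> closure {x. \<phi> x \<noteq> 0}" for x
  proof (rule gderiv_imp_grad, rule gderiv_eq_0)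
    show "open (- closure {x. \<phi> x \<noteq> 0})" by (intro open_Compl closed_closure)
    show "x \<in> - closure {x. \<phi> x \<noteq> 0}" using that by (simp only: Compl_iff not_False_eq_True)
  qed (rule zero, erule ComplD)
qed

lemma C01_continuous:
  fixes \<phi> :: "'a::euclidean_space \<Rightarrow> real"
  assumes "\<phi> \<in> C01 \<Omega>"
  shows "continuous_on UNIV \<phi>" "continuous_on UNIV (grad \<phi>)" "GDERIV \<phi> x :> grad \<phi> x"
proof -
  show "continuous_on UNIV (grad \<phi>)" "GDERIV \<phi> x :> grad \<phi> x"
    using assms by (auto simp: C01_def intro: differentiable_imp_gderiv_grad)
  show "continuous_on UNIV \<phi>"
    using assms by (auto simp: C01_def continuous_on_eq_continuous_within intro: differentiable_imp_continuous_within)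
qed

lemma C01_mono: "\<phi> \<in> C01 A \<Longrightarrow> A \<subseteq> \<Omega> \<Longrightarrow> \<phi> \<in> C01 \<Omega>"
  by (auto simp: C01_def compactly_contained_def)

lemma integrable_bounded_support:
  fixes f :: "'a::euclidean_space \<Rightarrow> 'b::{banach,second_countable_topology}"
  assumes [measurable]: "f \<in> borel_measurable borel" and "bounded K"
    and "\<And>x. x \<notin> K \<Longrightarrow> f x = 0" and "\<And>x. norm (f x) \<le> B"
  shows "integrable lborel f"
proof -
  obtain r where r: "K \<subseteq> cball (0::'a) r"
    using bounded_subset_ballD[OF \<open>bounded K\<close>, of 0] ball_subset_cball by (meson subset_trans)
  have "integrable lborel (\<lambda>x. indicator (cball (0::'a) r) x *\<^sub>R B)"
    using emeasure_lborel_cball_finite[of "0::'a" r]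
    by (intro integrable_scaleR_left integrable_real_indicator) auto
  then show ?thesis
  proof (rule Bochner_Integration.integrable_bound)
    show "AE x in lborel. norm (f x) \<le> norm (indicator (cball 0 r) x *\<^sub>R B)"
    proof (rule AE_I2)
      fix x show "norm (f x) \<le> norm (indicator (cball 0 r) x *\<^sub>R B)"
      proof (cases "x \<in> cball 0 r")
        case False
        with r have "x \<notin> K" by blast
        then show ?thesis by (simp add: assms(3))
      qed (use assms(4)[of x] in simp)
    qed
  qed simp
qed

lemma continuous_compact_bounded:
  fixes f :: "'a::euclidean_space \<Rightarrow> 'b::real_normed_vector"
  assumes "continuous_on K f" "compact K"
  obtains B where "B > 0" "\<And>x. x \<in> K \<Longrightarrow> norm (f x) \<le> B"
  using compact_imp_bounded[OF compact_continuous_image[OF assms]] by (auto simp: bounded_pos)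

lemma compact_support_bounded:
  fixes f :: "'a::euclidean_space \<Rightarrow> 'b::real_normed_vector"
  assumes "continuous_on UNIV f" "compact K" "\<And>x. x \<notin> K \<Longrightarrow> f x = 0"
  obtains B where "B > 0" "\<And>x. norm (f x) \<le> B"
proof -
  obtain B where B: "B > 0" "\<And>x. x \<in> K \<Longrightarrow> norm (f x) \<le> B"
    using continuous_compact_bounded[OF continuous_on_subset[OF assms(1) subset_UNIV] assms(2)] by blast
  have "norm (f x) \<le> B" for x
    using B assms(3)[of x] by (cases "x \<in> K") auto
  with B that show ?thesis by blast
qed

section \<open>Mollification\<close>

text \<open>The kernel is the truncated paraboloid \<open>(e\<^sup>2 - |x|\<^sup>2)\<^sub>+\<close>, squared. It is only \<open>C\<^sup>1\<close>, which is
all that \<^const>\<open>C01\<close> asks for, and being polynomial on its support it has an explicit second-order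
remainder; integrating it is how derivatives pass under the integral sign below.\<close>

definition bump :: "real \<Rightarrow> 'a::euclidean_space \<Rightarrow> real" where
  "bump e x = (max (e\<^sup>2 - (norm x)\<^sup>2) 0)\<^sup>2"

definition dbump :: "real \<Rightarrow> 'a::euclidean_space \<Rightarrow> 'a" where
  "dbump e x = (- 4 * max (e\<^sup>2 - (norm x)\<^sup>2) 0) *\<^sub>R x"

lemma continuous_bump [continuous_intros]: "continuous_on S (bump e)"
  unfolding bump_def by (intro continuous_intros)

lemma continuous_dbump: "continuous_on S (dbump e)"
  unfolding dbump_def by (intro continuous_intros)

lemma borel_measurable_bump [measurable]: "bump e \<in> borel_measurable borel"
  by (rule borel_measurable_continuous_onI[OF continuous_bump])

lemma borel_measurable_dbump [measurable]: "dbump e \<in> borel_measurable borel"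
  by (rule borel_measurable_continuous_onI[OF continuous_dbump])

lemma bump_nonneg: "0 \<le> bump e x"
  by (simp add: bump_def)

lemma bump_le: "bump e x \<le> e ^ 4"
proof -
  have "(max (e\<^sup>2 - (norm x)\<^sup>2) 0)\<^sup>2 \<le> (e\<^sup>2)\<^sup>2"
    by (rule power_mono) auto
  then show ?thesis by (simp add: bump_def power_mult[symmetric])
qed

lemma bump_eq_0: "0 < e \<Longrightarrow> e \<le> norm x \<Longrightarrow> bump e x = 0"
  by (simp add: bump_def max_def power_mono)

lemma dbump_eq_0: "0 < e \<Longrightarrow> e \<le> norm x \<Longrightarrow> dbump e x = 0"
  by (simp add: dbump_def max_def power_mono)

lemma bump_minus: "bump e (- x) = bump e x"
  by (simp add: bump_def)

lemma positive_part_square_remainder: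
  fixes s t :: real
  shows "\<bar>(max s 0)\<^sup>2 - (max t 0)\<^sup>2 - 2 * max t 0 * (s - t)\<bar> \<le> (s - t)\<^sup>2"
proof -
  consider "s \<ge> 0" "t \<ge> 0" | "s \<ge> 0" "t < 0" | "s < 0" "t \<ge> 0" | "s < 0" "t < 0" by linarith
  then show ?thesis
  proof cases
    case 1
    then have "(max s 0)\<^sup>2 - (max t 0)\<^sup>2 - 2 * max t 0 * (s - t) = (s - t)\<^sup>2"
      by (simp add: power2_eq_square algebra_simps)
    then show ?thesis by simp
  next
    case 2
    then have "s\<^sup>2 \<le> (s - t)\<^sup>2" by (intro power_mono) auto
    with 2 show ?thesis by simp
  next
    case 3
    have "t * s \<le> 0" using 3 by (simp add: mult_nonneg_nonpos)
    then have "\<bar>t * t - 2 * (t * s)\<bar> \<le> s * s + t * t - 2 * (t * s)"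
      using zero_le_square[of s] zero_le_square[of t] by linarith
    moreover have "(max s 0)\<^sup>2 - (max t 0)\<^sup>2 - 2 * max t 0 * (s - t) = t * t - 2 * (t * s)"
      using 3 by (simp add: power2_eq_square algebra_simps)
    moreover have "(s - t)\<^sup>2 = s * s + t * t - 2 * (t * s)"
      by (simp add: power2_eq_square algebra_simps)
    ultimately show ?thesis by (simp only:)
  qed simp
qed

lemma bump_remainder:
  fixes x h :: "'a::euclidean_space"
  assumes "norm x \<le> R" "norm h \<le> 1"
  shows "\<bar>bump e (x + h) - bump e x - h \<bullet> dbump e x\<bar> \<le> ((2 * R + 1)\<^sup>2 + 2 * e\<^sup>2) * (norm h)\<^sup>2"
proof -
  define s where "s = e\<^sup>2 - (norm (x + h))\<^sup>2"
  define t where "t = e\<^sup>2 - (norm x)\<^sup>2"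
  have st: "s - t = - (2 * (x \<bullet> h) + (norm h)\<^sup>2)"
    unfolding s_def t_def by (simp add: power2_norm_eq_inner inner_add inner_commute)
  have "\<bar>x \<bullet> h\<bar> \<le> R * norm h"
    using Cauchy_Schwarz_ineq2[of x h] assms by (meson mult_right_mono norm_ge_zero order_trans)
  moreover have "(norm h)\<^sup>2 \<le> norm h"
    using assms(2) by (simp add: power2_eq_square mult_left_le)
  ultimately have "\<bar>s - t\<bar> \<le> (2 * R + 1) * norm h"
    unfolding st distrib_right mult.assoc using zero_le_power2[of "norm h"] by linarith
  then have "(s - t)\<^sup>2 \<le> ((2 * R + 1) * norm h)\<^sup>2"
    by (metis abs_ge_zero power2_abs power_mono)
  then have A: "(s - t)\<^sup>2 \<le> (2 * R + 1)\<^sup>2 * (norm h)\<^sup>2" by (simp add: power_mult_distrib)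
  have B: "max t 0 * (norm h)\<^sup>2 \<le> e\<^sup>2 * (norm h)\<^sup>2"
    by (rule mult_right_mono) (auto simp: t_def)
  have "bump e (x + h) - bump e x - h \<bullet> dbump e x
      = ((max s 0)\<^sup>2 - (max t 0)\<^sup>2 - 2 * max t 0 * (s - t)) - 2 * (max t 0 * (norm h)\<^sup>2)"
    unfolding bump_def dbump_def st s_def[symmetric] t_def[symmetric]
    by (simp add: inner_commute algebra_simps)
  moreover have "0 \<le> max t 0 * (norm h)\<^sup>2" by simp
  ultimately show ?thesis
    using positive_part_square_remainder[of s t] A B
    by (simp only: distrib_right mult.assoc) linarith
qed

lemma gderiv_if_quadratic_remainder:
  fixes f :: "'a::euclidean_space \<Rightarrow> real"
  assumes "\<And>h. norm h \<le> 1 \<Longrightarrow> \<bar>f (x + h) - f x - h \<bullet> D\<bar> \<le> C * (norm h)\<^sup>2"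
  shows "GDERIV f x :> D"
  unfolding gderiv_def has_derivative_at
proof
  show "bounded_linear (\<lambda>h. h \<bullet> D)" by (rule bounded_linear_inner_left)
  have "((\<lambda>h::'a. \<bar>C\<bar> * norm h) \<longlongrightarrow> \<bar>C\<bar> * norm (0::'a)) (at 0)"
    by (intro tendsto_intros)
  then have lim: "((\<lambda>h::'a. \<bar>C\<bar> * norm h) \<longlongrightarrow> 0) (at 0)" by simp
  show "(\<lambda>h. norm (f (x + h) - f x - h \<bullet> D) / norm h) \<midarrow>0\<rightarrow> 0"
  proof (rule Lim_null_comparison[OF _ lim])
    have "eventually (\<lambda>h::'a. norm h < 1) (at 0)"
      by (rule eventually_at_ball'[of 1 0 UNIV, simplified, THEN eventually_mono]) simp_all
    moreover have "eventually (\<lambda>h::'a. h \<noteq> 0) (at 0)"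
      by (simp add: eventually_at_filter)
    ultimately show "eventually (\<lambda>h. norm (norm (f (x + h) - f x - h \<bullet> D) / norm h) \<le> \<bar>C\<bar> * norm h) (at 0)"
    proof eventually_elim
      case (elim h)
      have "\<bar>f (x + h) - f x - h \<bullet> D\<bar> \<le> C * (norm h)\<^sup>2" using assms elim by simp
      also have "\<dots> \<le> \<bar>C\<bar> * (norm h)\<^sup>2" by (intro mult_right_mono) auto
      finally show ?case using elim by (simp add: divide_le_eq power2_eq_square mult.assoc)
    qed
  qed
qed

lemma gderiv_bump: "GDERIV (bump e) x :> dbump e x"
  by (rule gderiv_if_quadratic_remainder[OF bump_remainder]) auto

definition bump_mass :: "'a::euclidean_space itself \<Rightarrow> real \<Rightarrow> real" where
  "bump_mass _ e = (LBINT x. bump e (x::'a))"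

text \<open>Convolution with the kernel divided by its mass, so that constants are reproduced.\<close>

definition mollify :: "real \<Rightarrow> ('a::euclidean_space \<Rightarrow> 'b::{banach,second_countable_topology}) \<Rightarrow> 'a \<Rightarrow> 'b" where
  "mollify e f x = (LBINT y. bump e (x - y) *\<^sub>R f y) /\<^sub>R bump_mass TYPE('a) e"

lemma integrable_bump: "0 < e \<Longrightarrow> integrable lborel (bump e)"
  by (rule integrable_bounded_support[of _ "ball 0 e" "e ^ 4"])
     (auto intro: bump_eq_0 simp: bump_nonneg bump_le)

lemma bump_mass_pos:
  assumes "0 < e" shows "0 < bump_mass TYPE('a::euclidean_space) e"
proof -
  have "0 \<le> bump_mass TYPE('a) e"
    by (simp add: bump_mass_def bump_nonneg)
  moreover have "bump_mass TYPE('a) e \<noteq> 0"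
  proof
    assume "bump_mass TYPE('a) e = 0"
    then have "AE x::'a in lborel. bump e x = 0"
      unfolding bump_mass_def
      by (subst (asm) integral_nonneg_eq_0_iff_AE) (auto simp: bump_nonneg integrable_bump assms)
    then have "AE x::'a in lborel. x \<notin> ball 0 e"
    proof eventually_elim
      case (elim x)
      show ?case
      proof
        assume "x \<in> ball 0 e"
        then have "(norm x)\<^sup>2 < e\<^sup>2" by (intro power_strict_mono) auto
        with elim show False by (auto simp: bump_def max_def split: if_splits)
      qed
    qed
    then have "emeasure lborel (ball (0::'a) e) = 0"
      by (subst (asm) AE_iff_measurable[OF _ refl]) (auto simp: ball_def)
    then show False
      using assms emeasure_lborel_ball_finite[of "0::'a" e] open_not_negligible[of "ball (0::'a) e"]
      by (simp add: negligible_iff_emeasure0)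
  qed
  ultimately show ?thesis by linarith
qed

lemma integrable_bump_shift:
  assumes "0 < e" shows "integrable lborel (\<lambda>y. bump e (x - y))" 
  by (rule integrable_bounded_support[of _ "ball x e" "e ^ 4"])
     (use assms in \<open>auto intro!: bump_eq_0 simp: bump_nonneg bump_le dist_norm\<close>)

lemma lborel_reflect: "distr lborel borel (\<lambda>y. x - y) = (lborel :: 'a::euclidean_space measure)"
  using lborel_affine[of "-1" x] by (simp add: density_1)

lemma integral_bump_shift:
  "(LBINT y. bump e (x - y)) = bump_mass TYPE('a) e" for x :: "'a::euclidean_space"
proof -
  have "(LINT y|distr lborel borel (\<lambda>y. x - y). bump e y) = (LBINT y. bump e (x - y))"
    by (rule integral_distr) simp_all
  then show ?thesis by (simp add: bump_mass_def lborel_reflect)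
qed

lemma bounded_dbump:
  assumes "0 < e" obtains B where "\<And>x::'a::euclidean_space. norm (dbump e x) \<le> B"
  using compact_support_bounded[of "dbump e :: 'a \<Rightarrow> 'a" "cball 0 e"] continuous_dbump assms
  by (metis compact_cball dbump_eq_0 linorder_not_less mem_cball_0 order_less_imp_le)

lemma integrable_bump_scaleR:
  fixes f :: "'a::euclidean_space \<Rightarrow> 'b::euclidean_space"
  assumes [measurable]: "f \<in> borel_measurable borel" and "integrable lborel f"
  shows "integrable lborel (\<lambda>y. bump e (x - y) *\<^sub>R f y)"
  by (rule Bochner_Integration.integrable_bound[of _ "\<lambda>y. e ^ 4 * norm (f y)"])
    (use assms in \<open>auto intro!: mult_right_mono simp: abs_mult bump_nonneg bump_le\<close>)

text \<open>The remainder of the kernel is \<open>O(|h|\<^sup>2)\<close> uniformly over the bounded support of \<open>u\<close>, so integrating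
it against \<open>u\<close> leaves a remainder of the same order.\<close>

lemma gderiv_mollify:
  fixes u :: "'a::euclidean_space \<Rightarrow> real"
  assumes [measurable]: "u \<in> borel_measurable borel" and B: "\<And>x. \<bar>u x\<bar> \<le> B"
    and K: "bounded K" "\<And>x. x \<notin> K \<Longrightarrow> u x = 0" and e: "0 < e"
  shows "GDERIV (mollify e u) x :> (LBINT y. u y *\<^sub>R dbump e (x - y)) /\<^sub>R bump_mass TYPE('a) e"
proof -
  define W where "W = (LBINT y. u y *\<^sub>R dbump e (x - y))"
  define Z where "Z = bump_mass TYPE('a) e"
  have Z: "0 < Z" unfolding Z_def using bump_mass_pos[OF e] .
  obtain r where r: "K \<subseteq> ball (0::'a) r" using bounded_subset_ballD[OF K(1)] by blast
  define R where "R = norm x + r"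
  define C where "C = (2 * R + 1)\<^sup>2 + 2 * e\<^sup>2"
  obtain D where D: "\<And>x::'a. norm (dbump e x) \<le> D" using bounded_dbump[OF e] by blast
  have B0: "0 \<le> B" using B[of 0] by linarith
  have int_u: "integrable lborel u"
    using K B by (intro integrable_bounded_support[of u K B]) auto
  have int_b: "integrable lborel (\<lambda>y. bump e (z - y) *\<^sub>R u y)" for z
    using K by (intro integrable_bounded_support[where K=K and B="e^4 * B"])
      (auto simp: abs_mult bump_nonneg intro!: mult_mono bump_le B)
  have int_d: "integrable lborel (\<lambda>y. u y *\<^sub>R dbump e (x - y))"
    using K by (intro integrable_bounded_support[where K=K and B="B * D"])
      (auto intro!: mult_mono D B B0)
  have key: "\<bar>(LBINT y. bump e (x + h - y) *\<^sub>R u y) - (LBINT y. bump e (x - y) *\<^sub>R u y) - h \<bullet> W\<bar>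
      \<le> C * (norm h)\<^sup>2 * (LBINT y. \<bar>u y\<bar>)" if h: "norm h \<le> 1" for h
  proof -
    have int_h: "integrable lborel (\<lambda>y. h \<bullet> (u y *\<^sub>R dbump e (x - y)))"
      by (rule integrable_inner_right) (rule int_d)
    have "h \<bullet> W = (LBINT y. h \<bullet> (u y *\<^sub>R dbump e (x - y)))"
      unfolding W_def by (rule integral_inner_right[symmetric]) (rule int_d)
    then have "(LBINT y. bump e (x + h - y) *\<^sub>R u y) - (LBINT y. bump e (x - y) *\<^sub>R u y) - h \<bullet> W
      = (LBINT y. bump e (x + h - y) *\<^sub>R u y - bump e (x - y) *\<^sub>R u y - h \<bullet> (u y *\<^sub>R dbump e (x - y)))"
      unfolding Bochner_Integration.integral_diff[OF Bochner_Integration.integrable_diff[OF int_b int_b] int_h]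
        Bochner_Integration.integral_diff[OF int_b int_b] by simp
    also have "norm \<dots> \<le> (LBINT y. C * (norm h)\<^sup>2 * \<bar>u y\<bar>)"
    proof (rule Bochner_Integration.integral_norm_bound_integral)
      show "integrable lborel (\<lambda>y. bump e (x + h - y) *\<^sub>R u y - bump e (x - y) *\<^sub>R u y - h \<bullet> (u y *\<^sub>R dbump e (x - y)))"
        by (rule Bochner_Integration.integrable_diff[OF Bochner_Integration.integrable_diff[OF int_b int_b] int_h])
      show "integrable lborel (\<lambda>y. C * (norm h)\<^sup>2 * \<bar>u y\<bar>)" using int_u by auto
      fix y
      show "norm (bump e (x + h - y) *\<^sub>R u y - bump e (x - y) *\<^sub>R u y - h \<bullet> (u y *\<^sub>R dbump e (x - y)))
        \<le> C * (norm h)\<^sup>2 * \<bar>u y\<bar>"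
      proof (cases "y \<in> K")
        case True
        then have "norm y < r" using r by auto
        then have "norm (x - y) \<le> R" unfolding R_def using norm_triangle_ineq4[of x y] by linarith
        from bump_remainder[OF this h, of e]
        have "\<bar>bump e (x - y + h) - bump e (x - y) - h \<bullet> dbump e (x - y)\<bar> * \<bar>u y\<bar> \<le> C * (norm h)\<^sup>2 * \<bar>u y\<bar>"
          unfolding C_def by (rule mult_right_mono) simp
        moreover have "bump e (x + h - y) *\<^sub>R u y - bump e (x - y) *\<^sub>R u y - h \<bullet> (u y *\<^sub>R dbump e (x - y))
           = (bump e (x - y + h) - bump e (x - y) - h \<bullet> dbump e (x - y)) * u y"
          by (simp add: algebra_simps)
        ultimately show ?thesis by (simp add: abs_mult)
      qed (simp add: K)
    qed
    finally show ?thesis by simp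
  qed
  have "GDERIV (\<lambda>x. LBINT y. bump e (x - y) *\<^sub>R u y) x :> W"
  proof (rule gderiv_if_quadratic_remainder[where C="C * (LBINT y. \<bar>u y\<bar>)"])
    fix h :: 'a assume "norm h \<le> 1"
    from key[OF this] show "\<bar>(LBINT y. bump e (x + h - y) *\<^sub>R u y) - (LBINT y. bump e (x - y) *\<^sub>R u y) - h \<bullet> W\<bar>
      \<le> C * (LBINT y. \<bar>u y\<bar>) * (norm h)\<^sup>2"
      by (simp add: mult_ac)
  qed
  from GDERIV_mult[OF GDERIV_const[of "inverse Z"] this] show ?thesis
    unfolding mollify_def[abs_def] W_def Z_def by simp
qed

lemma continuous_mollified_gradient:
  fixes u :: "'a::euclidean_space \<Rightarrow> real"
  assumes [measurable]: "u \<in> borel_measurable borel" and int_u: "integrable lborel u" and e: "0 < e"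
  shows "continuous_on UNIV (\<lambda>x. (LBINT y. u y *\<^sub>R dbump e (x - y)) /\<^sub>R bump_mass TYPE('a) e)"
proof -
  obtain D where D: "\<And>x::'a. norm (dbump e x) \<le> D" using bounded_dbump[OF e] by blast
  have "(\<lambda>n. LBINT y. u y *\<^sub>R dbump e (X n - y)) \<longlonglongrightarrow> (LBINT y. u y *\<^sub>R dbump e (x - y))"
    if "X \<longlonglongrightarrow> x" for X x
  proof (rule integral_dominated_convergence)
    show "integrable lborel (\<lambda>y. \<bar>u y\<bar> * D)" using int_u by auto
    show "AE y in lborel. (\<lambda>n. u y *\<^sub>R dbump e (X n - y)) \<longlonglongrightarrow> u y *\<^sub>R dbump e (x - y)"
    proof (rule AE_I2)
      fix y
      have "isCont (dbump e) (x - y)"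
        using continuous_dbump[of UNIV e] continuous_on_eq_continuous_at[OF open_UNIV] by blast
      moreover have "(\<lambda>n. X n - y) \<longlonglongrightarrow> x - y" using that by (intro tendsto_intros)
      ultimately have "(\<lambda>n. dbump e (X n - y)) \<longlonglongrightarrow> dbump e (x - y)"
        by (rule isCont_tendsto_compose)
      then show "(\<lambda>n. u y *\<^sub>R dbump e (X n - y)) \<longlonglongrightarrow> u y *\<^sub>R dbump e (x - y)"
        by (intro tendsto_intros)
    qed
    show "AE y in lborel. norm (u y *\<^sub>R dbump e (X n - y)) \<le> \<bar>u y\<bar> * D" for n
      by (auto intro!: AE_I2 mult_left_mono D)
  qed auto
  then have "continuous_on UNIV (\<lambda>x. LBINT y. u y *\<^sub>R dbump e (x - y))"
    by (auto simp: continuous_on_eq_continuous_at continuous_at_sequentially o_def)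
  then show ?thesis by (intro continuous_intros)
qed

text \<open>Mollification is an average over the ball of radius \<open>e\<close>. With \<open>c = f x\<close> this is convergence at points
of continuity; with \<open>c = 0\<close> and \<open>t = 0\<close> it locates the support.\<close>

lemma mollify_near:
  fixes f :: "'a::euclidean_space \<Rightarrow> 'b::euclidean_space"
  assumes e: "0 < e" and int: "integrable lborel (\<lambda>y. bump e (x - y) *\<^sub>R f y)"
    and near: "\<And>y. dist x y < e \<Longrightarrow> norm (f y - c) \<le> t"
  shows "norm (mollify e f x - c) \<le> t"
proof -
  define Z where "Z = bump_mass TYPE('a) e"
  have Z: "0 < Z" unfolding Z_def using bump_mass_pos[OF e] .
  have Zi: "(LBINT y. bump e (x - y)) = Z" by (simp add: Z_def integral_bump_shift)
  have "Z *\<^sub>R (mollify e f x - c) = (LBINT y. bump e (x - y) *\<^sub>R f y) - Z *\<^sub>R c"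
    using Z by (simp add: mollify_def Z_def[symmetric] scaleR_diff_right)
  also have "Z *\<^sub>R c = (LBINT y. bump e (x - y) *\<^sub>R c)"
    using integrable_bump_shift[OF e, of x] by (simp add: Zi)
  also have "(LBINT y. bump e (x - y) *\<^sub>R f y) - \<dots> = (LBINT y. bump e (x - y) *\<^sub>R f y - bump e (x - y) *\<^sub>R c)"
    using integrable_bump_shift[OF e, of x] int by simp
  also have "norm \<dots> \<le> (LBINT y. bump e (x - y) * t)"
  proof (rule Bochner_Integration.integral_norm_bound_integral)
    show "integrable lborel (\<lambda>y. bump e (x - y) *\<^sub>R f y - bump e (x - y) *\<^sub>R c)"
      "integrable lborel (\<lambda>y. bump e (x - y) * t)"
      using integrable_bump_shift[OF e, of x] int by auto
    fix y
    show "norm (bump e (x - y) *\<^sub>R f y - bump e (x - y) *\<^sub>R c) \<le> bump e (x - y) * t"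
    proof (cases "dist x y < e")
      case True
      from mult_left_mono[OF near[OF this] bump_nonneg[of e "x - y"]] show ?thesis
        by (simp add: scaleR_diff_right[symmetric] bump_nonneg)
    next
      case False
      then show ?thesis using bump_eq_0[of e "x - y"] e by (simp add: dist_norm)
    qed
  qed
  also have "\<dots> = Z * t" by (simp add: Zi)
  finally show ?thesis using Z by simp
qed

lemma powr_above_tangent:
  fixes s t p :: real
  assumes "0 \<le> s" "0 \<le> t" "1 \<le> p"
  shows "s powr p + p * s powr (p - 1) * (t - s) \<le> t powr p"
proof (cases "s = 0 \<or> t = 0")
  case True
  then show ?thesis
  proof
    assume t: "t = 0"
    show ?thesis
    proof (cases "s = 0")
      case False
      then have "s powr (p - 1) * s = s powr p"
        using assms powr_add[of s "p - 1" 1] by simp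
      then have "s powr p + p * s powr (p - 1) * (t - s) = (1 - p) * s powr p"
        using t by (simp add: algebra_simps)
      then show ?thesis using t assms by (simp add: mult_nonpos_nonneg)
    qed (use assms t in auto)
  qed (use assms in auto)
next
  case False
  then have st: "0 < s" "0 < t" using assms by auto
  have "((\<lambda>x. x powr p) has_real_derivative p * s powr (p - 1)) (at s within {0<..})"
    using st by (auto intro!: derivative_eq_intros)
  from convex_on_imp_above_tangent[OF powr_convex[OF \<open>1 \<le> p\<close>] _ _ _ this, of t] st
  show ?thesis by (simp add: interior_open)
qed

text \<open>Jensen's inequality, obtained by integrating the tangent line of \<open>t \<mapsto> t\<^sup>p\<close> at the mean value \<open>s\<close> of
\<open>norm f\<close>: the linear term integrates to zero.\<close>

lemma mollify_Jensen:
  fixes f :: "'a::euclidean_space \<Rightarrow> 'b::euclidean_space"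
  assumes e: "0 < e" and p: "1 \<le> p"
    and [measurable]: "f \<in> borel_measurable borel"
    and f: "integrable lborel f" and fp: "integrable lborel (\<lambda>x. norm (f x) powr p)"
  shows "bump_mass TYPE('a) e * norm (mollify e f x) powr p \<le> (LBINT y. bump e (x - y) * norm (f y) powr p)"
proof -
  define Z where "Z = bump_mass TYPE('a) e"
  have Z: "0 < Z" unfolding Z_def using bump_mass_pos[OF e] .
  have Zi: "(LBINT y. bump e (x - y)) = Z" by (simp add: Z_def integral_bump_shift)
  have i0: "integrable lborel (\<lambda>y. bump e (x - y))" by (rule integrable_bump_shift[OF e])
  have i1: "integrable lborel (\<lambda>y. bump e (x - y) * norm (f y))"
    by (rule integrable_bump_scaleR[of "\<lambda>y. norm (f y)", unfolded real_scaleR_def]) (measurable, rule integrable_norm[OF f])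
  have ip: "integrable lborel (\<lambda>y. bump e (x - y) * norm (f y) powr p)"
    by (rule integrable_bump_scaleR[of "\<lambda>y. norm (f y) powr p", unfolded real_scaleR_def]) (measurable, rule fp)
  define s where "s = (LBINT y. bump e (x - y) * norm (f y)) / Z"
  have s0: "0 \<le> s" unfolding s_def using Z by (intro divide_nonneg_pos integral_nonneg_AE AE_I2) (auto simp: bump_nonneg)
  have "norm (mollify e f x) \<le> s"
  proof -
    have "norm (LBINT y. bump e (x - y) *\<^sub>R f y) \<le> (LBINT y. norm (bump e (x - y) *\<^sub>R f y))"
      by (rule integral_norm_bound)
    also have "\<dots> = (LBINT y. bump e (x - y) * norm (f y))" by (simp add: bump_nonneg)
    finally show ?thesis using Z by (simp add: mollify_def Z_def[symmetric] s_def divide_right_mono divide_inverse_commute)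
  qed
  then have "Z * norm (mollify e f x) powr p \<le> Z * s powr p"
    using Z p by (intro mult_left_mono powr_mono2) auto
  also have "Z * s powr p = (LBINT y. bump e (x - y) * (s powr p + p * s powr (p - 1) * (norm (f y) - s)))"
  proof -
    have "(LBINT y. bump e (x - y) * (s powr p + p * s powr (p - 1) * (norm (f y) - s)))
      = (LBINT y. (s powr p - p * s powr (p - 1) * s) * bump e (x - y) + p * s powr (p - 1) * (bump e (x - y) * norm (f y)))"
      by (rule Bochner_Integration.integral_cong) (simp_all add: algebra_simps)
    also have "\<dots> = (s powr p - p * s powr (p - 1) * s) * Z + p * s powr (p - 1) * (s * Z)"
      using i0 i1 Z by (simp add: Zi s_def)
    finally show ?thesis by (simp add: algebra_simps)
  qed
  also have "\<dots> \<le> (LBINT y. bump e (x - y) * norm (f y) powr p)"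
  proof (rule integral_mono)
    have "integrable lborel (\<lambda>y. (s powr p - p * s powr (p - 1) * s) * bump e (x - y) + p * s powr (p - 1) * (bump e (x - y) * norm (f y)))"
      using i0 i1 by auto
    then show "integrable lborel (\<lambda>y. bump e (x - y) * (s powr p + p * s powr (p - 1) * (norm (f y) - s)))"
      by (rule Bochner_Integration.integrable_cong[THEN iffD1, rotated 2]) (simp_all add: algebra_simps)
    show "bump e (x - y) * (s powr p + p * s powr (p - 1) * (norm (f y) - s)) \<le> bump e (x - y) * norm (f y) powr p" for y
      using s0 p by (intro mult_left_mono powr_above_tangent bump_nonneg) auto
  qed (rule ip)
  finally show ?thesis by (simp add: Z_def)
qed

lemma borel_measurable_mollify [measurable]:
  fixes f :: "'a::euclidean_space \<Rightarrow> 'b::euclidean_space"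
  assumes [measurable]: "f \<in> borel_measurable borel"
  shows "mollify e f \<in> borel_measurable borel"
  unfolding mollify_def[abs_def] by measurable

text \<open>Jensen's inequality holds pointwise; exchanging the order of integration then lets the kernel
integrate to its mass.\<close>

lemma mollify_Lp_contraction:
  fixes f :: "'a::euclidean_space \<Rightarrow> 'b::euclidean_space"
  assumes e: "0 < e" and p: "1 \<le> p"
    and [measurable]: "f \<in> borel_measurable borel"
    and f: "integrable lborel f" and fp: "integrable lborel (\<lambda>x. norm (f x) powr p)"
  shows "(\<integral>\<^sup>+x. norm (mollify e f x) powr p \<partial>lborel) \<le> (\<integral>\<^sup>+x. norm (f x) powr p \<partial>lborel)"
proof -
  define Z where "Z = bump_mass TYPE('a) e"
  have Z: "0 < Z" unfolding Z_def using bump_mass_pos[OF e] .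
  have ip: "integrable lborel (\<lambda>y. bump e (x - y) * norm (f y) powr p)" for x
    by (rule integrable_bump_scaleR[of "\<lambda>y. norm (f y) powr p", unfolded real_scaleR_def]) (measurable, rule fp)
  have mass: "(\<integral>\<^sup>+x. ennreal (bump e (x - y)) \<partial>lborel) = ennreal Z" for y :: 'a
  proof -
    have "(\<integral>\<^sup>+x. ennreal (bump e (x - y)) \<partial>lborel) = (\<integral>\<^sup>+x. ennreal (bump e (y - x)) \<partial>lborel)"
      by (metis bump_minus minus_diff_eq)
    also have "\<dots> = ennreal Z"
      using nn_integral_eq_integral[OF integrable_bump_shift[OF e, of y]] by (simp add: bump_nonneg Z_def integral_bump_shift)
    finally show ?thesis .
  qed
  have "ennreal Z * (\<integral>\<^sup>+x. norm (mollify e f x) powr p \<partial>lborel) = (\<integral>\<^sup>+x. ennreal (Z * norm (mollify e f x) powr p) \<partial>lborel)"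
    using Z by (subst nn_integral_cmult[symmetric]) (auto simp: ennreal_mult)
  also have "\<dots> \<le> (\<integral>\<^sup>+x. (\<integral>\<^sup>+y. ennreal (bump e (x - y) * norm (f y) powr p) \<partial>lborel) \<partial>lborel)"
  proof (rule nn_integral_mono)
    fix x
    have "ennreal (Z * norm (mollify e f x) powr p) \<le> ennreal (LBINT y. bump e (x - y) * norm (f y) powr p)"
      unfolding Z_def by (intro ennreal_leI mollify_Jensen assms)
    also have "\<dots> = (\<integral>\<^sup>+y. ennreal (bump e (x - y) * norm (f y) powr p) \<partial>lborel)"
      by (rule nn_integral_eq_integral[symmetric]) (use ip in \<open>auto simp: bump_nonneg\<close>)
    finally show "ennreal (Z * norm (mollify e f x) powr p) \<le> (\<integral>\<^sup>+y. ennreal (bump e (x - y) * norm (f y) powr p) \<partial>lborel)" .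
  qed
  also have "\<dots> = (\<integral>\<^sup>+y. (\<integral>\<^sup>+x. ennreal (bump e (x - y) * norm (f y) powr p) \<partial>lborel) \<partial>lborel)"
    by (rule lborel_pair.Fubini') measurable
  also have "\<dots> = (\<integral>\<^sup>+y. ennreal Z * ennreal (norm (f y) powr p) \<partial>lborel)"
    by (rule nn_integral_cong) (simp add: ennreal_mult'' nn_integral_multc mass)
  also have "\<dots> = ennreal Z * (\<integral>\<^sup>+x. norm (f x) powr p \<partial>lborel)"
    by (rule nn_integral_cmult) measurable
  finally show ?thesis
    using Z by (simp add: ennreal_mult_le_mult_iff)
qed

section \<open>Approximation in the mean of order p\<close>

lemma powr_add_le:
  fixes a b p :: real
  assumes "0 \<le> a" "0 \<le> b" "0 \<le> p"
  shows "(a + b) powr p \<le> 2 powr p * (a powr p + b powr p)"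
proof -
  have "(a + b) powr p \<le> (2 * max a b) powr p"
    using assms by (intro powr_mono2) auto
  also have "\<dots> = 2 powr p * max a b powr p"
    by (rule powr_mult)
  also have "max a b powr p \<le> a powr p + b powr p"
    by (auto simp: max_def)
  finally show ?thesis by simp
qed

text \<open>A quasi-triangle inequality for the \<open>p\<close>-th power of the norm. The constant \<open>2\<^sup>p\<close> is harmless because
it is used with a fixed \<open>p\<close> and arbitrarily small right-hand sides.\<close>

lemma Lp_triangle:
  fixes f g h :: "'a::euclidean_space \<Rightarrow> 'b::euclidean_space"
  assumes [measurable]: "f \<in> borel_measurable borel" "g \<in> borel_measurable borel" "h \<in> borel_measurable borel"
    and "0 \<le> p"
    and "(\<integral>\<^sup>+x. norm (f x - g x) powr p \<partial>lborel) \<le> ennreal s" "(\<integral>\<^sup>+x. norm (g x - h x) powr p \<partial>lborel) \<le> ennreal t"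
    and "0 \<le> s" "0 \<le> t"
  shows "(\<integral>\<^sup>+x. norm (f x - h x) powr p \<partial>lborel) \<le> ennreal (2 powr p * (s + t))"
proof -
  have "(\<integral>\<^sup>+x. norm (f x - h x) powr p \<partial>lborel)
    \<le> (\<integral>\<^sup>+x. ennreal (2 powr p) * (ennreal (norm (f x - g x) powr p) + ennreal (norm (g x - h x) powr p)) \<partial>lborel)"
  proof (rule nn_integral_mono)
    fix x
    have "norm (f x - h x) \<le> norm (f x - g x) + norm (g x - h x)"
      using norm_triangle_ineq[of "f x - g x" "g x - h x"] by simp
    then have "norm (f x - h x) powr p \<le> (norm (f x - g x) + norm (g x - h x)) powr p"
      using \<open>0 \<le> p\<close> by (intro powr_mono2) auto
    also have "\<dots> \<le> 2 powr p * (norm (f x - g x) powr p + norm (g x - h x) powr p)"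
      using \<open>0 \<le> p\<close> by (intro powr_add_le) auto
    finally have "ennreal (norm (f x - h x) powr p) \<le> ennreal (2 powr p * (norm (f x - g x) powr p + norm (g x - h x) powr p))"
      by (rule ennreal_leI)
    then show "ennreal (norm (f x - h x) powr p) \<le> ennreal (2 powr p) * (ennreal (norm (f x - g x) powr p) + ennreal (norm (g x - h x) powr p))"
      by (simp add: ennreal_mult)
  qed
  also have "\<dots> = ennreal (2 powr p) * ((\<integral>\<^sup>+x. norm (f x - g x) powr p \<partial>lborel) + (\<integral>\<^sup>+x. norm (g x - h x) powr p \<partial>lborel))"
    by (subst nn_integral_cmult, simp, subst nn_integral_add) simp_all
  also have "\<dots> \<le> ennreal (2 powr p) * (ennreal s + ennreal t)"
    using assms by (intro mult_left_mono add_mono) auto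
  also have "\<dots> = ennreal (2 powr p * (s + t))"
    using assms by (simp add: ennreal_mult)
  finally show ?thesis .
qed

text \<open>The radial retraction onto the ball of radius \<open>M\<close>. It is continuous, so it may be composed with
continuous approximations to make them dominated.\<close>

definition clamp_norm :: "real \<Rightarrow> 'b::real_normed_vector \<Rightarrow> 'b" where
  "clamp_norm M v = v /\<^sub>R max 1 (norm v / M)"

lemma continuous_clamp_norm: "0 < M \<Longrightarrow> continuous_on S (clamp_norm M)"
  unfolding clamp_norm_def by (intro continuous_intros) auto

lemma clamp_norm_id: "norm v \<le> M \<Longrightarrow> 0 < M \<Longrightarrow> clamp_norm M v = v"
  by (simp add: clamp_norm_def max_def divide_le_eq)

lemma clamp_norm_0 [simp]: "clamp_norm M 0 = 0"
  by (simp add: clamp_norm_def)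

lemma norm_clamp_norm: "0 < M \<Longrightarrow> norm (clamp_norm M v) \<le> M"
  by (auto simp: clamp_norm_def max_def field_simps)

lemma norm_diff_clamp_norm: "0 < M \<Longrightarrow> norm (v - clamp_norm M v) \<le> norm v"
proof -
  assume "0 < M"
  define c where "c = inverse (max 1 (norm v / M))"
  have c: "0 \<le> c" "c \<le> 1" unfolding c_def by (auto simp: inverse_le_1_iff le_max_iff_disj)
  have "v - clamp_norm M v = (1 - c) *\<^sub>R v" by (simp add: clamp_norm_def c_def scaleR_diff_left)
  then have "norm (v - clamp_norm M v) = (1 - c) * norm v" using c by simp
  then show ?thesis using c by (simp add: mult_left_le_one_le)
qed

lemma Lp_dense_truncation:
  fixes f :: "'a::euclidean_space \<Rightarrow> 'b::euclidean_space"
  assumes [measurable]: "f \<in> borel_measurable borel" and p: "1 \<le> p"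
    and fp: "integrable lborel (\<lambda>x. norm (f x) powr p)" and \<eta>: "0 < \<eta>"
  obtains M where "0 < M" "(\<integral>\<^sup>+x. norm (f x - clamp_norm M (f x)) powr p \<partial>lborel) \<le> ennreal \<eta>"
proof -
  have [measurable]: "clamp_norm (real (Suc n)) \<in> borel_measurable (borel :: 'b measure)" for n
    by (intro borel_measurable_continuous_onI continuous_clamp_norm) simp
  have "(\<lambda>n. \<integral>\<^sup>+x. norm (f x - clamp_norm (real (Suc n)) (f x)) powr p \<partial>lborel) \<longlonglongrightarrow> (\<integral>\<^sup>+x. 0 \<partial>(lborel :: 'a measure))"
  proof (rule nn_integral_dominated_convergence[where w="\<lambda>x. ennreal (norm (f x) powr p)"])
    show "AE x in lborel. ennreal (norm (f x - clamp_norm (real (Suc n)) (f x)) powr p) \<le> ennreal (norm (f x) powr p)" for n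
      using p by (intro AE_I2 ennreal_leI powr_mono2 norm_diff_clamp_norm) auto
    show "(\<integral>\<^sup>+x. ennreal (norm (f x) powr p) \<partial>lborel) < \<infinity>"
      using fp by (simp add: integrable_iff_bounded)
    show "AE x in lborel. (\<lambda>n. ennreal (norm (f x - clamp_norm (real (Suc n)) (f x)) powr p)) \<longlonglongrightarrow> 0"
    proof (rule AE_I2)
      fix x
      obtain n0 where n0: "norm (f x) \<le> real n0" using real_arch_simple by blast
      have "eventually (\<lambda>n. n0 \<le> n) sequentially" by (rule eventually_ge_at_top)
      then have "eventually (\<lambda>n. ennreal (norm (f x - clamp_norm (real (Suc n)) (f x)) powr p) = 0) sequentially"
      proof eventually_elim
        case (elim n)
        then have "clamp_norm (real (Suc n)) (f x) = f x" using n0 by (intro clamp_norm_id) auto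
        then show ?case by simp
      qed
      then show "(\<lambda>n. ennreal (norm (f x - clamp_norm (real (Suc n)) (f x)) powr p)) \<longlonglongrightarrow> 0"
        by (rule tendsto_eventually)
    qed
  qed measurable
  then have "(\<lambda>n. \<integral>\<^sup>+x. norm (f x - clamp_norm (real (Suc n)) (f x)) powr p \<partial>lborel) \<longlonglongrightarrow> 0" by simp
  then have "eventually (\<lambda>n. (\<integral>\<^sup>+x. norm (f x - clamp_norm (real (Suc n)) (f x)) powr p \<partial>lborel) < ennreal \<eta>) sequentially"
    using \<eta> by (intro order_tendstoD(2)) auto
  then obtain n where "(\<integral>\<^sup>+x. norm (f x - clamp_norm (real (Suc n)) (f x)) powr p \<partial>lborel) < ennreal \<eta>"
    by (auto simp: eventually_sequentially)
  then show ?thesis by (intro that[of "real (Suc n)"]) auto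
qed

text \<open>A measurable function is almost everywhere a limit of continuous ones. After truncating \<open>f\<close> at
height \<open>M\<close>, the approximations may be clamped to the same height and cut off outside a ball without
spoiling the convergence, and then dominated convergence applies.\<close>

lemma Lp_dense_continuous:
  fixes f :: "'a::euclidean_space \<Rightarrow> 'b::euclidean_space"
  assumes [measurable]: "f \<in> borel_measurable borel" and p: "1 \<le> p"
    and fp: "integrable lborel (\<lambda>x. norm (f x) powr p)"
    and R: "\<And>x. R < norm x \<Longrightarrow> f x = 0" and \<eta>: "0 < \<eta>"
  obtains g where "continuous_on UNIV g" "\<And>x. R + 1 < norm x \<Longrightarrow> g x = 0"
    "(\<integral>\<^sup>+x. norm (f x - g x) powr p \<partial>lborel) \<le> ennreal \<eta>"
proof -
  define \<eta>' where "\<eta>' = \<eta> / (2 * 2 powr p)"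
  have \<eta>': "0 < \<eta>'" using \<eta> by (simp add: \<eta>'_def)
  obtain M where M: "0 < M" "(\<integral>\<^sup>+x. norm (f x - clamp_norm M (f x)) powr p \<partial>lborel) \<le> ennreal \<eta>'"
    using Lp_dense_truncation[OF assms(1) p fp \<eta>'] by blast
  have [measurable]: "clamp_norm M \<in> borel_measurable (borel :: 'b measure)"
    by (intro borel_measurable_continuous_onI continuous_clamp_norm M)
  have "f measurable_on UNIV"
    by (rule lebesgue_measurable_imp_measurable_on) (auto intro: measurable_completion)
  then obtain N g where N: "negligible N" and g: "\<And>n. continuous_on UNIV (g n)"
    and lim: "\<And>x. x \<notin> N \<Longrightarrow> (\<lambda>n. g n x) \<longlonglongrightarrow> f x"
    unfolding measurable_on_def by auto
  define cut where "cut = (\<lambda>x::'a. max 0 (min 1 (R + 1 - norm x)))"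
  have cut_cont: "continuous_on UNIV cut" unfolding cut_def by (intro continuous_intros)
  define k where "k = (\<lambda>n x. cut x *\<^sub>R clamp_norm M (g n x))"
  have k_cont: "continuous_on UNIV (k n)" for n
    unfolding k_def
    by (intro continuous_intros cut_cont continuous_on_compose2[OF continuous_clamp_norm[OF M(1)] g]) auto
  then have [measurable]: "k n \<in> borel_measurable borel" for n
    by (rule borel_measurable_continuous_onI)
  have k0: "k n x = 0" if "R + 1 < norm x" for n x
    using that by (simp add: k_def cut_def)
  have k_le: "norm (k n x) \<le> M" for n x
  proof -
    have "norm (k n x) = \<bar>cut x\<bar> * norm (clamp_norm M (g n x))" by (simp add: k_def)
    also have "\<dots> \<le> 1 * M" using M by (intro mult_mono norm_clamp_norm) (auto simp: cut_def)
    finally show ?thesis by simp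
  qed
  have "(\<lambda>n. \<integral>\<^sup>+x. norm (clamp_norm M (f x) - k n x) powr p \<partial>lborel) \<longlonglongrightarrow> (\<integral>\<^sup>+x. 0 \<partial>(lborel :: 'a measure))"
  proof (rule nn_integral_dominated_convergence[where w="\<lambda>x. ennreal ((2 * M) powr p) * indicator (cball 0 (R + 1)) x"])
    show "AE x in lborel. ennreal (norm (clamp_norm M (f x) - k n x) powr p) \<le> ennreal ((2 * M) powr p) * indicator (cball 0 (R + 1)) x" for n
    proof (rule AE_I2)
      fix x
      have "norm (clamp_norm M (f x) - k n x) \<le> 2 * M"
        using norm_triangle_ineq4[of "clamp_norm M (f x)" "k n x"] norm_clamp_norm[OF M(1), of "f x"] k_le[of n x] by linarith
      then have "norm (clamp_norm M (f x) - k n x) powr p \<le> (2 * M) powr p"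
        using p by (intro powr_mono2) auto
      moreover have "clamp_norm M (f x) - k n x = 0" if "R + 1 < norm x"
        using that R[of x] k0[of x n] by simp
      ultimately show "ennreal (norm (clamp_norm M (f x) - k n x) powr p) \<le> ennreal ((2 * M) powr p) * indicator (cball 0 (R + 1)) x"
        by (cases "R + 1 < norm x") (auto intro: ennreal_leI)
    qed
    show "(\<integral>\<^sup>+x. ennreal ((2 * M) powr p) * indicator (cball (0::'a) (R + 1)) x \<partial>lborel) < \<infinity>"
      using emeasure_lborel_cball_finite[of "0::'a" "R + 1"]
      by (simp add: nn_integral_cmult_indicator ennreal_mult_less_top)
    have "AE x in lebesgue. x \<notin> N"
      using N by (simp add: negligible_iff_null_sets AE_not_in)
    then have "AE x in lborel. x \<notin> N" by (simp add: AE_completion_iff)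
    then show "AE x in lborel. (\<lambda>n. ennreal (norm (clamp_norm M (f x) - k n x) powr p)) \<longlonglongrightarrow> 0"
    proof eventually_elim
      case (elim x)
      have "isCont (clamp_norm M) (f x)"
        using continuous_clamp_norm[OF M(1), of UNIV] continuous_on_eq_continuous_at[OF open_UNIV] by blast
      then have "(\<lambda>n. clamp_norm M (g n x)) \<longlonglongrightarrow> clamp_norm M (f x)"
        using lim[OF elim] by (rule isCont_tendsto_compose)
      then have "(\<lambda>n. k n x) \<longlonglongrightarrow> cut x *\<^sub>R clamp_norm M (f x)"
        unfolding k_def by (intro tendsto_intros)
      moreover have "cut x *\<^sub>R clamp_norm M (f x) = clamp_norm M (f x)"
        using R[of x] by (cases "R < norm x") (auto simp: cut_def)
      ultimately have "(\<lambda>n. norm (clamp_norm M (f x) - k n x)) \<longlonglongrightarrow> norm (clamp_norm M (f x) - clamp_norm M (f x))"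
        by (intro tendsto_intros) simp
      then have "(\<lambda>n. norm (clamp_norm M (f x) - k n x) powr p) \<longlonglongrightarrow> 0 powr p"
        using p by (intro tendsto_powr2) auto
      then show "(\<lambda>n. ennreal (norm (clamp_norm M (f x) - k n x) powr p)) \<longlonglongrightarrow> 0"
        using tendsto_ennrealI by fastforce
    qed
    show "(\<lambda>x. ennreal (norm (clamp_norm M (f x) - k n x) powr p)) \<in> borel_measurable lborel" for n
      by measurable
    show "(\<lambda>x. ennreal ((2 * M) powr p) * indicator (cball 0 (R + 1)) x) \<in> borel_measurable lborel"
      by (intro borel_measurable_times_ennreal borel_measurable_const borel_measurable_indicator) simp
  qed (rule borel_measurable_const)
  then have "(\<lambda>n. \<integral>\<^sup>+x. norm (clamp_norm M (f x) - k n x) powr p \<partial>lborel) \<longlonglongrightarrow> 0"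
    by (simp only: nn_integral_const mult_zero_left)
  then have "eventually (\<lambda>n. (\<integral>\<^sup>+x. norm (clamp_norm M (f x) - k n x) powr p \<partial>lborel) < ennreal \<eta>') sequentially"
    using \<eta>' by (intro order_tendstoD(2)) auto
  then obtain n where n: "(\<integral>\<^sup>+x. norm (clamp_norm M (f x) - k n x) powr p \<partial>lborel) \<le> ennreal \<eta>'"
    by (auto simp: eventually_sequentially intro: less_imp_le)
  have "(\<integral>\<^sup>+x. norm (f x - k n x) powr p \<partial>lborel) \<le> ennreal (2 powr p * (\<eta>' + \<eta>'))"
    using p \<eta>' by (intro Lp_triangle[OF _ _ _ _ M(2) n]) auto
  also have "2 powr p * (\<eta>' + \<eta>') = \<eta>" by (simp add: \<eta>'_def field_simps)
  finally show ?thesis using that[OF k_cont k0] by blast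
qed

section \<open>Smooth approximation of Sobolev functions\<close>

lemma integrable_if_Lp_bounded_support:
  fixes f :: "'a::euclidean_space \<Rightarrow> 'b::euclidean_space"
  assumes [measurable]: "f \<in> borel_measurable borel" and p: "1 \<le> p"
    and fp: "integrable lborel (\<lambda>x. norm (f x) powr p)"
    and R: "\<And>x. R < norm x \<Longrightarrow> f x = 0"
  shows "integrable lborel f"
proof (rule Bochner_Integration.integrable_bound)
  have "integrable lborel (\<lambda>x. indicator (cball (0::'a) R) x *\<^sub>R (1::real))"
    using emeasure_lborel_cball_finite[of "0::'a" R]
    by (intro integrable_scaleR_left integrable_real_indicator) auto
  then show "integrable lborel (\<lambda>x. indicator (cball (0::'a) R) x *\<^sub>R (1::real) + norm (f x) powr p)"
    by (rule Bochner_Integration.integrable_add[OF _ fp])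
  show "AE x in lborel. norm (f x) \<le> norm (indicator (cball 0 R) x *\<^sub>R (1::real) + norm (f x) powr p)"
  proof (rule AE_I2)
    fix x
    have "norm (f x) \<le> indicator (cball 0 R) x + norm (f x) powr p"
    proof (cases "R < norm x")
      case True
      then show ?thesis using R[of x] by simp
    next
      case False
      have "norm (f x) \<le> 1 + norm (f x) powr p"
      proof (cases "norm (f x) \<le> 1")
        case False
        then have "norm (f x) powr 1 \<le> norm (f x) powr p" using p by (intro powr_mono) auto
        then show ?thesis using False by simp
      qed (simp add: add_increasing2)
      then show ?thesis using False by simp
    qed
    then show "norm (f x) \<le> norm (indicator (cball 0 R) x *\<^sub>R (1::real) + norm (f x) powr p)" by simp
  qed
qed simp

lemma mollify_continuous_Lp:
  fixes g :: "'a::euclidean_space \<Rightarrow> 'b::euclidean_space"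
  assumes g: "continuous_on UNIV g" and R: "\<And>x. R < norm x \<Longrightarrow> g x = 0" and p: "1 \<le> p" and \<eta>: "0 < \<eta>"
  shows "\<exists>e0>0. \<forall>e. 0 < e \<and> e < e0 \<longrightarrow> (\<integral>\<^sup>+x. norm (mollify e g x - g x) powr p \<partial>lborel) \<le> ennreal \<eta>"
proof -
  have g_meas[measurable]: "g \<in> borel_measurable borel" by (rule borel_measurable_continuous_onI[OF g])
  obtain B where B: "B > 0" "\<And>x. norm (g x) \<le> B"
    using compact_support_bounded[OF g, of "cball 0 R"] R by (auto simp: not_le)
  have int_g: "integrable lborel g"
    by (rule integrable_bounded_support[where K="cball 0 R"]) (use B R in auto)
  define vol where "vol = measure lborel (cball (0::'a) (R + 1))"
  have vol: "emeasure lborel (cball (0::'a) (R + 1)) = ennreal vol" "0 \<le> vol"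
    unfolding vol_def using emeasure_lborel_cball_finite[of "0::'a" "R + 1"]
    by (auto intro!: emeasure_eq_ennreal_measure)
  define \<tau> where "\<tau> = (\<eta> / (vol + 1)) powr (1 / p)"
  have \<tau>: "0 < \<tau>" "\<tau> powr p = \<eta> / (vol + 1)"
    using \<eta> vol p by (auto simp: \<tau>_def powr_powr)
  have "uniformly_continuous_on (cball 0 (R + 2)) g"
    by (intro compact_uniformly_continuous continuous_on_subset[OF g]) auto
  then obtain \<delta> where \<delta>: "\<delta> > 0"
    "\<And>x y. x \<in> cball 0 (R + 2) \<Longrightarrow> y \<in> cball 0 (R + 2) \<Longrightarrow> dist y x < \<delta> \<Longrightarrow> dist (g y) (g x) < \<tau>"
    unfolding uniformly_continuous_on_def using \<tau>(1) by metis
  have "(\<integral>\<^sup>+x. norm (mollify e g x - g x) powr p \<partial>lborel) \<le> ennreal \<eta>" if e: "0 < e" "e < min 1 \<delta>" for e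
  proof -
    have "(\<integral>\<^sup>+x. norm (mollify e g x - g x) powr p \<partial>lborel) \<le> (\<integral>\<^sup>+x. ennreal (\<tau> powr p) * indicator (cball (0::'a) (R + 1)) x \<partial>lborel)"
    proof (rule nn_integral_mono)
      fix x
      show "ennreal (norm (mollify e g x - g x) powr p) \<le> ennreal (\<tau> powr p) * indicator (cball 0 (R + 1)) x"
      proof (cases "norm x \<le> R + 1")
        case True
        have "norm (mollify e g x - g x) \<le> \<tau>"
        proof (rule mollify_near[OF e(1) integrable_bump_scaleR[OF g_meas int_g]])
          fix y assume y: "dist x y < e"
          have "norm y \<le> norm x + dist x y"
            using norm_triangle_ineq[of "y - x" x] by (simp add: dist_norm norm_minus_commute)
          then have "dist (g y) (g x) < \<tau>" using y e True by (intro \<delta>(2)) (auto simp: dist_commute)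
          then show "norm (g y - g x) \<le> \<tau>" by (simp add: dist_norm)
        qed
        then have "norm (mollify e g x - g x) powr p \<le> \<tau> powr p" using p by (intro powr_mono2) auto
        then show ?thesis using True by (simp add: ennreal_leI)
      next
        case False
        have "norm (mollify e g x - 0) \<le> 0"
        proof (rule mollify_near[OF e(1) integrable_bump_scaleR[OF g_meas int_g]])
          fix y assume y: "dist x y < e"
          have "norm x \<le> norm y + dist x y"
            using norm_triangle_ineq[of "x - y" y] by (simp add: dist_norm)
          then show "norm (g y - 0) \<le> 0" using R[of y] y e False by auto
        qed
        then show ?thesis using R[of x] False by simp
      qed
    qed
    also have "\<dots> = ennreal (\<tau> powr p) * emeasure lborel (cball (0::'a) (R + 1))"
      by (rule nn_integral_cmult_indicator) simp
    also have "\<dots> = ennreal (\<tau> powr p * vol)"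
      using vol by (simp add: ennreal_mult)
    also have "\<dots> \<le> ennreal \<eta>"
      unfolding \<tau>(2) using \<eta> vol(2) by (intro ennreal_leI) (simp add: field_simps)
    finally show ?thesis .
  qed
  then show ?thesis using \<delta>(1) by (intro exI[of _ "min 1 \<delta>"]) auto
qed

text \<open>The usual three-term argument: pass from \<open>f\<close> to a continuous \<open>g\<close> close to it, mollify \<open>g\<close>, and pass
back, the first passage being controlled by the contraction property.\<close>

lemma mollify_tendsto_Lp:
  fixes f :: "'a::euclidean_space \<Rightarrow> 'b::euclidean_space"
  assumes f_meas[measurable]: "f \<in> borel_measurable borel" and p: "1 \<le> p"
    and fp: "integrable lborel (\<lambda>x. norm (f x) powr p)"
    and R: "\<And>x. R < norm x \<Longrightarrow> f x = 0" and \<eta>: "0 < \<eta>"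
  shows "\<exists>e0>0. \<forall>e. 0 < e \<and> e < e0 \<longrightarrow> (\<integral>\<^sup>+x. norm (mollify e f x - f x) powr p \<partial>lborel) \<le> ennreal \<eta>"
proof -
  define \<eta>1 where "\<eta>1 = \<eta> / (2 powr p * (1 + 2 powr p * 2))"
  have pos: "0 < 2 powr p * (1 + 2 powr p * 2)" by (intro mult_pos_pos add_pos_pos) auto
  have \<eta>1: "0 < \<eta>1" unfolding \<eta>1_def using \<eta> pos by (rule divide_pos_pos)
  have int_f: "integrable lborel f"
    by (rule integrable_if_Lp_bounded_support[OF f_meas p fp R])
  obtain g where g: "continuous_on UNIV g" "\<And>x. R + 1 < norm x \<Longrightarrow> g x = 0"
    and fg: "(\<integral>\<^sup>+x. norm (f x - g x) powr p \<partial>lborel) \<le> ennreal \<eta>1"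
    using Lp_dense_continuous[OF f_meas p fp R \<eta>1] by blast
  have g_meas[measurable]: "g \<in> borel_measurable borel" by (rule borel_measurable_continuous_onI[OF g(1)])
  obtain B where B: "B > 0" "\<And>x. norm (g x) \<le> B"
    using compact_support_bounded[OF g(1), of "cball 0 (R + 1)"] g(2) by (auto simp: not_le)
  have int_g: "integrable lborel g"
    by (rule integrable_bounded_support[where K="cball 0 (R + 1)"]) (use B g in auto)
  have fgp: "integrable lborel (\<lambda>x. norm (f x - g x) powr p)"
    using fg by (intro integrableI_bounded) (auto simp: le_less_trans[OF _ ennreal_less_top])
  obtain e0 where e0: "e0 > 0" "\<And>e. 0 < e \<and> e < e0 \<Longrightarrow> (\<integral>\<^sup>+x. norm (mollify e g x - g x) powr p \<partial>lborel) \<le> ennreal \<eta>1"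
    using mollify_continuous_Lp[OF g p \<eta>1] by blast
  have "(\<integral>\<^sup>+x. norm (mollify e f x - f x) powr p \<partial>lborel) \<le> ennreal \<eta>" if e: "0 < e" "e < e0" for e
  proof -
    have diff: "mollify e f x - mollify e g x = mollify e (\<lambda>y. f y - g y) x" for x
      unfolding mollify_def
      using integrable_bump_scaleR[OF f_meas int_f] integrable_bump_scaleR[OF g_meas int_g]
      by (simp add: scaleR_diff_right)
    have A: "(\<integral>\<^sup>+x. norm (mollify e f x - mollify e g x) powr p \<partial>lborel) \<le> ennreal \<eta>1"
      unfolding diff
      by (rule order_trans[OF mollify_Lp_contraction[OF e(1) p _ _ fgp] fg])
        (use int_f int_g in auto)
    have "(\<integral>\<^sup>+x. norm (g x - f x) powr p \<partial>lborel) \<le> ennreal \<eta>1"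
      using fg by (simp add: norm_minus_commute)
    then have "(\<integral>\<^sup>+x. norm (mollify e g x - f x) powr p \<partial>lborel) \<le> ennreal (2 powr p * (\<eta>1 + \<eta>1))"
      using p \<eta>1 e0(2)[of e] e by (intro Lp_triangle) auto
    then have "(\<integral>\<^sup>+x. norm (mollify e f x - f x) powr p \<partial>lborel) \<le> ennreal (2 powr p * (\<eta>1 + 2 powr p * (\<eta>1 + \<eta>1)))"
      using p \<eta>1 by (intro Lp_triangle[OF _ _ _ _ A]) auto
    also have "2 powr p * (\<eta>1 + 2 powr p * (\<eta>1 + \<eta>1)) = \<eta>1 * (2 powr p * (1 + 2 powr p * 2))"
      by (simp add: algebra_simps)
    also have "\<dots> = \<eta>" unfolding \<eta>1_def by (metis pos less_irrefl nonzero_eq_divide_eq)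
    finally show ?thesis .
  qed
  then show ?thesis using e0(1) by blast
qed

text \<open>A continuous Sobolev function has \<open>C\<^sup>1\<close> approximations that converge uniformly together with strong
convergence of their gradients, on any compact subset of \<open>\<Omega>\<close>. The point is that the gradient of the mollified
function is the mollified weak gradient: the kernel centred at \<open>x\<close> is itself an admissible test
function. To have bounded functions on the whole space, everything is cut off outside a compact
neighbourhood \<open>K1\<close> of \<open>K\<close>.\<close>

lemma smooth_approximation:
  fixes u :: "'a::euclidean_space \<Rightarrow> real" and H :: "'a \<Rightarrow> 'a"
  assumes \<Omega>: "open \<Omega>" and K: "compact K" "K \<subseteq> \<Omega>"
    and u: "continuous_on \<Omega> u" and [measurable]: "u \<in> borel_measurable borel" and [measurable]: "H \<in> borel_measurable borel"
    and p: "1 \<le> p" and Lp: "\<And>L. compact L \<Longrightarrow> L \<subseteq> \<Omega> \<Longrightarrow> integrable lborel (\<lambda>x. indicator L x * norm (H x) powr p)"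
    and weak: "\<And>\<phi>. \<phi> \<in> C01 \<Omega> \<Longrightarrow> (LBINT x. u x *\<^sub>R grad \<phi> x) = - (LBINT x. \<phi> x *\<^sub>R H x)"
    and \<eta>: "0 < \<eta>"
  obtains v dv where "\<And>x. GDERIV v x :> dv x" "continuous_on UNIV dv" "\<And>x. x \<in> K \<Longrightarrow> \<bar>v x - u x\<bar> \<le> \<eta>"
    "(\<integral>\<^sup>+x\<in>K. norm (dv x - H x) powr p \<partial>lborel) \<le> ennreal \<eta>"
proof -
  obtain e1 where e1: "e1 > 0" "(\<Union>x\<in>K. cball x e1) \<subseteq> \<Omega>"
    using compact_subset_open_imp_cball_epsilon_subset[OF K(1) \<Omega> K(2)] by blast
  define K1 where "K1 = {x + y | x y. x \<in> K \<and> y \<in> cball 0 e1}"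
  have K1: "compact K1" unfolding K1_def by (rule compact_sums[OF K(1)]) simp
  have K1I: "y \<in> K1" if "x \<in> K" "dist x y \<le> e1" for x y
  proof -
    have "y = x + (y - x)" by simp
    moreover have "y - x \<in> cball 0 e1" using that by (simp add: dist_norm norm_minus_commute)
    ultimately show ?thesis unfolding K1_def using that(1) by blast
  qed
  have K1_sub: "K1 \<subseteq> \<Omega>"
  proof
    fix z assume "z \<in> K1"
    then obtain x y where "x \<in> K" "norm y \<le> e1" "z = x + y" by (auto simp: K1_def)
    then have "z \<in> cball x e1" by (simp add: dist_norm)
    with \<open>x \<in> K\<close> e1(2) show "z \<in> \<Omega>" by blast
  qed
  have [measurable]: "K1 \<in> sets borel" using K1 by (simp add: borel_compact)
  obtain R where R: "K1 \<subseteq> cball 0 R"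
    using bounded_subset_ballD[OF compact_imp_bounded[OF K1], of 0] ball_subset_cball by (meson subset_trans)
  define w where "w = (\<lambda>x. indicator K1 x * u x)"
  define f where "f = (\<lambda>x. indicator K1 x *\<^sub>R H x)"
  have f_meas[measurable]: "f \<in> borel_measurable borel" unfolding f_def by measurable
  have w_meas[measurable]: "w \<in> borel_measurable borel" unfolding w_def by measurable
  have "norm (f x) powr p = indicator K1 x * norm (H x) powr p" for x
    unfolding f_def by (cases "x \<in> K1") auto
  then have fp: "integrable lborel (\<lambda>x. norm (f x) powr p)"
    using Lp[OF K1 K1_sub] by simp
  have fR: "f x = 0" if "R < norm x" for x
    using that R unfolding f_def by (auto simp: indicator_def)
  obtain e0 where e0: "e0 > 0" "\<And>e. 0 < e \<and> e < e0 \<Longrightarrow> (\<integral>\<^sup>+x. norm (mollify e f x - f x) powr p \<partial>lborel) \<le> ennreal \<eta>"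
    using mollify_tendsto_Lp[OF f_meas p fp fR \<eta>] by blast
  have "uniformly_continuous_on K1 u"
    by (intro compact_uniformly_continuous K1 continuous_on_subset[OF u K1_sub])
  then obtain \<delta> where \<delta>: "\<delta> > 0"
    "\<And>x y. x \<in> K1 \<Longrightarrow> y \<in> K1 \<Longrightarrow> dist y x < \<delta> \<Longrightarrow> dist (u y) (u x) < \<eta>"
    unfolding uniformly_continuous_on_def using \<eta> by metis
  define e where "e = min (min e0 e1) \<delta> / 2"
  have e: "0 < e" "e < e0" "e < e1" "e < \<delta>" using e0(1) e1(1) \<delta>(1) by (auto simp: e_def min_def)
  have "bounded (u ` K1)"
    by (intro compact_imp_bounded compact_continuous_image K1 continuous_on_subset[OF u K1_sub])
  then obtain B where B: "B > 0" "\<And>x. x \<in> K1 \<Longrightarrow> \<bar>u x\<bar> \<le> B" by (auto simp: bounded_pos)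
  have wB: "\<bar>w x\<bar> \<le> B" for x using B by (auto simp: w_def indicator_def)
  have w0: "w x = 0" if "x \<notin> K1" for x using that by (simp add: w_def)
  have int_w: "integrable lborel w"
    by (rule integrable_bounded_support[where K=K1]) (use wB w0 K1 compact_imp_bounded in auto)
  define dv where "dv = (\<lambda>x. (LBINT y. w y *\<^sub>R dbump e (x - y)) /\<^sub>R bump_mass TYPE('a) e)"
  have 1: "GDERIV (mollify e w) x :> dv x" for x
    unfolding dv_def by (rule gderiv_mollify[OF w_meas wB compact_imp_bounded[OF K1] w0 e(1)])
  have 2: "continuous_on UNIV dv"
    unfolding dv_def by (rule continuous_mollified_gradient[OF w_meas int_w e(1)])
  have 3: "\<bar>mollify e w x - u x\<bar> \<le> \<eta>" if x: "x \<in> K" for x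
  proof -
    have "norm (mollify e w x - u x) \<le> \<eta>"
    proof (rule mollify_near[OF e(1) integrable_bump_scaleR[OF w_meas int_w]])
      fix y assume "dist x y < e"
      then have y: "y \<in> K1" "x \<in> K1" "dist y x < \<delta>" using x e e1 by (auto intro: K1I simp: dist_commute)
      then have "dist (u y) (u x) < \<eta>" using \<delta>(2) by blast
      then show "norm (w y - u x) \<le> \<eta>" using y by (simp add: w_def dist_real_def)
    qed
    then show ?thesis by simp
  qed
  have dv_eq: "dv x = mollify e f x" if x: "x \<in> K" for x
  proof -
    define \<phi> where "\<phi> = (\<lambda>y. bump e (x - y))"
    define d\<phi> where "d\<phi> = (\<lambda>y. - dbump e (x - y))"
    have der: "GDERIV \<phi> y :> d\<phi> y" for y
    proof -
      have "((\<lambda>y. x - y) has_derivative (\<lambda>h. - h)) (at y)" by (auto intro!: derivative_eq_intros)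
      from has_derivative_compose[OF this gderiv_bump[unfolded gderiv_def]]
      show ?thesis unfolding gderiv_def \<phi>_def d\<phi>_def by simp
    qed
    have cont: "continuous_on UNIV d\<phi>"
      unfolding d\<phi>_def by (intro continuous_intros continuous_on_compose2[OF continuous_dbump[of UNIV]]) auto
    have out: "e \<le> norm (x - y)" if "y \<notin> cball x e" for y using that by (simp add: dist_norm)
    have zero: "\<phi> y = 0" "d\<phi> y = 0" if "y \<notin> cball x e" for y
      using bump_eq_0[OF e(1) out[OF that]] dbump_eq_0[OF e(1) out[OF that]] by (simp_all add: \<phi>_def d\<phi>_def)
    have sub: "cball x e \<subseteq> K1" using x e by (auto intro: K1I)
    have mem: "\<phi> \<in> C01 \<Omega>" and gr: "grad \<phi> = d\<phi>"
      using C01_by_gradient[OF der cont compact_cball subset_trans[OF sub K1_sub] zero(1)] by simp_all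
    have "(LBINT y. w y *\<^sub>R dbump e (x - y)) = (LBINT y. - (u y *\<^sub>R grad \<phi> y))"
    proof (rule Bochner_Integration.integral_cong)
      fix y
      show "w y *\<^sub>R dbump e (x - y) = - (u y *\<^sub>R grad \<phi> y)"
        using zero(2)[of y] sub by (cases "y \<in> cball x e") (auto simp: gr d\<phi>_def w_def)
    qed simp
    also have "\<dots> = (LBINT y. \<phi> y *\<^sub>R H y)"
      using weak[OF mem] by simp
    also have "\<dots> = (LBINT y. bump e (x - y) *\<^sub>R f y)"
    proof (rule Bochner_Integration.integral_cong)
      fix y
      show "\<phi> y *\<^sub>R H y = bump e (x - y) *\<^sub>R f y"
        using zero(1)[of y] sub by (cases "y \<in> cball x e") (auto simp: \<phi>_def f_def)
    qed simp
    finally show ?thesis by (simp add: dv_def mollify_def)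
  qed
  have "K \<subseteq> K1" using e1 by (auto intro: K1I)
  then have "(\<integral>\<^sup>+x\<in>K. norm (dv x - H x) powr p \<partial>lborel) \<le> (\<integral>\<^sup>+x. norm (mollify e f x - f x) powr p \<partial>lborel)"
    by (intro nn_integral_mono) (auto simp: indicator_def dv_eq f_def)
  also have "\<dots> \<le> ennreal \<eta>" using e0(2)[of e] e by blast
  finally show ?thesis using that[of "mollify e w" dv] 1 2 3 by blast
qed

section \<open>Integration by parts and radial vector fields\<close>

lemma continuous_on_UNIV_if_support:
  fixes h :: "'a::euclidean_space \<Rightarrow> 'b::real_normed_vector"
  assumes "open A" "continuous_on A h" "compact K" "K \<subseteq> A" "\<And>x. x \<notin> K \<Longrightarrow> h x = 0"
  shows "continuous_on UNIV h"
proof -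
  have "open (- K)" using \<open>compact K\<close> by (simp add: compact_imp_closed open_Compl)
  moreover have "continuous_on (- K) h"
    using assms(5) by (intro continuous_on_eq[OF continuous_on_const[of _ 0]]) auto
  ultimately have "continuous_on (A \<union> - K) h" using assms by (intro continuous_on_open_Un) auto
  moreover have "A \<union> - K = UNIV" using \<open>K \<subseteq> A\<close> by auto
  ultimately show ?thesis by simp
qed

lemma integrable_continuous_support:
  fixes h :: "'a::euclidean_space \<Rightarrow> 'b::euclidean_space"
  assumes "continuous_on UNIV h" "compact K" "\<And>x. x \<notin> K \<Longrightarrow> h x = 0"
  shows "integrable lborel h"
proof -
  obtain B where "\<And>x. norm (h x) \<le> B" using compact_support_bounded[OF assms] by blast
  then show ?thesis
    using assms by (intro integrable_bounded_support[of h K B] borel_measurable_continuous_onI) (auto intro: compact_imp_bounded)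
qed

text \<open>By translation invariance of Lebesgue measure every difference quotient of \<open>f\<close> has integral zero;
dominated convergence carries this over to the partial derivatives.\<close>

lemma integral_grad_eq_0:
  fixes f :: "'a::euclidean_space \<Rightarrow> real"
  assumes der: "\<And>x. GDERIV f x :> df x" and cont: "continuous_on UNIV df"
    and K: "compact K" "\<And>x. x \<notin> K \<Longrightarrow> f x = 0" "\<And>x. x \<notin> K \<Longrightarrow> df x = 0"
  shows "(LBINT x. df x) = 0"
proof (rule euclidean_eqI)
  fix b :: 'a assume b: "b \<in> Basis"
  have fder: "(f has_derivative (\<lambda>h. h \<bullet> df x)) (at x)" for x
    using der[of x] by (simp add: gderiv_def)
  have fcont: "continuous_on UNIV f"
    unfolding continuous_on_eq_continuous_at[OF open_UNIV] using has_derivative_continuous[OF fder] by blast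
  have [measurable]: "f \<in> borel_measurable borel" "df \<in> borel_measurable borel"
    by (auto intro: borel_measurable_continuous_onI fcont cont)
  obtain M where M: "M > 0" "\<And>x. norm (df x) \<le> M" using compact_support_bounded[OF cont K(1,3)] by blast
  have lip: "\<bar>f x - f y\<bar> \<le> M * norm (x - y)" for x y
  proof -
    have "norm (f x - f y) \<le> M * norm (x - y)"
    proof (rule differentiable_bound[of UNIV f "\<lambda>x h. h \<bullet> df x"])
      show "onorm (\<lambda>h. h \<bullet> df x) \<le> M" for x
      proof (rule onorm_le)
        fix h
        have "norm (h \<bullet> df x) \<le> norm h * norm (df x)" using Cauchy_Schwarz_ineq2[of h "df x"] by simp
        also have "\<dots> \<le> M * norm h" using mult_left_mono[OF M(2)[of x] norm_ge_zero[of h]] by (simp add: mult.commute)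
        finally show "norm (h \<bullet> df x) \<le> M * norm h" .
      qed
    qed (use fder in auto)
    then show ?thesis by simp
  qed
  have int_f: "integrable lborel f" by (rule integrable_continuous_support[OF fcont K(1,2)])
  have int_df: "integrable lborel df" by (rule integrable_continuous_support[OF cont K(1,3)])
  obtain R where R: "K \<subseteq> ball 0 R" using bounded_subset_ballD[OF compact_imp_bounded[OF K(1)]] by blast
  define t where "t = (\<lambda>n. inverse (real (Suc n)))"
  have t: "0 < t n" "t n \<le> 1" for n by (auto simp: t_def inverse_le_1_iff)
  define q where "q = (\<lambda>n x. (f (t n *\<^sub>R b + x) - f x) / t n)"
  have "(LBINT x. q n x) = 0" for n
  proof -
    have "(LBINT x. f x) = (LINT x|distr lborel borel ((+) (t n *\<^sub>R b)). f x)"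
      by (simp only: lborel_distr_plus)
    also have "\<dots> = (LBINT x. f (t n *\<^sub>R b + x))"
      by (rule integral_distr) simp_all
    finally have eq: "(LBINT x. f (t n *\<^sub>R b + x)) = (LBINT x. f x)" ..
    have "integrable (distr lborel borel ((+) (t n *\<^sub>R b))) f" using int_f by (simp only: lborel_distr_plus)
    then have "integrable lborel (\<lambda>x. f (t n *\<^sub>R b + x))"
      by (subst (asm) integrable_distr_eq) simp_all
    then have "(LBINT x. (f (t n *\<^sub>R b + x) - f x)) = 0" using int_f eq by simp
    then show ?thesis unfolding q_def by simp
  qed
  moreover have "(\<lambda>n. LBINT x. q n x) \<longlonglongrightarrow> (LBINT x. b \<bullet> df x)"
  proof (rule integral_dominated_convergence[where w="\<lambda>x. indicator (cball 0 (R + 1)) x *\<^sub>R M"])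
    show "integrable lborel (\<lambda>x. indicator (cball (0::'a) (R + 1)) x *\<^sub>R M)"
      using emeasure_lborel_cball_finite[of "0::'a" "R + 1"]
      by (intro integrable_scaleR_left integrable_real_indicator) auto
    show "AE x in lborel. norm (q n x) \<le> indicator (cball 0 (R + 1)) x *\<^sub>R M" for n
    proof (rule AE_I2)
      fix x
      show "norm (q n x) \<le> indicator (cball 0 (R + 1)) x *\<^sub>R M"
      proof (cases "norm x \<le> R + 1")
        case True
        have "\<bar>f (t n *\<^sub>R b + x) - f x\<bar> \<le> M * norm (t n *\<^sub>R b)" using lip[of "t n *\<^sub>R b + x" x] by simp
        then have "\<bar>q n x\<bar> \<le> M" using t[of n] b unfolding q_def by (simp add: divide_le_eq)
        then show ?thesis using True by simp
      next
        case False
        have "norm x \<le> norm (t n *\<^sub>R b + x) + norm (t n *\<^sub>R b)"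
          using norm_triangle_ineq4[of "t n *\<^sub>R b + x" "t n *\<^sub>R b"] by simp
        then have "R < norm (t n *\<^sub>R b + x)" using False t[of n] b by simp
        then have "t n *\<^sub>R b + x \<notin> K" using R by auto
        moreover have "x \<notin> K" using False R by auto
        ultimately show ?thesis using K(2) False by (simp add: q_def)
      qed
    qed
    show "AE x in lborel. (\<lambda>n. q n x) \<longlonglongrightarrow> b \<bullet> df x"
    proof (rule AE_I2)
      fix x
      have "((\<lambda>s. s *\<^sub>R b + x) has_derivative (\<lambda>h. h *\<^sub>R b)) (at 0)" by (auto intro!: derivative_eq_intros)
      moreover have "(f has_derivative (\<lambda>h. h \<bullet> df x)) (at (0 *\<^sub>R b + x))" using fder by simp
      ultimately have "((\<lambda>s. f (s *\<^sub>R b + x)) has_derivative (\<lambda>h. (h *\<^sub>R b) \<bullet> df x)) (at 0)"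
        by (rule has_derivative_compose)
      then have "((\<lambda>s. f (s *\<^sub>R b + x)) has_real_derivative b \<bullet> df x) (at 0)"
        by (simp add: has_field_derivative_def mult.commute mult_commute_abs)
      then have lim: "((\<lambda>s. (f (s *\<^sub>R b + x) - f x) / s) \<longlongrightarrow> b \<bullet> df x) (at 0)"
        by (simp add: DERIV_def)
      have "filterlim t (at 0) sequentially"
        unfolding t_def using LIMSEQ_inverse_real_of_nat by (auto simp: filterlim_at)
      from filterlim_compose[OF lim this] show "(\<lambda>n. q n x) \<longlonglongrightarrow> b \<bullet> df x"
        by (simp add: q_def)
    qed
    show "q n \<in> borel_measurable lborel" for n unfolding q_def by measurable
  qed measurable
  ultimately have "(\<lambda>n. 0) \<longlonglongrightarrow> (LBINT x. b \<bullet> df x)" by simp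
  then have "(LBINT x. b \<bullet> df x) = 0" by (simp only: LIMSEQ_const_iff)
  moreover have "(LBINT x. b \<bullet> df x) = b \<bullet> (LBINT x. df x)"
    by (rule integral_inner_right) (rule int_df)
  ultimately show "(LBINT x. df x) \<bullet> b = 0 \<bullet> b" by (simp add: inner_commute)
qed

lemma integration_by_parts_C01:
  fixes F :: "'a::euclidean_space \<Rightarrow> 'a"
  assumes A: "open A"
    and der: "\<And>i x. i \<in> Basis \<Longrightarrow> x \<in> A \<Longrightarrow> GDERIV (\<lambda>x. F x \<bullet> i) x :> DF i x"
    and cont: "\<And>i. i \<in> Basis \<Longrightarrow> continuous_on A (DF i)"
    and \<phi>: "\<phi> \<in> C01 A"
  shows "(LBINT x. F x \<bullet> grad \<phi> x) = - (LBINT x. \<phi> x * (\<Sum>i\<in>Basis. DF i x \<bullet> i))"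
proof -
  obtain K where K: "compact K" "K \<subseteq> A" and zero: "\<And>x. x \<notin> K \<Longrightarrow> \<phi> x = 0" "\<And>x. x \<notin> K \<Longrightarrow> grad \<phi> x = 0"
    using C01_support[OF \<phi>] by blast
  note c\<phi> = C01_continuous[OF \<phi>]
  define g where "g = (\<lambda>i x. \<phi> x *\<^sub>R DF i x + (F x \<bullet> i) *\<^sub>R grad \<phi> x)"
  have Fi: "continuous_on A (\<lambda>x. F x \<bullet> i)" if "i \<in> Basis" for i
  proof -
    have "isCont (\<lambda>x. F x \<bullet> i) x" if "x \<in> A" for x
      using der[OF \<open>i \<in> Basis\<close> that] by (auto simp: gderiv_def dest: has_derivative_continuous)
    then show ?thesis using A by (simp add: continuous_on_eq_continuous_at)
  qed
  have FA: "continuous_on A F" using Fi by (simp add: continuous_on_componentwise[of A F])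
  have gcont: "continuous_on UNIV (g i)" if i: "i \<in> Basis" for i
  proof (rule continuous_on_UNIV_if_support[OF A _ K])
    show "continuous_on A (g i)"
      unfolding g_def by (intro continuous_intros continuous_on_subset[OF c\<phi>(1)] continuous_on_subset[OF c\<phi>(2)] cont Fi i) auto
  qed (simp add: g_def zero)
  have gder: "GDERIV (\<lambda>x. \<phi> x * (F x \<bullet> i)) x :> g i x" if i: "i \<in> Basis" for i x
  proof (cases "x \<in> A")
    case True
    from GDERIV_mult[OF c\<phi>(3) der[OF i True]] show ?thesis unfolding g_def .
  next
    case False
    have op: "open (- K)" using K by (simp add: compact_imp_closed open_Compl)
    have x: "x \<in> - K" using False K by auto
    have "GDERIV (\<lambda>x. \<phi> x * (F x \<bullet> i)) x :> 0" by (rule gderiv_eq_0[OF op x]) (simp add: zero)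
    then show ?thesis using x by (simp add: g_def zero)
  qed
  have g0: "(LBINT x. g i x) = 0" if i: "i \<in> Basis" for i
    by (rule integral_grad_eq_0[OF gder[OF i] gcont[OF i] K(1)]) (simp_all add: g_def zero)
  have gint: "integrable lborel (g i)" if "i \<in> Basis" for i
    by (rule integrable_continuous_support[OF gcont[OF that] K(1)]) (simp add: g_def zero)
  have "(LBINT x. (\<Sum>i\<in>Basis. g i x \<bullet> i)) = (\<Sum>i\<in>Basis. (LBINT x. g i x) \<bullet> i)"
    using gint by (simp add: Bochner_Integration.integral_sum)
  then have zero_sum: "(LBINT x. (\<Sum>i\<in>Basis. g i x \<bullet> i)) = 0" by (simp add: g0)
  have split: "(\<Sum>i\<in>Basis. g i x \<bullet> i) = \<phi> x * (\<Sum>i\<in>Basis. DF i x \<bullet> i) + F x \<bullet> grad \<phi> x" for x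
  proof -
    have "F x \<bullet> grad \<phi> x = (\<Sum>i\<in>Basis. (F x \<bullet> i) * (grad \<phi> x \<bullet> i))" by (rule euclidean_inner)
    then show ?thesis by (simp add: g_def inner_add_left sum.distrib sum_distrib_left)
  qed
  have i1: "integrable lborel (\<lambda>x. \<phi> x * (\<Sum>i\<in>Basis. DF i x \<bullet> i))"
  proof (rule integrable_continuous_support[OF continuous_on_UNIV_if_support[OF A _ K] K(1)])
    show "continuous_on A (\<lambda>x. \<phi> x * (\<Sum>i\<in>Basis. DF i x \<bullet> i))"
      by (intro continuous_intros continuous_on_subset[OF c\<phi>(1)] cont) auto
  qed (simp_all add: zero)
  have i2: "integrable lborel (\<lambda>x. F x \<bullet> grad \<phi> x)"
  proof (rule integrable_continuous_support[OF continuous_on_UNIV_if_support[OF A _ K] K(1)])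
    show "continuous_on A (\<lambda>x. F x \<bullet> grad \<phi> x)"
      by (intro continuous_intros continuous_on_subset[OF c\<phi>(2)] FA) auto
  qed (simp_all add: zero)
  from zero_sum show ?thesis unfolding split using i1 i2 by simp
qed

text \<open>The field has the Jacobian \<open>k(r) I + (k'(r) / r) (x - y) (x - y)\<^sup>T\<close> with \<open>r = |x - y|\<close>, whose trace appears on
the right.\<close>

lemma radial_flux:
  fixes y :: "'a::euclidean_space"
  assumes s: "0 \<le> s" and der: "\<And>r. s < r \<Longrightarrow> r < R \<Longrightarrow> (k has_real_derivative k' r) (at r)"
    and cont: "continuous_on {s<..<R} k'"
    and \<phi>: "\<phi> \<in> C01 {x. s < norm (x - y) \<and> norm (x - y) < R}"
  shows "(LBINT x. (k (norm (x - y)) *\<^sub>R (x - y)) \<bullet> grad \<phi> x)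
    = - (LBINT x. \<phi> x * (real DIM('a) * k (norm (x - y)) + norm (x - y) * k' (norm (x - y))))"
proof -
  define A where "A = {x. s < norm (x - y) \<and> norm (x - y) < R}"
  have A: "open A" unfolding A_def by (intro open_Collect_conj open_Collect_less continuous_intros)
  define DF where "DF = (\<lambda>i x. k (norm (x - y)) *\<^sub>R i + (((x - y) \<bullet> i) * k' (norm (x - y)) / norm (x - y)) *\<^sub>R (x - y))"
  have kc: "continuous_on {s<..<R} k"
    unfolding continuous_on_eq_continuous_at[OF open_greaterThanLessThan] using DERIV_isCont[OF der] by auto
  have "(LBINT x. (k (norm (x - y)) *\<^sub>R (x - y)) \<bullet> grad \<phi> x) = - (LBINT x. \<phi> x * (\<Sum>i\<in>Basis. DF i x \<bullet> i))"
  proof (rule integration_by_parts_C01[OF A])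
    fix i :: 'a and x assume "i \<in> Basis" and x: "x \<in> A"
    have 1: "GDERIV (\<lambda>x. norm (x - y)) x :> sgn (x - y)"
      by (rule GDERIV_norm_diff) (use x s in \<open>auto simp: A_def\<close>)
    have 2: "GDERIV (\<lambda>x. (x - y) \<bullet> i) x :> i"
      unfolding gderiv_def by (auto intro!: derivative_eq_intros)
    have "(k has_real_derivative k' (norm (x - y))) (at (norm (x - y)))" using x by (intro der) (auto simp: A_def)
    from GDERIV_mult[OF GDERIV_DERIV_compose[OF 1 this] 2]
    have "GDERIV (\<lambda>x. k (norm (x - y)) * ((x - y) \<bullet> i)) x :> DF i x"
      by (rule GDERIV_subst) (simp add: DF_def sgn_div_norm divide_inverse mult_ac)
    then show "GDERIV (\<lambda>x. (k (norm (x - y)) *\<^sub>R (x - y)) \<bullet> i) x :> DF i x" by simp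
  next
    fix i :: 'a
    show "continuous_on A (DF i)"
      unfolding DF_def
      by (intro continuous_intros continuous_on_compose2[OF kc] continuous_on_compose2[OF cont]) (use s in \<open>auto simp: A_def\<close>)
  next
    show "\<phi> \<in> C01 A" using \<phi> by (simp add: A_def)
  qed
  also have "(\<lambda>x. \<phi> x * (\<Sum>i\<in>Basis. DF i x \<bullet> i)) = (\<lambda>x. \<phi> x * (real DIM('a) * k (norm (x - y)) + norm (x - y) * k' (norm (x - y))))"
  proof
    fix x
    define z where "z = x - y"
    have "(\<Sum>i\<in>Basis. DF i x \<bullet> i) = real DIM('a) * k (norm z) + (k' (norm z) / norm z) * (\<Sum>i\<in>Basis. (z \<bullet> i) * (z \<bullet> i))"
      by (simp add: DF_def z_def[symmetric] inner_add_left sum.distrib sum_distrib_left inner_same_Basis mult_ac)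
    also have "(\<Sum>i\<in>Basis. (z \<bullet> i) * (z \<bullet> i)) = norm z * norm z"
      by (simp add: euclidean_inner[symmetric] power2_norm_eq_inner[symmetric] power2_eq_square)
    finally show "\<phi> x * (\<Sum>i\<in>Basis. DF i x \<bullet> i) = \<phi> x * (real DIM('a) * k (norm (x - y)) + norm (x - y) * k' (norm (x - y)))"
      by (simp add: z_def)
  qed
  finally show ?thesis .
qed

text \<open>The Cauchy-Schwarz inequality reduces this to the monotonicity of \<open>t \<mapsto> t\<^sup>p\<^sup>-\<^sup>1\<close>.\<close>

lemma p_flux_monotone:
  fixes a b :: "'a::real_inner"
  assumes p: "2 \<le> p"
  shows "0 \<le> (norm a powr (p - 2) *\<^sub>R a - norm b powr (p - 2) *\<^sub>R b) \<bullet> (a - b)"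
proof -
  define \<alpha> \<beta> where "\<alpha> = norm a powr (p - 2)" and "\<beta> = norm b powr (p - 2)"
  have nonneg: "0 \<le> \<alpha>" "0 \<le> \<beta>" by (auto simp: \<alpha>_def \<beta>_def)
  have cs: "a \<bullet> b \<le> norm a * norm b" by (rule norm_cauchy_schwarz)
  have "(\<alpha> *\<^sub>R a - \<beta> *\<^sub>R b) \<bullet> (a - b) = \<alpha> * (norm a)\<^sup>2 + \<beta> * (norm b)\<^sup>2 - (\<alpha> + \<beta>) * (a \<bullet> b)"
    by (simp add: inner_diff inner_commute power2_norm_eq_inner algebra_simps)
  also have "\<dots> \<ge> \<alpha> * (norm a)\<^sup>2 + \<beta> * (norm b)\<^sup>2 - (\<alpha> + \<beta>) * (norm a * norm b)"
    using mult_left_mono[OF cs, of "\<alpha> + \<beta>"] nonneg by simp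
  also have "\<alpha> * (norm a)\<^sup>2 + \<beta> * (norm b)\<^sup>2 - (\<alpha> + \<beta>) * (norm a * norm b)
    = (\<alpha> * norm a - \<beta> * norm b) * (norm a - norm b)"
    by (simp add: power2_eq_square algebra_simps)
  finally have le: "(\<alpha> * norm a - \<beta> * norm b) * (norm a - norm b) \<le> (\<alpha> *\<^sub>R a - \<beta> *\<^sub>R b) \<bullet> (a - b)" .
  have "0 \<le> (\<alpha> * norm a - \<beta> * norm b) * (norm a - norm b)"
  proof (cases "norm a \<le> norm b")
    case True
    then have "\<alpha> * norm a \<le> \<beta> * norm b"
      unfolding \<alpha>_def \<beta>_def using p by (intro mult_mono powr_mono2) auto
    with True show ?thesis by (simp add: mult_nonpos_nonpos)
  next
    case False
    then have "\<beta> * norm b \<le> \<alpha> * norm a"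
      unfolding \<alpha>_def \<beta>_def using p by (intro mult_mono powr_mono2) auto
    with False show ?thesis by simp
  qed
  with le show ?thesis unfolding \<alpha>_def \<beta>_def by simp
qed

text \<open>A form of Young's inequality with a free weight \<open>t\<close>; it replaces Hoelder's inequality when the flux,
which is of order \<open>|H|\<^sup>p\<^sup>-\<^sup>1\<close>, is paired with a small gradient error. Either \<open>b \<le> t a\<close> or \<open>a < b / t\<close>.\<close>

lemma powr_Young:
  fixes a b t p :: real
  assumes "0 \<le> a" "0 \<le> b" "0 < t" "1 \<le> p"
  shows "a powr (p - 1) * b \<le> t * a powr p + t powr (1 - p) * b powr p"
proof (cases "b \<le> t * a")
  case True
  have "a powr (p - 1) * b \<le> a powr (p - 1) * (t * a)" using True by (intro mult_left_mono) auto
  also have "\<dots> = t * (a powr (p - 1) * a powr 1)" using assms by simp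
  also have "a powr (p - 1) * a powr 1 = a powr p" by (subst powr_add[symmetric]) simp
  finally show ?thesis by (simp add: add_increasing2)
next
  case False
  then have b: "0 < b" "a \<le> b / t" using assms by (auto simp: field_simps) (smt (verit) mult_nonneg_nonneg)
  have "a powr (p - 1) * b \<le> (b / t) powr (p - 1) * b" using b assms by (intro mult_right_mono powr_mono2) auto
  also have "(b / t) powr (p - 1) = t powr (1 - p) * b powr (p - 1)"
    using assms b by (simp add: powr_divide powr_diff field_simps)
  also have "t powr (1 - p) * b powr (p - 1) * b = t powr (1 - p) * (b powr (p - 1) * b powr 1)" using b by simp
  also have "b powr (p - 1) * b powr 1 = b powr p" by (subst powr_add[symmetric]) simp
  finally show ?thesis using assms by (simp add: add_increasing)
qed

section \<open>Comparison of weak solutions with smooth barriers\<close>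

lemma nonpos_if_le_small_multiples:
  fixes a c \<eta>0 :: real
  assumes "0 < \<eta>0" "\<And>\<eta>. 0 < \<eta> \<Longrightarrow> \<eta> < \<eta>0 \<Longrightarrow> a \<le> c * \<eta>"
  shows "a \<le> 0"
proof (rule tendsto_lowerbound)
  have "((\<lambda>\<eta>. c * \<eta>) \<longlongrightarrow> c * 0) (at_right 0)" by (intro tendsto_intros)
  then show "((\<lambda>\<eta>. c * \<eta>) \<longlongrightarrow> 0) (at_right 0)" by simp
  show "eventually (\<lambda>\<eta>. a \<le> c * \<eta>) (at_right 0)"
    using assms by (auto simp: eventually_at_right_field)
qed simp

lemma positive_part_square_Lipschitz:
  fixes a b M :: real
  assumes "a \<le> M" "b \<le> M" "0 \<le> M"
  shows "\<bar>(max a 0)\<^sup>2 - (max b 0)\<^sup>2\<bar> \<le> 2 * M * \<bar>a - b\<bar>"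
proof -
  have "(max a 0)\<^sup>2 - (max b 0)\<^sup>2 = (max a 0 + max b 0) * (max a 0 - max b 0)"
    by (simp add: power2_eq_square algebra_simps)
  then have "\<bar>(max a 0)\<^sup>2 - (max b 0)\<^sup>2\<bar> = (max a 0 + max b 0) * \<bar>max a 0 - max b 0\<bar>"
    by (simp add: abs_mult)
  also have "\<dots> \<le> (2 * M) * \<bar>a - b\<bar>"
    using assms by (intro mult_mono) auto
  finally show ?thesis .
qed

text \<open>Comparison of a weak sub- or supersolution \<open>u\<close> (\<open>\<sigma> = 1\<close> or \<open>\<sigma> = -1\<close>) with a smooth barrier \<open>V\<close> whose
\<open>p\<close>-Laplacian satisfies a strict inequality wherever \<open>u\<close> is on the wrong side of \<open>V\<close>. The classical proof tests both equations
with a function of the positive part of \<open>w - \<delta>\<close>, where \<open>w = \<sigma> (u - V)\<close>, and uses monotonicity of the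
\<open>p\<close>-Laplacian. Here \<open>u\<close> is not \<open>C\<^sup>1\<close>, so the test function is built from a smooth approximation \<open>v\<close> of
\<open>u\<close>; only \<open>H\<close> against the gradient of \<open>v\<close> then produces an error, which Young's inequality and the strong
convergence of the gradients make arbitrarily small. What remains is that the integral of \<open>E - D\<close>
against a positive function of \<open>w\<close> on the bad set is not positive. As \<open>D < E\<close> there, the bad set is null,
and by continuity it is empty.\<close>

lemma weak_comparison:
  fixes u V D E :: "'a::euclidean_space \<Rightarrow> real" and H dV :: "'a \<Rightarrow> 'a"
  assumes \<Omega>: "open \<Omega>" and A: "open A" "compact (closure A)" "closure A \<subseteq> \<Omega>"
    and u: "continuous_on \<Omega> u" and u_meas[measurable]: "u \<in> borel_measurable borel"
    and H_meas[measurable]: "H \<in> borel_measurable borel"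
    and p: "2 \<le> p" and Lp: "\<And>L. compact L \<Longrightarrow> L \<subseteq> \<Omega> \<Longrightarrow> integrable lborel (\<lambda>x. indicator L x * norm (H x) powr p)"
    and weak: "\<And>\<phi>. \<phi> \<in> C01 \<Omega> \<Longrightarrow> (LBINT x. u x *\<^sub>R grad \<phi> x) = - (LBINT x. \<phi> x *\<^sub>R H x)"
    and V: "continuous_on (closure A) V" "\<And>x. x \<in> A \<Longrightarrow> GDERIV V x :> dV x"
    and dV: "continuous_on A dV" "\<And>x. x \<in> A \<Longrightarrow> dV x \<noteq> 0"
    and \<sigma>: "\<sigma> = 1 \<or> \<sigma> = -1"
    and sub: "\<And>\<phi>. \<phi> \<in> C01 A \<Longrightarrow> (\<And>x. 0 \<le> \<phi> x) \<Longrightarrow>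
        \<sigma> * (LBINT x. (norm (H x) powr (p - 2) *\<^sub>R H x) \<bullet> grad \<phi> x) \<le> - (LBINT x. E x * \<phi> x)"
    and bar: "\<And>\<phi>. \<phi> \<in> C01 A \<Longrightarrow>
        \<sigma> * (LBINT x. (norm (dV x) powr (p - 2) *\<^sub>R dV x) \<bullet> grad \<phi> x) = - (LBINT x. D x * \<phi> x)"
    and E: "E \<in> borel_measurable borel" "\<And>x. x \<in> A \<Longrightarrow> \<bar>E x\<bar> \<le> BE"
    and D: "continuous_on A D"
    and bdry: "\<And>x. x \<in> frontier A \<Longrightarrow> \<sigma> * (u x - V x) < \<delta>"
    and strict: "\<And>x. x \<in> A \<Longrightarrow> \<delta> < \<sigma> * (u x - V x) \<Longrightarrow> D x < E x"
    and x1: "x1 \<in> A"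
  shows "\<sigma> * (u x1 - V x1) \<le> \<delta>"
proof (rule ccontr)
  assume contra: "\<not> \<sigma> * (u x1 - V x1) \<le> \<delta>"
  define w where "w = (\<lambda>x. \<sigma> * (u x - V x))"
  have w1: "\<delta> < w x1" using contra by (simp add: w_def)
  define \<delta>1 where "\<delta>1 = (\<delta> + w x1) / 2"
  have \<delta>1: "\<delta> < \<delta>1" "\<delta>1 < w x1" using w1 by (auto simp: \<delta>1_def)
  have \<sigma>2: "\<sigma> * \<sigma> = 1" "\<bar>\<sigma>\<bar> = 1" using \<sigma> by auto
  have w_cont: "continuous_on (closure A) w"
    unfolding w_def by (intro continuous_intros continuous_on_subset[OF u A(3)] V)
  have w_cont_A: "continuous_on A w" by (rule continuous_on_subset[OF w_cont closure_subset])
  define K where "K = {x \<in> closure A. \<delta> \<le> w x}"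
  have K_sub: "K \<subseteq> A"
  proof
    fix x assume x: "x \<in> K"
    then have "x \<notin> frontier A" using bdry[of x] by (auto simp: K_def w_def)
    then show "x \<in> A" using x A(1) by (simp add: K_def frontier_def interior_open)
  qed
  have K_cpt: "compact K"
  proof -
    have "closed K" unfolding K_def
      using continuous_closed_preimage[OF w_cont closed_closure closed_atLeast[of \<delta>]] by (simp add: vimage_def Int_def)
    moreover have "bounded K" using A(2) by (rule bounded_subset[OF compact_imp_bounded]) (auto simp: K_def)
    ultimately show ?thesis by (simp add: compact_eq_bounded_closed)
  qed
  have [measurable]: "K \<in> sets borel" using K_cpt by (simp add: borel_compact)
  have K_fin: "emeasure lborel K < \<infinity>" using compact_imp_bounded[OF K_cpt] by (rule emeasure_bounded_finite)
  have int_K: "integrable lborel (\<lambda>x. indicator K x * c)" for c :: real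
    using K_fin by (intro integrable_mult_left integrable_real_indicator) auto
  obtain M0 where M0: "0 < M0" "\<And>x. x \<in> closure A \<Longrightarrow> \<bar>w x\<bar> \<le> M0"
    using continuous_compact_bounded[OF w_cont A(2)] unfolding real_norm_def by blast
  define M where "M = M0 + 1 + \<bar>\<delta>1\<bar>"
  have M: "0 < M" using M0(1) by (simp add: M_def)
  define flux where "flux = (\<lambda>v::'a. norm v powr (p - 2) *\<^sub>R v)"
  have norm_flux: "norm (flux v) = norm v powr (p - 1)" for v
  proof (cases "v = 0")
    case False
    then have "norm (flux v) = norm v powr (p - 2) * norm v powr 1" by (simp add: flux_def)
    also have "\<dots> = norm v powr (p - 1)" by (subst powr_add[symmetric]) simp
    finally show ?thesis .
  qed (simp add: flux_def)
  have [measurable]: "(\<lambda>x. flux (H x)) \<in> borel_measurable borel" unfolding flux_def by measurable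
  have fluxV_cont: "continuous_on A (\<lambda>x. flux (dV x))"
    unfolding flux_def using dV by (intro continuous_intros) auto
  obtain BF where BF: "0 < BF" "\<And>x. x \<in> K \<Longrightarrow> norm (flux (dV x)) \<le> BF"
    using continuous_compact_bounded[OF continuous_on_subset[OF fluxV_cont K_sub] K_cpt] by blast
  obtain BD where BD: "0 < BD" "\<And>x. x \<in> K \<Longrightarrow> \<bar>D x\<bar> \<le> BD"
    using continuous_compact_bounded[OF continuous_on_subset[OF D K_sub] K_cpt] unfolding real_norm_def by blast
  define B where "B = BD + \<bar>BE\<bar>"
  have B: "\<bar>E x - D x\<bar> \<le> B" if "x \<in> K" for x
    using BD(2)[OF that] E(2)[of x] that K_sub unfolding B_def by fastforce
  have B0: "0 \<le> B" using BD by (simp add: B_def)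
  define ED where "ED = (\<lambda>x. indicator K x * (E x - D x))"
  have "(\<lambda>x. indicator K x *\<^sub>R D x) \<in> borel_measurable borel"
    by (rule borel_measurable_continuous_on_indicator[OF _ continuous_on_subset[OF D K_sub]]) measurable
  then have "(\<lambda>x. indicator K x * E x - indicator K x *\<^sub>R D x) \<in> borel_measurable borel"
    using E(1) by measurable
  then have ED_meas[measurable]: "ED \<in> borel_measurable borel" by (simp add: ED_def algebra_simps)
  have ED_le: "\<bar>ED x\<bar> \<le> indicator K x * B" for x using B[of x] by (auto simp: ED_def indicator_def)
  \<comment> \<open>Cutting at \<open>\<delta>1\<close> instead of \<open>\<delta>\<close> keeps the test function inside \<open>K\<close> when \<open>u\<close> is replaced by \<open>v\<close>.\<close>
  define \<psi> where "\<psi> = (\<lambda>t. (max (t - \<delta>1) 0)\<^sup>2)"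
  define S where "S = (LBINT x. ED x * \<psi> (w x))"
  define Kv where "Kv = (LBINT x. indicator K x :: real)"
  define Q where "Q = (LBINT x. indicator K x * norm (H x) powr p) + BF * Kv"
  have Lp_K: "integrable lborel (\<lambda>x. indicator K x * norm (H x) powr p)"
    using Lp[OF K_cpt] K_sub A(3) closure_subset by blast
  define wK where "wK = (\<lambda>x. indicator K x *\<^sub>R w x)"
  have wK_meas[measurable]: "wK \<in> borel_measurable borel"
    unfolding wK_def
    by (rule borel_measurable_continuous_on_indicator[OF _ continuous_on_subset[OF w_cont_A K_sub]]) measurable
  have "(\<lambda>x. ED x * \<psi> (wK x)) \<in> borel_measurable borel" unfolding \<psi>_def by measurable
  moreover have "ED x * \<psi> (wK x) = ED x * \<psi> (w x)" for x by (simp add: ED_def wK_def indicator_def)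
  ultimately have ED\<psi>_meas: "(\<lambda>x. ED x * \<psi> (w x)) \<in> borel_measurable borel" by simp
  have \<psi>_le: "\<psi> t \<le> M\<^sup>2" if "\<bar>t\<bar> \<le> M0 + 1" for t
    unfolding \<psi>_def using that M by (intro power_mono) (auto simp: M_def)
  have \<psi>0: "0 \<le> \<psi> t" for t by (simp add: \<psi>_def)
  have int_ED\<psi>: "integrable lborel (\<lambda>x. ED x * \<psi> (w x))"
  proof (rule Bochner_Integration.integrable_bound[OF int_K[of "B * M\<^sup>2"]])
    show "AE x in lborel. norm (ED x * \<psi> (w x)) \<le> norm (indicator K x * (B * M\<^sup>2))"
    proof (rule AE_I2)
      fix x
      show "norm (ED x * \<psi> (w x)) \<le> norm (indicator K x * (B * M\<^sup>2))"
      proof (cases "x \<in> K")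
        case True
        then have "\<psi> (w x) \<le> M\<^sup>2" using M0(2)[of x] by (intro \<psi>_le) (auto simp: K_def)
        then have "\<bar>ED x\<bar> * \<psi> (w x) \<le> B * M\<^sup>2"
          using True ED_le[of x] \<psi>0 B0 by (intro mult_mono) auto
        then show ?thesis using True B0 \<psi>0 by (simp add: abs_mult)
      qed (simp add: ED_def)
    qed
  qed (use ED\<psi>_meas in simp)
  \<comment> \<open>The weight \<open>t\<close> of Young's inequality is kept fixed while \<open>\<eta>\<close> tends to \<open>0\<close>, and only then \<open>t\<close> does.\<close>
  have est: "S \<le> 2 * M * (t * Q + t powr (1 - p) * (1 + BF) * \<eta>) + 2 * M * B * Kv * \<eta>"
    if t: "0 < t" and \<eta>: "0 < \<eta>" "\<eta> < min 1 (\<delta>1 - \<delta>)" for t \<eta>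
  proof -
    have p1: "1 \<le> p" using p by simp
    obtain v dv where v: "\<And>x. GDERIV v x :> dv x" and dv: "continuous_on UNIV dv"
      and vu: "\<And>x. x \<in> closure A \<Longrightarrow> \<bar>v x - u x\<bar> \<le> \<eta>"
      and dvH: "(\<integral>\<^sup>+x\<in>closure A. norm (dv x - H x) powr p \<partial>lborel) \<le> ennreal \<eta>"
      using smooth_approximation[OF \<Omega> A(2,3) u u_meas H_meas p1 Lp weak \<eta>(1)] by blast
    have [measurable]: "dv \<in> borel_measurable borel" by (rule borel_measurable_continuous_onI[OF dv])
    have v_cont: "continuous_on UNIV v"
      unfolding continuous_on_eq_continuous_at[OF open_UNIV]
      using has_derivative_continuous v[unfolded gderiv_def] by blast
    define \<omega> where "\<omega> = (\<lambda>x. \<sigma> * (v x - V x))"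
    have \<omega>w: "\<bar>\<omega> x - w x\<bar> \<le> \<eta>" if "x \<in> closure A" for x
    proof -
      have "\<omega> x - w x = \<sigma> * (v x - u x)" by (simp add: \<omega>_def w_def algebra_simps)
      then show ?thesis using vu[OF that] \<sigma>2 by (simp add: abs_mult)
    qed
    define m where "m = (\<lambda>x. max (\<omega> x - \<delta>1) 0)"
    define \<phi> where "\<phi> = (\<lambda>x. if x \<in> A then (m x)\<^sup>2 else 0)"
    define d\<phi> where "d\<phi> = (\<lambda>x. if x \<in> A then (2 * m x * \<sigma>) *\<^sub>R (dv x - dV x) else 0)"
    have m_zero: "m x = 0" if "x \<in> A" "x \<notin> K" for x
    proof -
      have xc: "x \<in> closure A" using that(1) closure_subset by blast
      then have "w x < \<delta>" using that(2) by (simp add: K_def)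
      moreover have "\<eta> < \<delta>1 - \<delta>" using \<eta> by simp
      ultimately have "\<omega> x \<le> \<delta>1" using \<omega>w[OF xc] by linarith
      then show ?thesis by (simp add: m_def)
    qed
    have zero: "\<phi> x = 0" "d\<phi> x = 0" if "x \<notin> K" for x
      using that m_zero[of x] by (auto simp: \<phi>_def d\<phi>_def)
    have m_le: "0 \<le> m x" "m x \<le> M" if "x \<in> closure A" for x
      using \<omega>w[OF that] M0(2)[OF that] \<eta> unfolding m_def M_def by auto
    have m_cont: "continuous_on A m"
      unfolding m_def \<omega>_def
      by (intro continuous_intros continuous_on_subset[OF v_cont] continuous_on_subset[OF V(1)] closure_subset) auto
    have der: "GDERIV \<phi> x :> d\<phi> x" for x
    proof (cases "x \<in> A")
      case True
      have 1: "GDERIV (\<lambda>x. \<sigma> * (v x - V x) - \<delta>1) x :> \<sigma> *\<^sub>R (dv x - dV x)"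
        by (rule GDERIV_subst[OF GDERIV_diff[OF GDERIV_mult[OF GDERIV_const GDERIV_diff[OF v V(2)[OF True]]] GDERIV_const]]) simp
      have 2: "((\<lambda>t. (max t 0)\<^sup>2) has_real_derivative 2 * max t 0) (at t)" for t :: real
      proof -
        have "GDERIV (\<lambda>t. (max t 0)\<^sup>2) t :> 2 * max t 0"
        proof (rule gderiv_if_quadratic_remainder[where C=1])
          fix h :: real
          show "\<bar>(max (t + h) 0)\<^sup>2 - (max t 0)\<^sup>2 - h \<bullet> (2 * max t 0)\<bar> \<le> 1 * (norm h)\<^sup>2"
            using positive_part_square_remainder[of "t + h" t] by (simp add: mult.commute)
        qed
        then show ?thesis by simp
      qed
      have "GDERIV (\<lambda>x. (m x)\<^sup>2) x :> d\<phi> x"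
        using GDERIV_DERIV_compose[OF 1 2] True unfolding m_def \<omega>_def d\<phi>_def by simp
      then show ?thesis unfolding gderiv_def using A(1) True
        by (rule has_derivative_transform_within_open) (simp add: \<phi>_def)
    next
      case False
      have op: "open (- K)" using K_cpt by (simp add: compact_imp_closed open_Compl)
      have x: "x \<in> - K" using False K_sub by auto
      have "GDERIV \<phi> x :> 0" by (rule gderiv_eq_0[OF op x]) (simp add: zero)
      then show ?thesis using x by (simp add: zero)
    qed
    have cont: "continuous_on UNIV d\<phi>"
    proof (rule continuous_on_UNIV_if_support[OF A(1) _ K_cpt K_sub zero(2)])
      have "continuous_on A (\<lambda>x. (2 * m x * \<sigma>) *\<^sub>R (dv x - dV x))"
        by (intro continuous_intros m_cont continuous_on_subset[OF dv] dV) auto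
      then show "continuous_on A d\<phi>" by (rule continuous_on_eq) (simp add: d\<phi>_def)
    qed
    have mem: "\<phi> \<in> C01 A" and gr: "grad \<phi> = d\<phi>"
      using C01_by_gradient[OF der cont K_cpt K_sub zero(1)] by simp_all
    have \<phi>_cont: "continuous_on UNIV \<phi>" by (rule C01_continuous(1)[OF mem])
    have [measurable]: "\<phi> \<in> borel_measurable borel" "d\<phi> \<in> borel_measurable borel"
      by (auto intro: borel_measurable_continuous_onI \<phi>_cont cont)
    obtain Bd where Bd: "0 < Bd" "\<And>x. norm (d\<phi> x) \<le> Bd" using compact_support_bounded[OF cont K_cpt zero(2)] by blast
    have iH: "integrable lborel (\<lambda>x. flux (H x) \<bullet> d\<phi> x)"
    proof (rule Bochner_Integration.integrable_bound)
      show "integrable lborel (\<lambda>x. Bd * (indicator K x * 1 + indicator K x * norm (H x) powr p))"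
        by (intro integrable_mult_right Bochner_Integration.integrable_add int_K Lp_K)
      show "AE x in lborel. norm (flux (H x) \<bullet> d\<phi> x) \<le> norm (Bd * (indicator K x * 1 + indicator K x * norm (H x) powr p))"
      proof (rule AE_I2)
        fix x
        show "norm (flux (H x) \<bullet> d\<phi> x) \<le> norm (Bd * (indicator K x * 1 + indicator K x * norm (H x) powr p))"
        proof (cases "x \<in> K")
          case True
          have "\<bar>flux (H x) \<bullet> d\<phi> x\<bar> \<le> norm (flux (H x)) * norm (d\<phi> x)" by (rule Cauchy_Schwarz_ineq2)
          also have "\<dots> \<le> (1 + norm (H x) powr p) * Bd"
          proof (rule mult_mono)
            have "norm (H x) powr (p - 1) * 1 \<le> 1 * norm (H x) powr p + 1 powr (1 - p) * 1 powr p"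
              using p1 by (intro powr_Young) auto
            then show "norm (flux (H x)) \<le> 1 + norm (H x) powr p" by (simp add: norm_flux)
          qed (use Bd in auto)
          finally show ?thesis using True Bd(1) by (simp add: mult.commute)
        qed (simp add: zero)
      qed
    qed simp
    have iV: "integrable lborel (\<lambda>x. flux (dV x) \<bullet> d\<phi> x)"
    proof (rule integrable_continuous_support[OF continuous_on_UNIV_if_support[OF A(1) _ K_cpt K_sub] K_cpt])
      show "continuous_on A (\<lambda>x. flux (dV x) \<bullet> d\<phi> x)"
        by (intro continuous_intros fluxV_cont continuous_on_subset[OF cont]) auto
    qed (simp_all add: zero)
    have \<phi>_le: "\<bar>\<phi> x\<bar> \<le> M\<^sup>2" for x
      using m_le[of x] closure_subset[of A] by (auto simp: \<phi>_def intro!: power_mono)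
    have iE: "integrable lborel (\<lambda>x. E x * \<phi> x)"
    proof (rule integrable_bounded_support[where K=K and B="\<bar>BE\<bar> * M\<^sup>2"])
      show "norm (E x * \<phi> x) \<le> \<bar>BE\<bar> * M\<^sup>2" for x
      proof (cases "x \<in> K")
        case True
        then have "\<bar>E x\<bar> * \<bar>\<phi> x\<bar> \<le> \<bar>BE\<bar> * M\<^sup>2"
          using E(2)[of x] K_sub \<phi>_le[of x] by (intro mult_mono) auto
        then show ?thesis by (simp add: abs_mult)
      qed (simp add: zero)
    qed (use E(1) zero compact_imp_bounded[OF K_cpt] in auto)
    have iD: "integrable lborel (\<lambda>x. D x * \<phi> x)"
    proof (rule integrable_continuous_support[OF continuous_on_UNIV_if_support[OF A(1) _ K_cpt K_sub] K_cpt])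
      show "continuous_on A (\<lambda>x. D x * \<phi> x)"
        by (intro continuous_intros D continuous_on_subset[OF \<phi>_cont]) auto
    qed (simp_all add: zero)
    have \<phi>0: "0 \<le> \<phi> x" for x by (simp add: \<phi>_def)
    \<comment> \<open>The equations for \<open>u\<close> and for the barrier, tested with the same function and subtracted.\<close>
    have s: "\<sigma> * (LBINT x. flux (H x) \<bullet> d\<phi> x) \<le> - (LBINT x. E x * \<phi> x)"
      using sub[OF mem \<phi>0] by (simp add: gr flux_def)
    have b: "\<sigma> * (LBINT x. flux (dV x) \<bullet> d\<phi> x) = - (LBINT x. D x * \<phi> x)"
      using bar[OF mem] by (simp add: gr flux_def)
    have X_le: "(\<integral>\<^sup>+x. ennreal (indicator K x * norm (dv x - H x) powr p) \<partial>lborel) \<le> ennreal \<eta>"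
    proof (rule order_trans[OF nn_integral_mono dvH])
      show "ennreal (indicator K x * norm (dv x - H x) powr p) \<le> ennreal (norm (dv x - H x) powr p) * indicator (closure A) x" for x
        using K_sub closure_subset[of A] by (auto simp: indicator_def)
    qed
    have iX: "integrable lborel (\<lambda>x. indicator K x * norm (dv x - H x) powr p)"
    proof (rule integrableI_bounded)
      show "(\<integral>\<^sup>+x. ennreal (norm (indicator K x * norm (dv x - H x) powr p)) \<partial>lborel) < \<infinity>"
        using X_le by (simp add: le_less_trans[OF _ ennreal_less_top])
    qed simp
    have X_int: "(LBINT x. indicator K x * norm (dv x - H x) powr p) \<le> \<eta>"
      using X_le nn_integral_eq_integral[OF iX] \<eta> by (simp add: ennreal_le_iff)
    have ED\<phi>: "ED x * \<phi> x = E x * \<phi> x - D x * \<phi> x" for x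
      by (auto simp: ED_def zero indicator_def algebra_simps)
    have "(LBINT x. ED x * \<phi> x) = (LBINT x. E x * \<phi> x - D x * \<phi> x)"
      unfolding ED\<phi> ..
    also have "\<dots> = (LBINT x. E x * \<phi> x) - (LBINT x. D x * \<phi> x)"
      by (rule Bochner_Integration.integral_diff[OF iE iD])
    also have "\<dots> \<le> - (\<sigma> * (LBINT x. flux (H x) \<bullet> d\<phi> x)) + \<sigma> * (LBINT x. flux (dV x) \<bullet> d\<phi> x)"
      using s b by linarith
    also have "\<dots> = (LBINT x. - \<sigma> * (flux (H x) \<bullet> d\<phi> x - flux (dV x) \<bullet> d\<phi> x))"
      unfolding integral_mult_right_zero Bochner_Integration.integral_diff[OF iH iV] by (simp add: algebra_simps)
    also have "\<dots> \<le> (LBINT x. 2 * M * (t * (indicator K x * norm (H x) powr p) + t * BF * indicator K x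
          + t powr (1 - p) * (1 + BF) * (indicator K x * norm (dv x - H x) powr p)))"
    proof (rule integral_mono)
      show "integrable lborel (\<lambda>x. - \<sigma> * (flux (H x) \<bullet> d\<phi> x - flux (dV x) \<bullet> d\<phi> x))"
        by (intro integrable_mult_right Bochner_Integration.integrable_diff iH iV)
      show "integrable lborel (\<lambda>x. 2 * M * (t * (indicator K x * norm (H x) powr p) + t * BF * indicator K x
          + t powr (1 - p) * (1 + BF) * (indicator K x * norm (dv x - H x) powr p)))"
        using int_K[of 1] by (intro integrable_mult_right Bochner_Integration.integrable_add iX Lp_K) auto
      fix x
      show "- \<sigma> * (flux (H x) \<bullet> d\<phi> x - flux (dV x) \<bullet> d\<phi> x) \<le>
        2 * M * (t * (indicator K x * norm (H x) powr p) + t * BF * indicator K x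
          + t powr (1 - p) * (1 + BF) * (indicator K x * norm (dv x - H x) powr p))"
      proof (cases "x \<in> K")
        case True
        then have xA: "x \<in> A" using K_sub by blast
        have mx: "0 \<le> m x" "m x \<le> M" using m_le[of x] closure_subset[of A] xA by auto
        define X where "X = dv x - H x"
        define G where "G = flux (H x) - flux (dV x)"
        have "- \<sigma> * (flux (H x) \<bullet> d\<phi> x - flux (dV x) \<bullet> d\<phi> x) = - (\<sigma> * \<sigma>) * (2 * m x) * (G \<bullet> (dv x - dV x))"
          using xA by (simp add: d\<phi>_def G_def inner_diff_left algebra_simps)
        also have "\<dots> = - (2 * m x * (G \<bullet> X)) - 2 * m x * (G \<bullet> (H x - dV x))"
          unfolding \<sigma>2 by (simp add: X_def inner_diff_right algebra_simps)
        also have "\<dots> \<le> 2 * m x * (norm G * norm X)"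
        proof -
          have "0 \<le> 2 * m x * (G \<bullet> (H x - dV x))"
            using mx p_flux_monotone[OF p, of "H x" "dV x"] unfolding G_def flux_def by simp
          moreover have "- (G \<bullet> X) \<le> norm G * norm X" using Cauchy_Schwarz_ineq2[of G X] by linarith
          then have "2 * m x * (- (G \<bullet> X)) \<le> 2 * m x * (norm G * norm X)" using mx by (intro mult_left_mono) auto
          ultimately show ?thesis by (simp only: mult_minus_right)
        qed
        also have "\<dots> \<le> 2 * M * (norm G * norm X)" using mx by (intro mult_right_mono) auto
        also have "\<dots> \<le> 2 * M * ((t * norm (H x) powr p + t powr (1 - p) * norm X powr p)
            + BF * (t + t powr (1 - p) * norm X powr p))"
        proof (rule mult_left_mono)
          have "norm G \<le> norm (H x) powr (p - 1) + BF"
            unfolding G_def using norm_triangle_ineq4[of "flux (H x)" "flux (dV x)"] BF(2)[OF True] norm_flux[of "H x"] by linarith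
          then have "norm G * norm X \<le> (norm (H x) powr (p - 1) + BF) * norm X" by (intro mult_right_mono) auto
          moreover have "norm (H x) powr (p - 1) * norm X \<le> t * norm (H x) powr p + t powr (1 - p) * norm X powr p"
            using t p1 by (intro powr_Young) auto
          moreover have "1 powr (p - 1) * norm X \<le> t * 1 powr p + t powr (1 - p) * norm X powr p"
            using t p1 by (intro powr_Young) auto
          then have "BF * norm X \<le> BF * (t + t powr (1 - p) * norm X powr p)" using BF(1) by (intro mult_left_mono) auto
          ultimately show "norm G * norm X \<le> (t * norm (H x) powr p + t powr (1 - p) * norm X powr p)
            + BF * (t + t powr (1 - p) * norm X powr p)"
            by (simp add: distrib_right)
        qed (use M in simp)
        finally show ?thesis using True by (simp add: X_def algebra_simps)
      qed (simp add: zero)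
    qed
    also have "\<dots> = 2 * M * (t * Q + t powr (1 - p) * (1 + BF) * (LBINT x. indicator K x * norm (dv x - H x) powr p))"
    proof -
      have i1: "integrable lborel (\<lambda>x. t * (indicator K x * norm (H x) powr p))" by (intro integrable_mult_right Lp_K)
      have i2: "integrable lborel (\<lambda>x. t * BF * indicator K x)" using int_K[of 1] by (intro integrable_mult_right) simp
      have i3: "integrable lborel (\<lambda>x. t powr (1 - p) * (1 + BF) * (indicator K x * norm (dv x - H x) powr p))"
        by (intro integrable_mult_right iX)
      show ?thesis
        unfolding integral_mult_right_zero Bochner_Integration.integral_add[OF Bochner_Integration.integrable_add[OF i1 i2] i3]
          Bochner_Integration.integral_add[OF i1 i2]
        by (simp add: Q_def Kv_def algebra_simps)
    qed
    also have "\<dots> \<le> 2 * M * (t * Q + t powr (1 - p) * (1 + BF) * \<eta>)"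
      using M BF(1) X_int by (intro mult_left_mono add_left_mono) auto
    finally have 1: "(LBINT x. ED x * \<phi> x) \<le> 2 * M * (t * Q + t powr (1 - p) * (1 + BF) * \<eta>)" .
    have i\<phi>: "integrable lborel (\<lambda>x. ED x * \<phi> x)"
      unfolding ED\<phi> by (rule Bochner_Integration.integrable_diff[OF iE iD])
    have "S - (LBINT x. ED x * \<phi> x) = (LBINT x. ED x * \<psi> (w x) - ED x * \<phi> x)"
      unfolding S_def by (rule Bochner_Integration.integral_diff[OF int_ED\<psi> i\<phi>, symmetric])
    also have "\<dots> \<le> (LBINT x. indicator K x * (2 * M * B * \<eta>))"
    proof (rule integral_mono[OF Bochner_Integration.integrable_diff[OF int_ED\<psi> i\<phi>] int_K])
      fix x
      show "ED x * \<psi> (w x) - ED x * \<phi> x \<le> indicator K x * (2 * M * B * \<eta>)"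
      proof (cases "x \<in> K")
        case True
        then have xA: "x \<in> A" "x \<in> closure A" using K_sub by (auto simp: K_def)
        have "\<bar>(max (w x - \<delta>1) 0)\<^sup>2 - (max (\<omega> x - \<delta>1) 0)\<^sup>2\<bar> \<le> 2 * M * \<bar>(w x - \<delta>1) - (\<omega> x - \<delta>1)\<bar>"
          using \<omega>w[OF xA(2)] M0(2)[OF xA(2)] \<eta> M by (intro positive_part_square_Lipschitz) (auto simp: M_def)
        also have "\<dots> \<le> 2 * M * \<eta>" using \<omega>w[OF xA(2)] M by (intro mult_left_mono) auto
        finally have "\<bar>\<psi> (w x) - \<phi> x\<bar> \<le> 2 * M * \<eta>" using xA by (simp add: \<psi>_def \<phi>_def m_def)
        then have "\<bar>ED x\<bar> * \<bar>\<psi> (w x) - \<phi> x\<bar> \<le> B * (2 * M * \<eta>)"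
          using True ED_le[of x] B0 by (intro mult_mono) auto
        moreover have "ED x * \<psi> (w x) - ED x * \<phi> x \<le> \<bar>ED x\<bar> * \<bar>\<psi> (w x) - \<phi> x\<bar>"
          unfolding abs_mult[symmetric] right_diff_distrib by (rule abs_ge_self)
        ultimately show ?thesis using True by (simp add: mult_ac)
      qed (simp add: ED_def)
    qed
    also have "\<dots> = 2 * M * B * Kv * \<eta>" unfolding Kv_def by simp
    finally show ?thesis using 1 by linarith
  qed
  have S_le_t: "S - 2 * M * (t * Q) \<le> 0" if t: "0 < t" for t
  proof (rule nonpos_if_le_small_multiples)
    fix \<eta> assume "0 < \<eta>" "\<eta> < min 1 (\<delta>1 - \<delta>)"
    from est[OF t this]
    show "S - 2 * M * (t * Q) \<le> (2 * M * (t powr (1 - p) * (1 + BF)) + 2 * M * B * Kv) * \<eta>"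
      by (simp add: algebra_simps)
  qed (use \<delta>1 in simp)
  have "S \<le> (2 * M * Q) * t" if "0 < t" for t using S_le_t[OF that] by (simp add: mult_ac)
  then have S_le: "S \<le> 0" by (intro nonpos_if_le_small_multiples[of 1 S "2 * M * Q"]) auto
  have nonneg: "0 \<le> ED x * \<psi> (w x)" for x
  proof (cases "x \<in> K \<and> \<delta>1 < w x")
    case True
    then have "D x < E x" using \<delta>1 K_sub by (intro strict) (auto simp: w_def)
    with True show ?thesis by (simp add: ED_def \<psi>0)
  next
    case False
    then show ?thesis by (auto simp: ED_def \<psi>_def)
  qed
  then have "S = 0" using S_le unfolding S_def by (intro antisym integral_nonneg_AE AE_I2) auto
  then have "AE x in lborel. ED x * \<psi> (w x) = 0"
    unfolding S_def using integral_nonneg_eq_0_iff_AE[OF int_ED\<psi>] nonneg by auto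
  define U where "U = {x \<in> A. \<delta>1 < w x}"
  have U: "open U"
    unfolding U_def using continuous_open_preimage[OF w_cont_A A(1), of "{\<delta>1<..}"]
    by (auto simp: vimage_def Int_def conj_commute)
  have "AE x in lborel. x \<notin> U"
    using \<open>AE x in lborel. ED x * \<psi> (w x) = 0\<close>
  proof eventually_elim
    case (elim x)
    show "x \<notin> U"
    proof
      assume x: "x \<in> U"
      then have "x \<in> K" using \<delta>1 closure_subset[of A] by (auto simp: U_def K_def)
      moreover have "D x < E x" using x \<delta>1 by (intro strict) (auto simp: U_def w_def)
      moreover have "0 < \<psi> (w x)" using x by (simp add: U_def \<psi>_def)
      ultimately show False using elim by (simp add: ED_def)
    qed
  qed
  then have "emeasure lborel U = 0"
    using U by (subst (asm) AE_iff_measurable[OF _ refl]) auto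
  then have "negligible U" using U by (simp add: negligible_iff_emeasure0 borel_open)
  moreover have "x1 \<in> U" using x1 \<delta>1 by (simp add: U_def)
  ultimately show False using open_not_negligible[OF U] by blast
qed

section \<open>The weak formulation in terms of Borel functions\<close>

lemma borel_representative:
  fixes f :: "'a::euclidean_space \<Rightarrow> 'b::euclidean_space"
  assumes f: "f \<in> borel_measurable lebesgue"
  obtains h where "h \<in> borel_measurable borel" "AE x in lborel. f x = h x"
proof -
  have "\<exists>k\<in>borel_measurable lborel. AE x in lborel. f x \<bullet> i = k x" for i
    using f by (intro completion_ex_borel_measurable_real) simp
  then obtain k where k: "\<And>i. k i \<in> borel_measurable lborel" "\<And>i. AE x in lborel. f x \<bullet> i = k i x"
    by metis
  define h where "h = (\<lambda>x. \<Sum>i\<in>Basis. k i x *\<^sub>R i)"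
  have [measurable]: "k i \<in> borel_measurable borel" for i using k(1)[of i] by simp
  have "h \<in> borel_measurable borel" unfolding h_def by measurable
  moreover have "AE x in lborel. \<forall>i\<in>Basis. f x \<bullet> i = k i x"
    using k(2) by (intro AE_finite_allI) auto
  then have "AE x in lborel. f x = h x"
  proof eventually_elim
    case (elim x)
    then have "h x = (\<Sum>i\<in>Basis. (f x \<bullet> i) *\<^sub>R i)" by (simp add: h_def)
    then show ?case by (simp add: euclidean_representation)
  qed
  ultimately show ?thesis using that by blast
qed

lemma borel_measurable_lebesgue_on:
  "f \<in> borel_measurable borel \<Longrightarrow> f \<in> borel_measurable (lebesgue_on S)"
  by (intro measurable_restrict_space1 measurable_completion) simp

lemma integral_lebesgue_on_eq_lborel:
  fixes f h :: "'a::euclidean_space \<Rightarrow> 'b::euclidean_space"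
  assumes S: "S \<in> sets lebesgue" and f: "f \<in> borel_measurable (lebesgue_on S)" and h: "h \<in> borel_measurable borel"
    and ae: "AE x in lborel. indicator S x *\<^sub>R f x = h x"
  shows "(LINT x|lebesgue_on S. f x) = (LBINT x. h x)"
proof -
  have "(LINT x|lebesgue_on S. f x) = (LINT x|lebesgue. indicator S x *\<^sub>R f x)"
    using S by (intro integral_restrict_space) simp
  also have "\<dots> = (LINT x|lebesgue. h x)"
  proof (rule integral_cong_AE)
    have "(\<lambda>x. if x \<in> S then f x else 0) \<in> borel_measurable lebesgue"
      using f S by (simp add: borel_measurable_if)
    then show "(\<lambda>x. indicator S x *\<^sub>R f x) \<in> borel_measurable lebesgue"
      by (simp add: indicator_scaleR_eq_if)
    show "h \<in> borel_measurable lebesgue" using h by (auto intro: measurable_completion)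
    show "AE x in lebesgue. indicator S x *\<^sub>R f x = h x" using ae by (simp add: AE_completion)
  qed
  also have "\<dots> = (LBINT x. h x)" using h by (intro integral_completion) simp
  finally show ?thesis .
qed

text \<open>The weak gradient is only Lebesgue measurable on \<open>\<Omega>\<close>, whereas Fubini's theorem and convolutions live
on Borel functions. Replacing it by a Borel representative and \<open>u\<close> by its extension by zero does not
change any of the integrals. At the same time the absorption term is replaced by its two consequences
used below: \<open>u\<close> is a subsolution of the \<open>p\<close>-Laplace equation, and a supersolution of the equation with
the constant coefficient \<open>b\<close>.\<close>

lemma weak_solution_borel_gradient:
  fixes \<Omega> :: "'a::euclidean_space set" and u lam :: "'a \<Rightarrow> real"
  assumes \<Omega>: "open \<Omega>" and sol: "weak_solution p q lam g \<Omega> u"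
    and lam: "lam \<in> borel_measurable (lebesgue_on \<Omega>)" "\<And>x. x \<in> \<Omega> \<Longrightarrow> 0 \<le> lam x" "\<And>x. x \<in> \<Omega> \<Longrightarrow> lam x \<le> b"
    and nonneg: "\<And>x. x \<in> \<Omega> \<Longrightarrow> 0 \<le> u x" and p: "2 \<le> p" and q: "0 \<le> q"
  defines "v \<equiv> \<lambda>x. if x \<in> \<Omega> then u x else 0"
  obtains H where "H \<in> borel_measurable borel" "v \<in> borel_measurable borel" "continuous_on \<Omega> v"
    "\<And>L. compact L \<Longrightarrow> L \<subseteq> \<Omega> \<Longrightarrow> integrable lborel (\<lambda>x. indicator L x * norm (H x) powr p)"
    "\<And>\<phi>. \<phi> \<in> C01 \<Omega> \<Longrightarrow> (LBINT x. v x *\<^sub>R grad \<phi> x) = - (LBINT x. \<phi> x *\<^sub>R H x)"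
    "\<And>\<phi>. \<phi> \<in> C01 \<Omega> \<Longrightarrow> (\<And>x. 0 \<le> \<phi> x) \<Longrightarrow>
       (LBINT x. (norm (H x) powr (p - 2) *\<^sub>R H x) \<bullet> grad \<phi> x) \<le> 0"
    "\<And>\<phi>. \<phi> \<in> C01 \<Omega> \<Longrightarrow> (\<And>x. 0 \<le> \<phi> x) \<Longrightarrow>
       - (LBINT x. (norm (H x) powr (p - 2) *\<^sub>R H x) \<bullet> grad \<phi> x) \<le> (LBINT x. b * v x powr q * \<phi> x)"
proof -
  have S: "\<Omega> \<in> sets lebesgue" and [measurable]: "\<Omega> \<in> sets borel" using \<Omega> by auto
  obtain G where G: "W1p_loc_with_gradient p \<Omega> u G"
    and eq: "\<And>\<phi>. \<phi> \<in> C01 \<Omega> \<Longrightarrow> (\<And>x. 0 \<le> \<phi> x) \<Longrightarrow>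
      (LINT x|lebesgue_on \<Omega>. (norm (G x) powr (p - 2)) *\<^sub>R G x \<bullet> grad \<phi> x)
         = - (LINT x|lebesgue_on \<Omega>. lam x * max (u x) 0 powr q * \<phi> x)"
    and ucont: "continuous_on (closure \<Omega>) u"
    using sol unfolding weak_solution_def by blast
  have G_meas[measurable]: "G \<in> borel_measurable (lebesgue_on \<Omega>)" and u_meas[measurable]: "u \<in> borel_measurable (lebesgue_on \<Omega>)"
    and GL: "\<And>L. compact L \<Longrightarrow> L \<subseteq> \<Omega> \<Longrightarrow> integrable (lebesgue_on L) (\<lambda>x. norm (G x) powr p)"
    and wk: "\<And>\<phi>. \<phi> \<in> C01 \<Omega> \<Longrightarrow> (LINT x|lebesgue_on \<Omega>. u x *\<^sub>R grad \<phi> x) = - (LINT x|lebesgue_on \<Omega>. \<phi> x *\<^sub>R G x)"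
    using G by (auto simp: W1p_loc_with_gradient_def weak_gradient_def Lp_loc_def)
  have uc: "continuous_on \<Omega> u" using ucont closure_subset continuous_on_subset by blast
  have v_meas[measurable]: "v \<in> borel_measurable borel"
  proof -
    have "(\<lambda>x. indicator \<Omega> x *\<^sub>R u x) \<in> borel_measurable borel"
      by (rule borel_measurable_continuous_on_indicator[OF _ uc]) measurable
    moreover have "(\<lambda>x. indicator \<Omega> x *\<^sub>R u x) = v" by (auto simp: v_def)
    ultimately show ?thesis by simp
  qed
  have vc: "continuous_on \<Omega> v" using uc by (rule continuous_on_eq) (simp add: v_def)
  have "(\<lambda>x. if x \<in> \<Omega> then G x else 0) \<in> borel_measurable lebesgue"
    using G_meas S by (simp add: borel_measurable_if)
  then obtain H where H[measurable]: "H \<in> borel_measurable borel"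
    and HG: "AE x in lborel. (if x \<in> \<Omega> then G x else 0) = H x"
    by (rule borel_representative)
  have Lp: "integrable lborel (\<lambda>x. indicator L x * norm (H x) powr p)" if L: "compact L" "L \<subseteq> \<Omega>" for L
  proof -
    have [measurable]: "L \<in> sets borel" using L by (simp add: borel_compact)
    have "integrable lebesgue (\<lambda>x. indicator L x *\<^sub>R (norm (G x) powr p))"
      using GL[OF L] by (subst (asm) integrable_restrict_space) auto
    then have "integrable lebesgue (\<lambda>x. indicator L x * norm (H x) powr p)"
    proof (rule integrable_cong_AE_imp)
      show "(\<lambda>x. indicator L x * norm (H x) powr p) \<in> borel_measurable lebesgue"
        by (rule measurable_completion) measurable
      have "AE x in lebesgue. (if x \<in> \<Omega> then G x else 0) = H x" using HG by (rule AE_completion)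
      then show "AE x in lebesgue. indicator L x *\<^sub>R norm (G x) powr p = indicator L x * norm (H x) powr p"
        by eventually_elim (use L in \<open>auto simp: indicator_def split: if_splits\<close>)
    qed
    then show ?thesis by (subst (asm) integrable_completion) measurable
  qed
  have test: "continuous_on UNIV \<phi>" "continuous_on UNIV (grad \<phi>)" "\<phi> \<in> borel_measurable borel" "grad \<phi> \<in> borel_measurable borel"
    "\<phi> \<in> borel_measurable (lebesgue_on \<Omega>)" "grad \<phi> \<in> borel_measurable (lebesgue_on \<Omega>)"
    "\<And>x. x \<notin> \<Omega> \<Longrightarrow> \<phi> x = 0" "\<And>x. x \<notin> \<Omega> \<Longrightarrow> grad \<phi> x = 0"
    if \<phi>: "\<phi> \<in> C01 \<Omega>" for \<phi>
  proof -
    show c: "continuous_on UNIV \<phi>" "continuous_on UNIV (grad \<phi>)" using C01_continuous[OF \<phi>] by auto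
    then show b: "\<phi> \<in> borel_measurable borel" "grad \<phi> \<in> borel_measurable borel"
      by (auto intro: borel_measurable_continuous_onI)
    then show "\<phi> \<in> borel_measurable (lebesgue_on \<Omega>)" "grad \<phi> \<in> borel_measurable (lebesgue_on \<Omega>)"
      by (simp_all add: borel_measurable_lebesgue_on)
    obtain K where "K \<subseteq> \<Omega>" "\<And>x. x \<notin> K \<Longrightarrow> \<phi> x = 0" "\<And>x. x \<notin> K \<Longrightarrow> grad \<phi> x = 0"
      using C01_support[OF \<phi>] by metis
    then show "x \<notin> \<Omega> \<Longrightarrow> \<phi> x = 0" "x \<notin> \<Omega> \<Longrightarrow> grad \<phi> x = 0" for x by blast+
  qed
  have weak: "(LBINT x. v x *\<^sub>R grad \<phi> x) = - (LBINT x. \<phi> x *\<^sub>R H x)" if \<phi>: "\<phi> \<in> C01 \<Omega>" for \<phi>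
  proof -
    note [measurable] = test(3-6)[OF \<phi>]
    have "(LINT x|lebesgue_on \<Omega>. u x *\<^sub>R grad \<phi> x) = (LBINT x. v x *\<^sub>R grad \<phi> x)"
      by (rule integral_lebesgue_on_eq_lborel[OF S]) (measurable, auto simp: v_def indicator_def test[OF \<phi>])
    moreover have "(LINT x|lebesgue_on \<Omega>. \<phi> x *\<^sub>R G x) = (LBINT x. \<phi> x *\<^sub>R H x)"
    proof (rule integral_lebesgue_on_eq_lborel[OF S])
      show "AE x in lborel. indicator \<Omega> x *\<^sub>R \<phi> x *\<^sub>R G x = \<phi> x *\<^sub>R H x"
        using HG by eventually_elim (auto simp: indicator_def test[OF \<phi>] split: if_splits)
    qed measurable
    ultimately show ?thesis using wk[OF \<phi>] by simp
  qed
  have flux: "(LINT x|lebesgue_on \<Omega>. (norm (G x) powr (p - 2)) *\<^sub>R G x \<bullet> grad \<phi> x)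
     = (LBINT x. (norm (H x) powr (p - 2) *\<^sub>R H x) \<bullet> grad \<phi> x)" if \<phi>: "\<phi> \<in> C01 \<Omega>" for \<phi>
  proof -
    note [measurable] = test(3-6)[OF \<phi>]
    show ?thesis
    proof (rule integral_lebesgue_on_eq_lborel[OF S])
      show "AE x in lborel. indicator \<Omega> x *\<^sub>R ((norm (G x) powr (p - 2)) *\<^sub>R G x \<bullet> grad \<phi> x) = (norm (H x) powr (p - 2) *\<^sub>R H x) \<bullet> grad \<phi> x"
        using HG by eventually_elim (auto simp: indicator_def test[OF \<phi>] split: if_splits)
    qed measurable
  qed
  have upper: "(LBINT x. (norm (H x) powr (p - 2) *\<^sub>R H x) \<bullet> grad \<phi> x) \<le> 0"
    if \<phi>: "\<phi> \<in> C01 \<Omega>" "\<And>x. 0 \<le> \<phi> x" for \<phi>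
  proof -
    have "0 \<le> (LINT x|lebesgue_on \<Omega>. lam x * max (u x) 0 powr q * \<phi> x)"
      using lam(2) \<phi>(2) by (intro integral_nonneg_AE AE_I2) (auto simp: space_restrict_space)
    then show ?thesis using eq[OF \<phi>] flux[OF \<phi>(1)] by simp
  qed
  have lower: "- (LBINT x. (norm (H x) powr (p - 2) *\<^sub>R H x) \<bullet> grad \<phi> x) \<le> (LBINT x. b * v x powr q * \<phi> x)"
    if \<phi>: "\<phi> \<in> C01 \<Omega>" "\<And>x. 0 \<le> \<phi> x" for \<phi>
  proof -
    note [measurable] = test(3-6)[OF \<phi>(1)]
    obtain K where K: "compact K" "K \<subseteq> \<Omega>" "\<And>x. x \<notin> K \<Longrightarrow> \<phi> x = 0"
      using C01_support[OF \<phi>(1)] by metis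
    obtain B where B: "B > 0" "\<And>x. norm (\<phi> x) \<le> B" using compact_support_bounded[OF test(1)[OF \<phi>(1)] K(1,3)] by blast
    have "bounded (v ` K)" by (intro compact_imp_bounded compact_continuous_image continuous_on_subset[OF vc] K)
    then obtain Bv where Bv: "Bv > 0" "\<And>x. x \<in> K \<Longrightarrow> \<bar>v x\<bar> \<le> Bv" by (auto simp: bounded_pos)
    have v0: "0 \<le> v x" for x using nonneg by (simp add: v_def)
    have int: "integrable lborel (\<lambda>x. b * v x powr q * \<phi> x)"
    proof (rule integrable_bounded_support[where K=K and B="\<bar>b\<bar> * Bv powr q * B"])
      show "norm (b * v x powr q * \<phi> x) \<le> \<bar>b\<bar> * Bv powr q * B" for x
      proof (cases "x \<in> K")
        case True
        have "v x powr q \<le> Bv powr q" using Bv(2)[OF True] v0[of x] q by (intro powr_mono2) auto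
        then have "\<bar>b\<bar> * v x powr q * \<bar>\<phi> x\<bar> \<le> \<bar>b\<bar> * Bv powr q * B"
          using B(2)[of x] by (intro mult_mono) auto
        then show ?thesis by (simp add: abs_mult)
      qed (use K B in simp)
    qed (use K compact_imp_bounded in auto)
    have b0: "0 \<le> b" if "x \<in> \<Omega>" for x using lam(2)[OF that] lam(3)[OF that] by linarith
    have "- (LBINT x. (norm (H x) powr (p - 2) *\<^sub>R H x) \<bullet> grad \<phi> x) = (LINT x|lebesgue_on \<Omega>. lam x * max (u x) 0 powr q * \<phi> x)"
      using eq[OF \<phi>] flux[OF \<phi>(1)] by simp
    also have "\<dots> \<le> (LINT x|lebesgue_on \<Omega>. b * v x powr q * \<phi> x)"
    proof (rule integral_mono')
      have "integrable lebesgue (\<lambda>x. b * v x powr q * \<phi> x)" using int by (subst integrable_completion) auto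
      then have "integrable lebesgue (\<lambda>x. indicator \<Omega> x *\<^sub>R (b * v x powr q * \<phi> x))"
        by (rule Bochner_Integration.integrable_cong[THEN iffD1, rotated 2]) (auto simp: indicator_def test[OF \<phi>(1)])
      then show "integrable (lebesgue_on \<Omega>) (\<lambda>x. b * v x powr q * \<phi> x)"
        using S by (subst integrable_restrict_space) auto
      fix x assume "x \<in> space (lebesgue_on \<Omega>)"
      then have x: "x \<in> \<Omega>" by (simp add: space_restrict_space)
      show "lam x * max (u x) 0 powr q * \<phi> x \<le> b * v x powr q * \<phi> x"
      proof -
        have "max (u x) 0 = v x" using nonneg[OF x] x by (simp add: v_def)
        then show ?thesis using lam(3)[OF x] \<phi>(2)[of x] by (simp add: mult_right_mono)
      qed
      show "0 \<le> b * v x powr q * \<phi> x" using b0[OF x] \<phi>(2)[of x] by simp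
    qed
    also have "\<dots> = (LBINT x. b * v x powr q * \<phi> x)"
    proof (rule integral_lebesgue_on_eq_lborel[OF S])
      have "(\<lambda>x. b * v x powr q * \<phi> x) \<in> borel_measurable borel" by measurable
      then show "(\<lambda>x. b * v x powr q * \<phi> x) \<in> borel_measurable borel"
        "(\<lambda>x. b * v x powr q * \<phi> x) \<in> borel_measurable (lebesgue_on \<Omega>)"
        by (assumption, rule borel_measurable_lebesgue_on)
    qed (auto simp: indicator_def test[OF \<phi>(1)])
    finally show ?thesis .
  qed
  show ?thesis by (rule that[OF H v_meas vc Lp weak upper lower])
qed

section \<open>Radial barriers\<close>

text \<open>The comparison principle on the annulus \<open>s < |x - y| < R\<close> for the barrier \<open>h(|x - y|)\<close> with slope
\<open>h' = \<sigma> g\<close>, \<open>g > 0\<close>: increasing barriers from above for subsolutions, decreasing barriers from below for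
supersolutions. The expression in \<open>g\<close> and \<open>g'\<close> is \<open>\<sigma>\<close> times \<open>\<Delta>\<^sub>p\<close> of the barrier. The inner ball is
removed because the barriers are not differentiable at the centre.\<close>

lemma radial_comparison:
  fixes \<Omega> :: "'a::euclidean_space set" and u lam :: "'a \<Rightarrow> real" and h g g' :: "real \<Rightarrow> real"
  assumes \<Omega>: "open \<Omega>" and sol: "weak_solution p q lam bd \<Omega> u"
    and lam: "lam \<in> borel_measurable (lebesgue_on \<Omega>)" "\<And>x. x \<in> \<Omega> \<Longrightarrow> 0 \<le> lam x" "\<And>x. x \<in> \<Omega> \<Longrightarrow> lam x \<le> b"
    and nonneg: "\<And>x. x \<in> \<Omega> \<Longrightarrow> 0 \<le> u x" and p: "2 \<le> p" and q: "0 \<le> q"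
    and s: "0 < s" and R: "cball y R \<subseteq> \<Omega>"
    and h: "continuous_on {s..R} h" "\<And>r. s < r \<Longrightarrow> r < R \<Longrightarrow> (h has_real_derivative \<sigma> * g r) (at r)"
    and g: "\<And>r. s < r \<Longrightarrow> r < R \<Longrightarrow> 0 < g r" "\<And>r. s < r \<Longrightarrow> r < R \<Longrightarrow> (g has_real_derivative g' r) (at r)"
      "continuous_on {s<..<R} g'"
    and \<sigma>: "\<sigma> = 1 \<or> \<sigma> = -1"
    and bdry: "\<And>x. norm (x - y) = s \<or> norm (x - y) = R \<Longrightarrow> x \<in> \<Omega> \<Longrightarrow> \<sigma> * (u x - h (norm (x - y))) < \<delta>"
    and strict: "\<And>x r. x \<in> \<Omega> \<Longrightarrow> r = norm (x - y) \<Longrightarrow> s < r \<Longrightarrow> r < R \<Longrightarrow> \<delta> < \<sigma> * (u x - h r) \<Longrightarrow>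
      g r powr (p - 2) * ((real DIM('a) - 1) * g r / r + (p - 1) * g' r) < (if \<sigma> = 1 then 0 else - (b * u x powr q))"
    and z: "s < norm (z - y)" "norm (z - y) < R"
  shows "\<sigma> * (u z - h (norm (z - y))) \<le> \<delta>"
proof -
  define v where "v = (\<lambda>x. if x \<in> \<Omega> then u x else 0)"
  obtain H where H: "H \<in> borel_measurable borel" and v_meas[measurable]: "v \<in> borel_measurable borel" and v_cont: "continuous_on \<Omega> v"
    and Lp: "\<And>L. compact L \<Longrightarrow> L \<subseteq> \<Omega> \<Longrightarrow> integrable lborel (\<lambda>x. indicator L x * norm (H x) powr p)"
    and weak: "\<And>\<phi>. \<phi> \<in> C01 \<Omega> \<Longrightarrow> (LBINT x. v x *\<^sub>R grad \<phi> x) = - (LBINT x. \<phi> x *\<^sub>R H x)"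
    and upper: "\<And>\<phi>. \<phi> \<in> C01 \<Omega> \<Longrightarrow> (\<And>x. 0 \<le> \<phi> x) \<Longrightarrow>
       (LBINT x. (norm (H x) powr (p - 2) *\<^sub>R H x) \<bullet> grad \<phi> x) \<le> 0"
    and lower: "\<And>\<phi>. \<phi> \<in> C01 \<Omega> \<Longrightarrow> (\<And>x. 0 \<le> \<phi> x) \<Longrightarrow>
       - (LBINT x. (norm (H x) powr (p - 2) *\<^sub>R H x) \<bullet> grad \<phi> x) \<le> (LBINT x. b * v x powr q * \<phi> x)"
    using weak_solution_borel_gradient[OF \<Omega> sol lam nonneg p q] unfolding v_def by blast
  define A where "A = {x. s < norm (x - y) \<and> norm (x - y) < R}"
  have A_open: "open A" unfolding A_def by (intro open_Collect_conj open_Collect_less continuous_intros)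
  have clA: "closure A \<subseteq> {x. s \<le> norm (x - y) \<and> norm (x - y) \<le> R}"
    by (rule closure_minimal) (auto simp: A_def intro!: closed_Collect_conj closed_Collect_le continuous_intros)
  have clA_ball: "closure A \<subseteq> cball y R" using clA by (auto simp: dist_norm norm_minus_commute)
  then have clA_\<Omega>: "closure A \<subseteq> \<Omega>" using R by blast
  have cptA: "compact (closure A)"
    using bounded_subset[OF bounded_cball clA_ball] by (simp add: compact_eq_bounded_closed)
  have A_\<Omega>: "A \<subseteq> \<Omega>" using clA_\<Omega> closure_subset by blast
  have vu: "v x = u x" if "x \<in> \<Omega>" for x using that by (simp add: v_def)
  have v0: "0 \<le> v x" for x using nonneg by (simp add: v_def)
  have frA: "norm (x - y) = s \<or> norm (x - y) = R" "x \<in> \<Omega>" if "x \<in> frontier A" for x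
  proof -
    have "x \<in> closure A" "x \<notin> A" using that A_open by (auto simp: frontier_def interior_open)
    then show "norm (x - y) = s \<or> norm (x - y) = R" "x \<in> \<Omega>" using clA clA_\<Omega> by (auto simp: A_def)
  qed
  define dV where "dV = (\<lambda>x. (\<sigma> * g (norm (x - y)) / norm (x - y)) *\<^sub>R (x - y))"
  have g_cont: "continuous_on {s<..<R} g"
    unfolding continuous_on_eq_continuous_at[OF open_greaterThanLessThan] using DERIV_isCont[OF g(2)] by auto
  have in_A: "norm (x - y) \<noteq> 0" "0 < g (norm (x - y))" if "x \<in> A" for x
    using that s g(1) by (auto simp: A_def)
  have dV_cont: "continuous_on A dV"
    unfolding dV_def by (intro continuous_intros continuous_on_compose2[OF g_cont]) (use in_A in \<open>auto simp: A_def\<close>)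
  have V_der: "GDERIV (\<lambda>x. h (norm (x - y))) x :> dV x" if x: "x \<in> A" for x
  proof -
    have 1: "GDERIV (\<lambda>x. norm (x - y)) x :> sgn (x - y)"
      by (rule GDERIV_norm_diff) (use in_A[OF x] in auto)
    have "(h has_real_derivative \<sigma> * g (norm (x - y))) (at (norm (x - y)))" using x by (intro h) (auto simp: A_def)
    from GDERIV_DERIV_compose[OF 1 this] show ?thesis
      by (rule GDERIV_subst) (simp add: dV_def sgn_div_norm divide_inverse)
  qed
  have V_cont: "continuous_on (closure A) (\<lambda>x. h (norm (x - y)))"
    by (intro continuous_on_compose2[OF h(1)] continuous_intros) (use clA in auto)
  define k where "k = (\<lambda>r. \<sigma> * g r powr (p - 1) / r)"
  define k' where "k' = (\<lambda>r. \<sigma> * ((p - 1) * g r powr (p - 2) * g' r / r - g r powr (p - 1) / r\<^sup>2))"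
  define D0 where "D0 = (\<lambda>r. g r powr (p - 2) * ((real DIM('a) - 1) * g r / r + (p - 1) * g' r))"
  have k_der: "(k has_real_derivative k' r) (at r)" if r: "s < r" "r < R" for r
  proof -
    have "((\<lambda>r. \<sigma> * g r powr (p - 1) / r) has_real_derivative
        (\<sigma> * (g' r * ((p - 1) * g r powr (p - 1 - 1))) * r - \<sigma> * g r powr (p - 1) * 1) / (r * r)) (at r)"
      using r s by (auto intro!: derivative_eq_intros g has_derivative_powr simp: g(1))
    moreover have "(\<sigma> * (g' r * ((p - 1) * g r powr (p - 1 - 1))) * r - \<sigma> * g r powr (p - 1) * 1) / (r * r) = k' r"
      using r s by (simp add: k'_def field_simps power2_eq_square)
    ultimately show ?thesis by (simp add: k_def)
  qed
  have k'_cont: "continuous_on {s<..<R} k'"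
    unfolding k'_def using s g(1) by (intro continuous_intros g_cont g(3)) (auto simp: less_imp_neq[symmetric])
  have D0_cont: "continuous_on {s<..<R} D0"
    unfolding D0_def using s g(1) by (intro continuous_intros g_cont g(3)) (auto simp: less_imp_neq[symmetric])
  have flux: "norm (dV x) powr (p - 2) *\<^sub>R dV x = k (norm (x - y)) *\<^sub>R (x - y)" if x: "x \<in> A" for x
  proof -
    have n: "norm (dV x) = g (norm (x - y))"
      using in_A[OF x] \<sigma> by (auto simp: dV_def abs_mult)
    have "g (norm (x - y)) powr (p - 2) * g (norm (x - y)) powr 1 = g (norm (x - y)) powr (p - 1)"
      by (subst powr_add[symmetric]) simp
    then have "g (norm (x - y)) powr (p - 2) * g (norm (x - y)) = g (norm (x - y)) powr (p - 1)"
      using in_A[OF x] by simp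
    then show ?thesis unfolding n by (simp add: dV_def k_def mult.left_commute)
  qed
  have div_eq: "real DIM('a) * k r + r * k' r = \<sigma> * D0 r" if r: "s < r" "r < R" for r
  proof -
    have "g r powr (p - 2) * g r powr 1 = g r powr (p - 1)"
      by (subst powr_add[symmetric]) simp
    then have e: "g r powr (p - 1) = g r powr (p - 2) * g r" using g(1)[OF r] by simp
    show ?thesis unfolding k_def k'_def D0_def e using r s
      by (simp add: field_simps power2_eq_square)
  qed
  define E where "E = (\<lambda>x. if \<sigma> = 1 then 0 else - (b * v x powr q))"
  define D where "D = (\<lambda>x. D0 (norm (x - y)))"
  have "bounded (v ` closure A)" by (intro compact_imp_bounded compact_continuous_image continuous_on_subset[OF v_cont] clA_\<Omega> cptA)
  then obtain Bv where Bv: "Bv > 0" "\<And>x. x \<in> closure A \<Longrightarrow> \<bar>v x\<bar> \<le> Bv" by (auto simp: bounded_pos)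
  have "\<sigma> * (v z - h (norm (z - y))) \<le> \<delta>"
  proof (rule weak_comparison[OF \<Omega> A_open cptA clA_\<Omega> v_cont v_meas H p Lp weak V_cont V_der dV_cont _ \<sigma>, where E=E and D=D and BE="\<bar>b\<bar> * Bv powr q"])
    show "dV x \<noteq> 0" if "x \<in> A" for x using in_A[OF that] \<sigma> by (auto simp: dV_def)
    show "\<sigma> * (LBINT x. (norm (H x) powr (p - 2) *\<^sub>R H x) \<bullet> grad \<phi> x) \<le> - (LBINT x. E x * \<phi> x)"
      if \<phi>: "\<phi> \<in> C01 A" "\<And>x. 0 \<le> \<phi> x" for \<phi>
    proof (cases "\<sigma> = 1")
      case True
      then show ?thesis using upper[OF C01_mono[OF \<phi>(1) A_\<Omega>] \<phi>(2)] by (simp add: E_def)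
    next
      case False
      then show ?thesis using \<sigma> lower[OF C01_mono[OF \<phi>(1) A_\<Omega>] \<phi>(2)] by (simp add: E_def)
    qed
    show "\<sigma> * (LBINT x. (norm (dV x) powr (p - 2) *\<^sub>R dV x) \<bullet> grad \<phi> x) = - (LBINT x. D x * \<phi> x)"
      if \<phi>: "\<phi> \<in> C01 A" for \<phi>
    proof -
      obtain K where K: "K \<subseteq> A" "\<And>x. x \<notin> K \<Longrightarrow> \<phi> x = 0" "\<And>x. x \<notin> K \<Longrightarrow> grad \<phi> x = 0"
        using C01_support[OF \<phi>] by metis
      have out: "\<phi> x = 0" "grad \<phi> x = 0" if "x \<notin> A" for x using that K by blast+
      have "(LBINT x. (norm (dV x) powr (p - 2) *\<^sub>R dV x) \<bullet> grad \<phi> x) = (LBINT x. (k (norm (x - y)) *\<^sub>R (x - y)) \<bullet> grad \<phi> x)"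
      proof (rule Bochner_Integration.integral_cong)
        show "(norm (dV x) powr (p - 2) *\<^sub>R dV x) \<bullet> grad \<phi> x = (k (norm (x - y)) *\<^sub>R (x - y)) \<bullet> grad \<phi> x" for x
          using flux[of x] out[of x] by (cases "x \<in> A") simp_all
      qed simp
      also have "\<dots> = - (LBINT x. \<phi> x * (real DIM('a) * k (norm (x - y)) + norm (x - y) * k' (norm (x - y))))"
        using \<phi> s by (intro radial_flux[OF _ k_der k'_cont]) (auto simp: A_def)
      also have "(LBINT x. \<phi> x * (real DIM('a) * k (norm (x - y)) + norm (x - y) * k' (norm (x - y)))) = (LBINT x. \<sigma> * (D x * \<phi> x))"
      proof (rule Bochner_Integration.integral_cong)
        show "\<phi> x * (real DIM('a) * k (norm (x - y)) + norm (x - y) * k' (norm (x - y))) = \<sigma> * (D x * \<phi> x)" for x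
        proof (cases "x \<in> A")
          case True
          then show ?thesis by (subst div_eq) (auto simp: A_def D_def)
        qed (simp add: out)
      qed simp
      finally show ?thesis using \<sigma> by auto
    qed
    show "E \<in> borel_measurable borel" unfolding E_def by measurable
    show "\<bar>E x\<bar> \<le> \<bar>b\<bar> * Bv powr q" if "x \<in> A" for x
    proof -
      have "v x powr q \<le> Bv powr q" using Bv(2)[of x] that closure_subset[of A] v0[of x] q by (intro powr_mono2) auto
      then show ?thesis by (auto simp: E_def abs_mult mult_left_mono)
    qed
    show "continuous_on A D" unfolding D_def
      by (intro continuous_on_compose2[OF D0_cont] continuous_intros) (auto simp: A_def)
    show "\<sigma> * (v x - h (norm (x - y))) < \<delta>" if "x \<in> frontier A" for x
      using bdry[OF frA[OF that]] vu[OF frA(2)[OF that]] by simp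
    show "D x < E x" if x: "x \<in> A" "\<delta> < \<sigma> * (v x - h (norm (x - y)))" for x
    proof -
      have x\<Omega>: "x \<in> \<Omega>" using x A_\<Omega> by blast
      show ?thesis unfolding D_def D0_def E_def vu[OF x\<Omega>]
        by (rule strict[OF x\<Omega> refl]) (use x vu[OF x\<Omega>] in \<open>auto simp: A_def\<close>)
    qed
    show "z \<in> A" using z by (simp add: A_def)
  qed
  moreover have "z \<in> \<Omega>" using z R by (auto simp: dist_norm norm_minus_commute)
  ultimately show ?thesis by (simp add: vu)
qed

text \<open>The derivative in the direction of the gradient is a limit of difference quotients bounded by \<open>m\<close>.\<close>

lemma norm_grad_le_if_cone_above:
  fixes f :: "'a::euclidean_space \<Rightarrow> real"
  assumes "0 < \<rho>" "0 \<le> m" and cone: "\<And>z. norm (z - x) < \<rho> \<Longrightarrow> f z \<le> f x + m * norm (z - x)"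
  shows "norm (grad f x) \<le> m"
proof (cases "f differentiable (at x) \<and> grad f x \<noteq> 0")
  case True
  then have D: "GDERIV f x :> grad f x" by (simp add: differentiable_imp_gderiv_grad)
  define e where "e = sgn (grad f x)"
  have e: "norm e = 1" using True by (simp add: e_def norm_sgn)
  have "((\<lambda>t. t *\<^sub>R e + x) has_derivative (\<lambda>h. h *\<^sub>R e)) (at 0)" by (auto intro!: derivative_eq_intros)
  moreover have "(f has_derivative (\<lambda>h. h \<bullet> grad f x)) (at (0 *\<^sub>R e + x))" using D by (simp add: gderiv_def)
  ultimately have "((\<lambda>t. f (t *\<^sub>R e + x)) has_derivative (\<lambda>h. (h *\<^sub>R e) \<bullet> grad f x)) (at 0)"
    by (rule has_derivative_compose)
  then have "((\<lambda>t. f (t *\<^sub>R e + x)) has_real_derivative e \<bullet> grad f x) (at 0)"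
    by (simp add: has_field_derivative_def mult.commute mult_commute_abs)
  then have "((\<lambda>t. (f (t *\<^sub>R e + x) - f x) / t) \<longlongrightarrow> e \<bullet> grad f x) (at 0)"
    by (simp add: DERIV_def)
  then have lim: "((\<lambda>t. (f (t *\<^sub>R e + x) - f x) / t) \<longlongrightarrow> e \<bullet> grad f x) (at_right 0)"
    by (rule filterlim_mono) (auto simp: at_le)
  have "e \<bullet> grad f x \<le> m"
  proof (rule tendsto_upperbound[OF lim])
    show "eventually (\<lambda>t. (f (t *\<^sub>R e + x) - f x) / t \<le> m) (at_right 0)"
      unfolding eventually_at_right_field
    proof (intro exI[of _ \<rho>] conjI allI impI)
      fix t assume t: "0 < t" "t < \<rho>"
      have "f (t *\<^sub>R e + x) \<le> f x + m * norm (t *\<^sub>R e)" using cone[of "t *\<^sub>R e + x"] t e by simp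
      then show "(f (t *\<^sub>R e + x) - f x) / t \<le> m" using t e by (simp add: divide_le_eq)
    qed (use assms in simp)
  qed simp
  moreover have "e \<bullet> grad f x = norm (grad f x)"
    using True by (simp add: e_def sgn_div_norm power2_norm_eq_inner[symmetric] power2_eq_square)
  ultimately show ?thesis by simp
next
  case False
  then show ?thesis using assms(2) by (auto simp: grad_def)
qed

section \<open>Growth away from the free boundary\<close>

lemma powr_le_powr_abs:
  fixes z M a :: real
  assumes "0 < z" "z \<le> M" "1 / z \<le> M"
  shows "z powr a \<le> M powr \<bar>a\<bar>"
proof (cases "0 \<le> a")
  case True
  then show ?thesis using assms by (simp add: powr_mono2)
next
  case False
  have "z powr a = (1 / z) powr (- a)"
    using assms by (simp add: powr_minus_divide powr_divide)
  also have "\<dots> \<le> M powr (- a)" using False assms by (intro powr_mono2) auto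
  finally show ?thesis using False by simp
qed

text \<open>Since \<open>Q\<^sub>j = l P\<^sub>j + o(P\<^sub>j)\<close>, replacing the exponent \<open>Q\<^sub>j\<close> by \<open>l (P\<^sub>j - 2)\<close> costs a factor that is
subexponential in \<open>P\<^sub>j\<close>, and any base \<open>\<kappa> > 1\<close> absorbs it.\<close>

lemma eventually_powr_gap:
  fixes P Q :: "nat \<Rightarrow> real"
  assumes \<kappa>: "1 < \<kappa>" and M: "1 \<le> M" and P: "filterlim P at_top sequentially"
    and Q: "(\<lambda>j. Q j / P j) \<longlonglongrightarrow> l"
  shows "eventually (\<lambda>j. M powr \<bar>Q j - l * (P j - 2)\<bar> \<le> \<kappa> powr (P j - 2)) sequentially"
proof -
  define L where "L = ln M"
  define k where "k = ln \<kappa>"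
  have L: "0 \<le> L" and k: "0 < k" using \<kappa> M by (auto simp: L_def k_def)
  define e where "e = k / (4 * (L + 1))"
  have e: "0 < e" "e * L \<le> k / 4" using L k by (auto simp: e_def field_simps)
  have "eventually (\<lambda>j. dist (Q j / P j) l < e) sequentially" using tendstoD[OF Q e(1)] .
  moreover have "eventually (\<lambda>j. max 4 (8 * \<bar>l\<bar> * L / k) < P j) sequentially"
    using P unfolding filterlim_at_top_dense by blast
  ultimately show ?thesis
  proof eventually_elim
    case (elim j)
    then have P4: "4 < P j" and Pl: "8 * \<bar>l\<bar> * L \<le> k * P j" using k by (auto simp: field_simps)
    have "Q j - l * P j = (Q j / P j - l) * P j" using P4 by (simp add: field_simps)
    then have "\<bar>Q j - l * P j\<bar> = \<bar>Q j / P j - l\<bar> * P j" using P4 by (simp add: abs_mult)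
    also have "\<dots> \<le> e * P j" using elim P4 by (intro mult_right_mono) (auto simp: dist_real_def)
    finally have "\<bar>Q j - l * P j\<bar> \<le> e * P j" .
    moreover have "Q j - l * (P j - 2) = (Q j - l * P j) + 2 * l" by (simp add: algebra_simps)
    ultimately have "\<bar>Q j - l * (P j - 2)\<bar> \<le> e * P j + 2 * \<bar>l\<bar>" by (simp add: abs_le_iff) linarith
    then have "\<bar>Q j - l * (P j - 2)\<bar> * L \<le> (e * P j + 2 * \<bar>l\<bar>) * L" using L by (rule mult_right_mono)
    also have "\<dots> = (e * L) * P j + 2 * \<bar>l\<bar> * L" by (simp add: algebra_simps)
    also have "\<dots> \<le> (k / 4) * P j + (k * P j) / 4"
      using mult_right_mono[OF e(2), of "P j"] P4 Pl by linarith
    also have "\<dots> = k * (P j / 2)" by simp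
    also have "\<dots> \<le> k * (P j - 2)" using k P4 by (intro mult_left_mono) auto
    finally have "\<bar>Q j - l * (P j - 2)\<bar> * L \<le> (P j - 2) * k" by (simp add: mult.commute)
    then show ?case using \<kappa> M by (simp add: powr_def L_def k_def)
  qed
qed

lemma uniform_limit_eventually_close:
  fixes w :: "nat \<Rightarrow> 'a \<Rightarrow> real"
  assumes "uniform_limit S w f sequentially" "0 < e"
  shows "eventually (\<lambda>j. \<forall>x\<in>S. \<bar>w j x - f x\<bar> < e) sequentially"
  using uniform_limitD[OF assms] by (simp add: dist_real_def)

lemma obtain_at_right:
  fixes a :: real
  assumes "eventually Z (at_right a)"
  obtains x where "a < x" "Z x"
proof -
  have "\<exists>x. Z x \<and> a < x"
    using eventually_conj[OF assms eventually_at_right_less] by (rule eventually_happens'[OF trivial_limit_at_right_real])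
  then show ?thesis using that by blast
qed

lemma continuous_obtain_radius:
  fixes f :: "'a::euclidean_space \<Rightarrow> real"
  assumes "open \<Omega>" "continuous_on \<Omega> f" "y \<in> \<Omega>" "0 < \<epsilon>" "0 < d"
  obtains s where "0 < s" "s < d" "\<And>x. norm (x - y) \<le> s \<Longrightarrow> \<bar>f x - f y\<bar> < \<epsilon>"
proof -
  have "isCont f y" using assms by (simp add: continuous_on_eq_continuous_at)
  then obtain s' where s': "0 < s'" "\<And>x. dist x y < s' \<Longrightarrow> dist (f x) (f y) < \<epsilon>"
    using \<open>0 < \<epsilon>\<close> unfolding continuous_at_eps_delta by blast
  define s where "s = min s' d / 2"
  have "0 < s" "s < d" "s < s'" using s'(1) \<open>0 < d\<close> by (auto simp: s_def min_def)
  with s'(2) show ?thesis by (intro that[of s]) (auto simp: dist_norm)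
qed

text \<open>The function \<open>V(x) = ((1 - l) (R - |x - y|))\<close> to the power \<open>1 / (1 - l)\<close> solves \<open>|\<nabla>V| = V\<^sup>l\<close>. Barriers
\<open>h\<close> slightly steeper than \<open>V\<close> satisfy \<open>|\<nabla>h| \<ge> \<kappa> h\<^sup>l\<close> with some \<open>\<kappa> > 1\<close>, so that \<open>|\<nabla>h|\<^sup>p\<^sup>-\<^sup>2\<close>
dominates the absorption term for large \<open>p\<close> and they become strict subsolutions. Hence, if \<open>f y\<close> exceeded the height of such a barrier
whose support reaches beyond \<open>x0\<close>, the solutions would lie above the barrier, and \<open>f x0\<close> would be
positive.\<close>

lemma dead_core_growth:
  fixes \<Omega> :: "'a::euclidean_space set" and w :: "nat \<Rightarrow> 'a \<Rightarrow> real" and f lam :: "'a \<Rightarrow> real"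
  assumes \<Omega>: "open \<Omega>" and sol: "\<And>j. weak_solution (P j) (Q j) lam bd \<Omega> (w j)"
    and lam: "lam \<in> borel_measurable (lebesgue_on \<Omega>)" "\<And>x. x \<in> \<Omega> \<Longrightarrow> 0 \<le> lam x" "\<And>x. x \<in> \<Omega> \<Longrightarrow> lam x \<le> b"
    and nonneg: "\<And>j x. x \<in> \<Omega> \<Longrightarrow> 0 \<le> w j x"
    and P2: "\<And>j. 2 \<le> P j" and Plim: "filterlim P at_top sequentially"
    and Q0: "\<And>j. 0 \<le> Q j" and Qlim: "(\<lambda>j. Q j / P j) \<longlonglongrightarrow> l" and l: "0 \<le> l" "l < 1"
    and unif: "uniform_limit \<Omega> w f sequentially" and f_cont: "continuous_on \<Omega> f"
    and ball: "cball y R0 \<subseteq> \<Omega>" and x0: "norm (x0 - y) < R0" "f x0 = 0"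
  shows "f y \<le> ((1 - l) * norm (x0 - y)) powr (1 / (1 - l))"
proof (rule ccontr)
  define N where "N = real DIM('a)"
  have N1: "0 \<le> N - 1" using DIM_positive[where 'a='a] unfolding N_def by linarith
  define \<gamma>0 where "\<gamma>0 = 1 / (1 - l)"
  have \<gamma>0: "1 \<le> \<gamma>0" "\<gamma>0 * (1 - l) = 1" using l by (auto simp: \<gamma>0_def)
  define d where "d = norm (x0 - y)"
  assume "\<not> f y \<le> ((1 - l) * norm (x0 - y)) powr (1 / (1 - l))"
  then have big: "((1 - l) * d) powr \<gamma>0 < f y" by (simp add: d_def \<gamma>0_def)
  have R0: "0 < R0" using x0(1) norm_ge_zero[of "x0 - y"] by linarith
  have y\<Omega>: "y \<in> \<Omega>" using ball R0 by auto
  have x0\<Omega>: "x0 \<in> \<Omega>" using ball x0(1) by (auto simp: dist_norm norm_minus_commute)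
  have b0: "0 \<le> b" using lam(2,3)[OF y\<Omega>] by linarith
  have d: "0 < d" 
  proof (rule ccontr)
    assume "\<not> 0 < d"
    then have "x0 = y" by (simp add: d_def)
    then have "f y = 0" using x0(2) by simp
    then show False using big powr_ge_zero[of "(1 - l) * d" \<gamma>0] by linarith
  qed
  define C0 where "C0 = (1 - l) powr \<gamma>0"
  have C0: "0 < C0" using l by (simp add: C0_def)
  have "C0 * d powr \<gamma>0 < f y" using big l d by (simp add: C0_def powr_mult)
  define F where "F = f y / d powr \<gamma>0"
  have C0': "C0 < F" using \<open>C0 * d powr \<gamma>0 < f y\<close> d by (simp add: F_def pos_less_divide_eq)
  define c where "c = (C0 + F) / 2"
  have c: "C0 < c" using C0' by (simp add: c_def)
  have c_less: "c < F" using C0' by (simp add: c_def)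
  have c0: "0 < c" using C0 c by linarith
  have cd: "c * d powr \<gamma>0 < f y" using c_less d by (simp add: F_def pos_less_divide_eq)
  obtain R where R: "d < R" "R < R0" "c * R powr \<gamma>0 < f y"
  proof -
    have "((\<lambda>R. c * R powr \<gamma>0) \<longlongrightarrow> c * d powr \<gamma>0) (at_right d)"
      using d by (intro tendsto_intros) auto
    then have "eventually (\<lambda>R. c * R powr \<gamma>0 < f y) (at_right d)" using cd by (rule order_tendstoD(2))
    moreover have "eventually (\<lambda>R. R < R0) (at_right d)"
      using x0(1) by (auto simp: eventually_at_right_field d_def)
    ultimately have "eventually (\<lambda>R. R < R0 \<and> c * R powr \<gamma>0 < f y) (at_right d)"
      by eventually_elim auto
    then show ?thesis by (rule obtain_at_right) (elim conjE, rule that)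
  qed
  have Rpos: "0 < R" using d R by linarith
  define t0 where "t0 = (R - d) / 2"
  have t0: "0 < t0" using R by (simp add: t0_def)
  define T where "T = min 1 t0"
  have T: "0 < T" "T \<le> t0" using t0 by (auto simp: T_def)
  \<comment> \<open>For \<open>\<gamma> = \<gamma>0\<close> the barrier \<open>c (R - r)\<^sup>\<gamma>\<close> satisfies \<open>|\<nabla>h| = \<mu> h\<^sup>l\<close>.\<close>
  define \<mu> where "\<mu> = c powr (1 - l) * \<gamma>0"
  have \<mu>: "1 < \<mu>"
  proof -
    have "C0 powr (1 - l) = 1 - l" unfolding C0_def using l \<gamma>0 by (simp add: powr_powr)
    moreover have "C0 powr (1 - l) < c powr (1 - l)" using c C0 l by (intro powr_less_mono2) auto
    ultimately have "(1 - l) * \<gamma>0 < c powr (1 - l) * \<gamma>0" using \<gamma>0(1) by (intro mult_strict_right_mono) auto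
    then show ?thesis using \<gamma>0(2) by (simp add: \<mu>_def mult.commute)
  qed
  define \<kappa> where "\<kappa> = (1 + \<mu>) / 2"
  have \<kappa>: "1 < \<kappa>" "\<kappa> < \<mu>" using \<mu> by (auto simp: \<kappa>_def)
  \<comment> \<open>A slightly larger exponent makes the profile strictly convex also for \<open>l = 0\<close>, where \<open>\<gamma>0 = 1\<close>.\<close>
  obtain \<gamma> where \<gamma>: "\<gamma>0 < \<gamma>" "c * R powr \<gamma> < f y" "\<kappa> < c powr (1 - l) * \<gamma> * T powr (\<gamma> * (1 - l) - 1)"
  proof -
    have "((\<lambda>\<gamma>. c * R powr \<gamma>) \<longlongrightarrow> c * R powr \<gamma>0) (at_right \<gamma>0)"
      using Rpos by (intro tendsto_intros) auto
    then have "eventually (\<lambda>\<gamma>. c * R powr \<gamma> < f y) (at_right \<gamma>0)" using R(3) by (rule order_tendstoD(2))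
    moreover have "((\<lambda>\<gamma>. c powr (1 - l) * \<gamma> * T powr (\<gamma> * (1 - l) - 1)) \<longlongrightarrow> c powr (1 - l) * \<gamma>0 * T powr (\<gamma>0 * (1 - l) - 1)) (at_right \<gamma>0)"
      using T by (intro tendsto_intros) auto
    then have "((\<lambda>\<gamma>. c powr (1 - l) * \<gamma> * T powr (\<gamma> * (1 - l) - 1)) \<longlongrightarrow> \<mu>) (at_right \<gamma>0)"
      using \<gamma>0(2) T by (simp add: \<mu>_def)
    then have "eventually (\<lambda>\<gamma>. \<kappa> < c powr (1 - l) * \<gamma> * T powr (\<gamma> * (1 - l) - 1)) (at_right \<gamma>0)"
      using \<kappa>(2) by (rule order_tendstoD(1))
    ultimately have "eventually (\<lambda>\<gamma>. c * R powr \<gamma> < f y \<and> \<kappa> < c powr (1 - l) * \<gamma> * T powr (\<gamma> * (1 - l) - 1)) (at_right \<gamma>0)"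
      by eventually_elim auto
    then show ?thesis by (rule obtain_at_right) (elim conjE, rule that)
  qed
  have \<gamma>1: "1 < \<gamma>" using \<gamma> \<gamma>0 by linarith
  have "\<gamma>0 * (1 - l) < \<gamma> * (1 - l)" using \<gamma>(1) l by (intro mult_strict_right_mono) auto
  then have expo: "0 < \<gamma> * (1 - l) - 1" using \<gamma>0(2) by simp
  define h where "h = (\<lambda>r. c * (R - r) powr \<gamma>)"
  define g where "g = (\<lambda>r. c * \<gamma> * (R - r) powr (\<gamma> - 1))"
  define g' where "g' = (\<lambda>r. - (c * \<gamma> * (\<gamma> - 1) * (R - r) powr (\<gamma> - 2)))"
  \<comment> \<open>Lowering the barrier by \<open>\<delta>\<close> restricts the comparison to \<open>R - r > t0\<close>, where \<open>h\<close> is bounded away from \<open>0\<close>.\<close>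
  define \<delta> where "\<delta> = c * t0 powr \<gamma>"
  have \<delta>: "0 < \<delta>" using c0 t0 by (simp add: \<delta>_def)
  define \<epsilon> where "\<epsilon> = (f y - c * R powr \<gamma>) / 2"
  have \<epsilon>: "0 < \<epsilon>" using \<gamma>(2) by (simp add: \<epsilon>_def)
  have fy: "f y = c * R powr \<gamma> + 2 * \<epsilon>" by (simp add: \<epsilon>_def field_simps)
  obtain s where s: "0 < s" "s < d" and near: "\<And>x. norm (x - y) \<le> s \<Longrightarrow> \<bar>f x - f y\<bar> < \<epsilon>"
    using continuous_obtain_radius[OF \<Omega> f_cont y\<Omega> \<epsilon> d] by blast
  define K1 where "K1 = c * \<gamma> * (t0 powr \<gamma> / R\<^sup>2)"
  have K1: "0 < K1" unfolding K1_def using c0 \<gamma>1 t0 Rpos by (intro mult_pos_pos divide_pos_pos) auto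
  define Y where "Y = (\<lambda>p. (p - 1) * (\<gamma> - 1) - (N - 1) * (R / s))"
  define M where "M = max 1 (max (c * R powr \<gamma>) (1 / \<delta>))"
  define \<epsilon>2 where "\<epsilon>2 = h d - \<delta>"
  have \<epsilon>2: "0 < \<epsilon>2"
  proof -
    have "t0 powr \<gamma> < (R - d) powr \<gamma>" using t0 \<gamma>1 by (intro powr_less_mono2) (auto simp: t0_def)
    then show ?thesis using c0 by (simp add: \<epsilon>2_def h_def \<delta>_def)
  qed
  have ev1: "eventually (\<lambda>j. b < K1 * Y (P j)) sequentially"
  proof -
    have "eventually (\<lambda>j. 1 + (b / K1 + (N - 1) * (R / s)) / (\<gamma> - 1) < P j) sequentially"
      using Plim unfolding filterlim_at_top_dense by blast
    then show ?thesis
    proof eventually_elim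
      case (elim j)
      then have "(b / K1 + (N - 1) * (R / s)) / (\<gamma> - 1) < P j - 1" by linarith
      then have "b / K1 + (N - 1) * (R / s) < (P j - 1) * (\<gamma> - 1)" using \<gamma>1 by (simp add: pos_divide_less_eq)
      then have "b / K1 < Y (P j)" by (simp add: Y_def)
      then show ?case using K1 by (simp add: pos_divide_less_eq mult.commute)
    qed
  qed
  have ev2: "eventually (\<lambda>j. M powr \<bar>Q j - l * (P j - 2)\<bar> \<le> \<kappa> powr (P j - 2)) sequentially"
    by (rule eventually_powr_gap[OF \<kappa>(1) _ Plim Qlim]) (simp add: M_def)
  have ev3: "eventually (\<lambda>j. \<forall>x\<in>\<Omega>. \<bar>w j x - f x\<bar> < min \<epsilon> \<epsilon>2) sequentially"
    using \<epsilon> \<epsilon>2 by (intro uniform_limit_eventually_close[OF unif]) auto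
  obtain j where j1: "b < K1 * Y (P j)" and j2: "M powr \<bar>Q j - l * (P j - 2)\<bar> \<le> \<kappa> powr (P j - 2)"
    and j3: "\<And>x. x \<in> \<Omega> \<Longrightarrow> \<bar>w j x - f x\<bar> < \<epsilon>" "\<And>x. x \<in> \<Omega> \<Longrightarrow> \<bar>w j x - f x\<bar> < \<epsilon>2"
    using eventually_happens[OF eventually_conj[OF ev1 eventually_conj[OF ev2 ev3]]] by auto
  have "(-1) * (w j x0 - h (norm (x0 - y))) \<le> \<delta>"
  proof (rule radial_comparison[OF \<Omega> sol lam nonneg P2 Q0 s(1), where g=g and g'=g' and R=R])
    show "cball y R \<subseteq> \<Omega>" using ball R by (meson less_imp_le order_trans subset_cball)
    show "continuous_on {s..R} h" unfolding h_def using \<gamma>1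
      by (intro continuous_on_mult continuous_on_const continuous_on_powr' continuous_on_diff continuous_on_id) auto
    show "(h has_real_derivative - 1 * g r) (at r)" if "s < r" "r < R" for r
      unfolding h_def g_def using that by (auto intro!: derivative_eq_intros)
    show "0 < g r" if "s < r" "r < R" for r using that c0 \<gamma>1 by (simp add: g_def)
    show "(g has_real_derivative g' r) (at r)" if "s < r" "r < R" for r
      unfolding g'_def g_def using that by (auto intro!: derivative_eq_intros)
    show "continuous_on {s<..<R} g'" unfolding g'_def by (intro continuous_intros) auto
    show "- 1 * (w j x - h (norm (x - y))) < \<delta>" if x: "norm (x - y) = s \<or> norm (x - y) = R" "x \<in> \<Omega>" for x
      using x(1)
    proof
      assume xs: "norm (x - y) = s"
      have "h s \<le> c * R powr \<gamma>" unfolding h_def using s d R c0 \<gamma>1 by (intro mult_left_mono powr_mono2) auto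
      moreover have "c * R powr \<gamma> < w j x" using near[of x] fy j3(1)[OF x(2)] xs by linarith
      ultimately show ?thesis using xs \<delta> by simp
    next
      assume "norm (x - y) = R"
      then show ?thesis using nonneg[OF x(2), of j] \<delta> by (simp add: h_def)
    qed
    fix x r assume x: "x \<in> \<Omega>" and r: "r = norm (x - y)" "s < r" "r < R" and gap: "\<delta> < - 1 * (w j x - h r)"
    define t where "t = R - r"
    define p q where "p = P j" and "q = Q j"
    have wx: "0 \<le> w j x" by (rule nonneg[OF x])
    have t: "0 < t" "t < R" "t \<le> R" using r s by (auto simp: t_def)
    define z where "z = c * t powr \<gamma>"
    have hz: "h r = z" by (simp add: h_def z_def t_def)
    have z\<delta>: "\<delta> < z" using gap wx hz by simp
    have tt0: "t0 < t"
    proof (rule ccontr)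
      assume "\<not> t0 < t"
      then have "t powr \<gamma> \<le> t0 powr \<gamma>" using t \<gamma>1 by (intro powr_mono2) auto
      then show False using z\<delta> c0 by (simp add: z_def \<delta>_def)
    qed
    have z0: "0 < z" using z\<delta> \<delta> by linarith
    have g_split: "g r = z powr l * (c powr (1 - l) * \<gamma> * t powr (\<gamma> * (1 - l) - 1))"
    proof -
      have "c powr l * c powr (1 - l) = c" using c0 by (simp add: powr_add[symmetric])
      moreover have "t powr (\<gamma> * l) * t powr (\<gamma> * (1 - l) - 1) = t powr (\<gamma> - 1)"
        by (simp add: powr_add[symmetric] algebra_simps)
      moreover have "z powr l = c powr l * t powr (\<gamma> * l)" using c0 by (simp add: z_def powr_mult powr_powr)
      ultimately show ?thesis
        by (metis (no_types, lifting) g_def mult.assoc mult.left_commute t_def)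
    qed
    have "T powr (\<gamma> * (1 - l) - 1) \<le> t powr (\<gamma> * (1 - l) - 1)" using T tt0 expo by (intro powr_mono2) auto
    then have "c powr (1 - l) * \<gamma> * T powr (\<gamma> * (1 - l) - 1) \<le> c powr (1 - l) * \<gamma> * t powr (\<gamma> * (1 - l) - 1)"
      using c0 \<gamma>1 by (intro mult_left_mono) auto
    then have "\<kappa> \<le> c powr (1 - l) * \<gamma> * t powr (\<gamma> * (1 - l) - 1)" using \<gamma>(3) by linarith
    then have g_ge: "z powr l * \<kappa> \<le> g r" unfolding g_split by (intro mult_left_mono) auto
    have p2: "0 \<le> p - 2" using P2[of j] by (simp add: p_def)
    have gpow: "z powr (l * (p - 2)) * \<kappa> powr (p - 2) \<le> g r powr (p - 2)"
    proof -
      have "(z powr l * \<kappa>) powr (p - 2) \<le> g r powr (p - 2)" using g_ge \<kappa> p2 by (intro powr_mono2) auto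
      then show ?thesis using \<kappa> by (simp add: powr_mult powr_powr)
    qed
    have "z \<le> c * R powr \<gamma>" unfolding z_def using t c0 \<gamma>1 by (intro mult_left_mono powr_mono2) auto
    moreover have "1 / z \<le> 1 / \<delta>" using z\<delta> \<delta> by (intro divide_left_mono) auto
    ultimately have zM: "z \<le> M" "1 / z \<le> M" by (auto simp: M_def le_max_iff_disj)
    have "w j x powr q \<le> z powr q" using wx gap hz \<delta> Q0[of j] by (intro powr_mono2) (auto simp: q_def)
    also have "\<dots> = z powr (l * (p - 2)) * z powr (q - l * (p - 2))" by (simp add: powr_add[symmetric])
    also have "\<dots> \<le> z powr (l * (p - 2)) * M powr \<bar>q - l * (p - 2)\<bar>"
      by (intro mult_left_mono powr_le_powr_abs z0 zM) auto
    also have "\<dots> \<le> z powr (l * (p - 2)) * \<kappa> powr (p - 2)"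
      using j2 by (intro mult_left_mono) (auto simp: p_def q_def)
    finally have wq: "w j x powr q \<le> g r powr (p - 2)" using gpow by linarith
    have gpos: "0 < g r" using t c0 \<gamma>1 by (simp add: g_def t_def)
    have diff: "(N - 1) * g r / r + (p - 1) * g' r = - (c * \<gamma> * t powr (\<gamma> - 2) * ((p - 1) * (\<gamma> - 1) - (N - 1) * (t / r)))"
    proof -
      have "t powr (\<gamma> - 2) * t powr 1 = t powr (\<gamma> - 1)" by (subst powr_add[symmetric]) simp
      then have "t powr (\<gamma> - 1) = t powr (\<gamma> - 2) * t" using t by simp
      then have "g r = c * \<gamma> * t powr (\<gamma> - 2) * t" by (simp add: g_def t_def[symmetric])
      then show ?thesis by (simp add: g'_def t_def[symmetric] algebra_simps)
    qed
    have "K1 * Y p \<le> (c * \<gamma> * t powr (\<gamma> - 2)) * ((p - 1) * (\<gamma> - 1) - (N - 1) * (t / r))"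
    proof (rule mult_mono)
      have "t powr (\<gamma> - 2) = t powr \<gamma> / t\<^sup>2" using t by (simp add: powr_diff)
      moreover have "t0 powr \<gamma> / R\<^sup>2 \<le> t powr \<gamma> / t\<^sup>2"
        using t t0 tt0 \<gamma>1 by (intro frac_le powr_mono2 power_mono) auto
      ultimately show "K1 \<le> c * \<gamma> * t powr (\<gamma> - 2)" unfolding K1_def using c0 \<gamma>1 by (intro mult_left_mono) auto
      have "t / r \<le> R / s" using t r s by (intro frac_le) auto
      from mult_left_mono[OF this N1] show "Y p \<le> (p - 1) * (\<gamma> - 1) - (N - 1) * (t / r)" by (simp add: Y_def)
      show "0 \<le> c * \<gamma> * t powr (\<gamma> - 2)" using c0 \<gamma>1 by simp
      have "0 < K1 * Y p" using j1 b0 by (simp add: p_def)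
      then show "0 \<le> Y p" using K1 by (simp add: zero_less_mult_iff)
    qed
    then have "b < c * \<gamma> * t powr (\<gamma> - 2) * ((p - 1) * (\<gamma> - 1) - (N - 1) * (t / r))" using j1 by (simp add: p_def)
    then have "g r powr (p - 2) * b < g r powr (p - 2) * (c * \<gamma> * t powr (\<gamma> - 2) * ((p - 1) * (\<gamma> - 1) - (N - 1) * (t / r)))"
      using gpos by (intro mult_strict_left_mono) auto
    moreover have "b * w j x powr q \<le> g r powr (p - 2) * b" using wq b0 by (simp add: mult.commute mult_left_mono)
    ultimately have "b * w j x powr q < - (g r powr (p - 2) * ((N - 1) * g r / r + (p - 1) * g' r))"
      unfolding diff by simp
    then show "g r powr (P j - 2) * ((real DIM('a) - 1) * g r / r + (P j - 1) * g' r) < (if (- 1::real) = 1 then 0 else - (b * w j x powr Q j))"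
      by (simp add: p_def q_def N_def)
  qed (use s R d in \<open>auto simp: d_def\<close>)
  then have "\<epsilon>2 \<le> w j x0" by (simp add: \<epsilon>2_def d_def)
  then show False using j3(2)[OF x0\<Omega>] x0(2) by simp
qed

section \<open>Comparison with cones from above\<close>

text \<open>The limit of \<open>p\<close>-subharmonic functions is infinity-subharmonic, and this is the property that such
functions enjoy. The cone is approximated by \<open>c r\<^sup>1\<^sup>-\<^sup>\<beta>\<close> with a small \<open>\<beta> > 0\<close>, which is strictly concave
in \<open>r\<close> and hence strictly \<open>p\<close>-superharmonic off the vertex as soon as \<open>(p - 1) \<beta> > N - 1\<close>.\<close>

lemma cone_comparison:
  fixes \<Omega> :: "'a::euclidean_space set" and w :: "nat \<Rightarrow> 'a \<Rightarrow> real" and f lam :: "'a \<Rightarrow> real"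
  assumes \<Omega>: "open \<Omega>" and sol: "\<And>j. weak_solution (P j) (Q j) lam bd \<Omega> (w j)"
    and lam: "lam \<in> borel_measurable (lebesgue_on \<Omega>)" "\<And>x. x \<in> \<Omega> \<Longrightarrow> 0 \<le> lam x" "\<And>x. x \<in> \<Omega> \<Longrightarrow> lam x \<le> b"
    and nonneg: "\<And>j x. x \<in> \<Omega> \<Longrightarrow> 0 \<le> w j x"
    and P2: "\<And>j. 2 \<le> P j" and Plim: "filterlim P at_top sequentially"
    and Q0: "\<And>j. 0 \<le> Q j"
    and unif: "uniform_limit \<Omega> w f sequentially" and f_cont: "continuous_on \<Omega> f"
    and ball: "cball x \<rho> \<subseteq> \<Omega>" and m: "0 < m"
    and bdry: "\<And>z. norm (z - x) = \<rho> \<Longrightarrow> f z \<le> f x + m * \<rho>"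
    and z: "norm (z - x) < \<rho>"
  shows "f z \<le> f x + m * norm (z - x)"
proof (rule ccontr)
  define N where "N = real DIM('a)"
  define d where "d = norm (z - x)"
  assume "\<not> f z \<le> f x + m * norm (z - x)"
  then have big: "f x + m * d < f z" by (simp add: d_def)
  have \<rho>: "0 < \<rho>" using z norm_ge_zero[of "z - x"] by linarith
  have x\<Omega>: "x \<in> \<Omega>" using ball \<rho> by auto
  have z\<Omega>: "z \<in> \<Omega>" using ball z by (auto simp: dist_norm norm_minus_commute)
  have d: "0 < d" using big by (cases "z = x") (auto simp: d_def)
  \<comment> \<open>The gap is shared by the lift of the barrier (3), the choice of \<open>\<beta>\<close> (1) and the uniform error at \<open>z\<close> (1).\<close>
  define \<epsilon> where "\<epsilon> = (f z - f x - m * d) / 6"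
  have \<epsilon>: "0 < \<epsilon>" "f z = f x + m * d + 6 * \<epsilon>" using big by (simp_all add: \<epsilon>_def field_simps)
  obtain \<beta> where \<beta>: "0 < \<beta>" "\<beta> < 1" "m * d * (\<rho> / d) powr \<beta> < m * d + \<epsilon>"
  proof -
    have "((\<lambda>\<beta>. m * d * (\<rho> / d) powr \<beta>) \<longlongrightarrow> m * d * (\<rho> / d) powr 0) (at_right 0)"
      using \<rho> d by (intro tendsto_intros) auto
    then have "((\<lambda>\<beta>. m * d * (\<rho> / d) powr \<beta>) \<longlongrightarrow> m * d) (at_right 0)" using \<rho> d by simp
    then have "eventually (\<lambda>\<beta>. m * d * (\<rho> / d) powr \<beta> < m * d + \<epsilon>) (at_right 0)"
      using \<epsilon>(1) by (intro order_tendstoD(2)) auto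
    moreover have "eventually (\<lambda>\<beta>. \<beta> < 1) (at_right (0::real))"
      by (auto simp: eventually_at_right_field intro: exI[of _ 1])
    ultimately have "eventually (\<lambda>\<beta>. \<beta> < 1 \<and> m * d * (\<rho> / d) powr \<beta> < m * d + \<epsilon>) (at_right 0)"
      by eventually_elim auto
    then show ?thesis by (rule obtain_at_right) (elim conjE, rule that)
  qed
  \<comment> \<open>This makes the barrier and the cone agree at radius \<open>\<rho>\<close>, up to the additive constant.\<close>
  define c where "c = m * \<rho> powr \<beta>"
  have c: "0 < c" using m \<rho> by (simp add: c_def)
  define h where "h = (\<lambda>r. f x + 3 * \<epsilon> + c * r powr (1 - \<beta>))"
  define g where "g = (\<lambda>r. c * (1 - \<beta>) * r powr (- \<beta>))"
  define g' where "g' = (\<lambda>r. - (c * (1 - \<beta>) * \<beta> * r powr (- \<beta> - 1)))"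
  obtain s where s: "0 < s" "s < d" and near: "\<And>y. norm (y - x) \<le> s \<Longrightarrow> \<bar>f y - f x\<bar> < \<epsilon>"
    using continuous_obtain_radius[OF \<Omega> f_cont x\<Omega> \<epsilon>(1) d] by blast
  have ev1: "eventually (\<lambda>j. 1 + (N - 1) / \<beta> < P j) sequentially"
    using Plim unfolding filterlim_at_top_dense by blast
  have ev2: "eventually (\<lambda>j. \<forall>x\<in>\<Omega>. \<bar>w j x - f x\<bar> < \<epsilon>) sequentially"
    using \<epsilon>(1) by (rule uniform_limit_eventually_close[OF unif])
  obtain j where j1: "1 + (N - 1) / \<beta> < P j" and j2: "\<And>x. x \<in> \<Omega> \<Longrightarrow> \<bar>w j x - f x\<bar> < \<epsilon>"
    using eventually_happens[OF eventually_conj[OF ev1 ev2]] by auto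
  have "1 * (w j z - h (norm (z - x))) \<le> 0"
  proof (rule radial_comparison[OF \<Omega> sol lam nonneg P2 Q0 s(1) ball, where g=g and g'=g'])
    show "continuous_on {s..\<rho>} h" unfolding h_def using s by (intro continuous_intros) auto
    show "(h has_real_derivative 1 * g r) (at r)" if "s < r" "r < \<rho>" for r
      unfolding h_def g_def using that s by (auto intro!: derivative_eq_intros)
    show "0 < g r" if "s < r" "r < \<rho>" for r using that c \<beta> s by (simp add: g_def)
    show "(g has_real_derivative g' r) (at r)" if "s < r" "r < \<rho>" for r
      unfolding g'_def g_def using that s by (auto intro!: derivative_eq_intros)
    show "continuous_on {s<..<\<rho>} g'" unfolding g'_def using s by (intro continuous_intros) auto
    show "1 * (w j y - h (norm (y - x))) < 0" if y: "norm (y - x) = s \<or> norm (y - x) = \<rho>" "y \<in> \<Omega>" for y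
      using y(1)
    proof
      assume ys: "norm (y - x) = s"
      have "0 \<le> c * s powr (1 - \<beta>)" using c by simp
      then have "f x + 3 * \<epsilon> \<le> h s" by (simp add: h_def)
      moreover have "w j y < f x + 2 * \<epsilon>" using near[of y] j2[OF y(2)] ys by linarith
      ultimately show ?thesis using ys \<epsilon>(1) by simp
    next
      assume y\<rho>: "norm (y - x) = \<rho>"
      have "\<rho> powr \<beta> * \<rho> powr (1 - \<beta>) = \<rho>" using \<rho> by (simp add: powr_add[symmetric])
      then have "h \<rho> = f x + 3 * \<epsilon> + m * \<rho>" by (simp add: h_def c_def mult.assoc)
      moreover have "w j y < f x + m * \<rho> + \<epsilon>" using bdry[OF y\<rho>] j2[OF y(2)] by linarith
      ultimately show ?thesis using y\<rho> \<epsilon>(1) by simp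
    qed
    fix y r assume y: "y \<in> \<Omega>" and r: "r = norm (y - x)" "s < r" "r < \<rho>"
    have r0: "0 < r" using r s by linarith
    have "0 < g r" using c \<beta> r0 by (simp add: g_def)
    moreover have "(N - 1) * g r / r + (P j - 1) * g' r < 0"
    proof -
      have "r powr (- \<beta> - 1) = r powr (- \<beta>) / r" using r0 by (simp add: powr_diff)
      define k where "k = c * (1 - \<beta>) * r powr (- \<beta>) / r"
      have "g' r = - (\<beta> * k)" using \<open>r powr (- \<beta> - 1) = r powr (- \<beta>) / r\<close> by (simp add: g'_def k_def)
      moreover have "(N - 1) * g r / r = (N - 1) * k" by (simp add: g_def k_def)
      ultimately have "(N - 1) * g r / r + (P j - 1) * g' r = k * ((N - 1) - (P j - 1) * \<beta>)"
        by (simp only:) (simp add: algebra_simps)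
      moreover have "(N - 1) / \<beta> < P j - 1" using j1 by linarith
      then have "(N - 1) - (P j - 1) * \<beta> < 0" using \<beta> by (simp add: pos_divide_less_eq)
      moreover have "0 < k" using c \<beta> r0 by (simp add: k_def)
      ultimately show ?thesis by (simp only: mult_pos_neg)
    qed
    ultimately show "g r powr (P j - 2) * ((real DIM('a) - 1) * g r / r + (P j - 1) * g' r) < (if (1::real) = 1 then 0 else - (b * w j y powr Q j))"
      by (simp add: N_def mult_pos_neg)
  qed (use s z in \<open>auto simp: d_def\<close>)
  then have "w j z \<le> h d" by (simp add: d_def)
  also have "h d = f x + 3 * \<epsilon> + m * d * (\<rho> / d) powr \<beta>"
    using \<rho> d by (simp add: h_def c_def powr_divide powr_diff)
  also have "\<dots> < f x + m * d + 4 * \<epsilon>" using \<beta>(3) by linarith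
  finally show False using j2[OF z\<Omega>] \<epsilon> by linarith
qed

section \<open>The averaged gradient estimate\<close>

text \<open>The two comparison results are combined with the same radius \<open>r\<close>: the sphere of radius \<open>r\<close> around
a point of the ball of radius \<open>r\<close> at \<open>x0\<close> stays within \<open>2 r\<close> of \<open>x0\<close>, where the growth estimate bounds \<open>u_inf\<close> by
\<open>m r\<close> with \<open>m\<close> equal to the asserted bound.\<close>

theorem theorem1p6:
  fixes \<Omega> \<Omega>' :: "'a::euclidean_space set"
    and lam g u_inf :: "'a \<Rightarrow> real"
    and q :: "real \<Rightarrow> real" and l :: real
    and u :: "real \<Rightarrow> 'a \<Rightarrow> real" and p :: "nat \<Rightarrow> real"
  assumes "regular_bounded_domain \<Omega>"
    and "lam \<in> borel_measurable (lebesgue_on \<Omega>)"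
    and "\<exists>a b. 0 < a \<and> (\<forall>x\<in>\<Omega>. a \<le> lam x \<and> lam x \<le> b)"
    and "\<forall>x\<in>frontier \<Omega>. 0 \<le> g x"
    and "\<exists>L. L-lipschitz_on (frontier \<Omega>) g"
    and "\<And>s. 2 \<le> s \<Longrightarrow> 0 \<le> q s \<and> q s < s - 1"
    and "((\<lambda>s. q s / s) \<longlongrightarrow> l) at_top" and "0 \<le> l" and "l < 1"
    and "\<And>j. 2 \<le> p j" and "filterlim p at_top sequentially"
    and "\<And>j. weak_solution (p j) (q (p j)) lam g \<Omega> (u (p j))"
    and "\<And>j x. x \<in> closure \<Omega> \<Longrightarrow> 0 \<le> u (p j) x"
    and "uniform_limit (closure \<Omega>) (\<lambda>j. u (p j)) u_inf sequentially"
    and "compactly_contained \<Omega>' \<Omega>"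
  shows "\<exists>r0>0. \<forall>x0 \<in> frontier {x\<in>\<Omega>. 0 < u_inf x} \<inter> \<Omega>'. \<forall>r. 0 < r \<and> r < r0 \<longrightarrow>
           (\<integral>\<^sup>+x\<in>ball x0 r. ennreal (norm (grad u_inf x)) \<partial>lebesgue) / emeasure lebesgue (ball x0 r)
             \<le> ennreal (2 * 2 powr (l / (1 - l)) * (1 - l) powr (1 / (1 - l)) * r powr (l / (1 - l)))"
proof -
  have \<Omega>: "open \<Omega>" using assms(1) by (simp add: regular_bounded_domain_def)
  obtain a b where ab: "0 < a" "\<And>x. x \<in> \<Omega> \<Longrightarrow> a \<le> lam x" "\<And>x. x \<in> \<Omega> \<Longrightarrow> lam x \<le> b"
    using assms(3) by blast
  have lam0: "\<And>x. x \<in> \<Omega> \<Longrightarrow> 0 \<le> lam x" using ab(1,2) by (meson less_imp_le order_trans)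
  have nonneg: "\<And>j x. x \<in> \<Omega> \<Longrightarrow> 0 \<le> u (p j) x" using assms(13) closure_subset by blast
  have q0: "\<And>j. 0 \<le> q (p j)" using assms(6,10) by blast
  have qlim: "(\<lambda>j. q (p j) / p j) \<longlonglongrightarrow> l" by (rule filterlim_compose[OF assms(7,11)])
  have unif: "uniform_limit \<Omega> (\<lambda>j. u (p j)) u_inf sequentially"
    using assms(14) closure_subset by (rule uniform_limit_on_subset)
  have "continuous_on (closure \<Omega>) (u (p j))" for j using assms(12)[of j] by (simp add: weak_solution_def)
  then have "continuous_on (closure \<Omega>) u_inf"
    by (intro uniform_limit_theorem[OF _ assms(14)]) auto
  then have cont: "continuous_on \<Omega> u_inf" using closure_subset continuous_on_subset by blast
  have inf0: "0 \<le> u_inf x" if "x \<in> \<Omega>" for x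
  proof -
    have "x \<in> closure \<Omega>" using that closure_subset by blast
    then have "(\<lambda>j. u (p j) x) \<longlonglongrightarrow> u_inf x" using assms(14) by (rule tendsto_uniform_limitI[rotated])
    then show ?thesis by (rule tendsto_lowerbound) (auto simp: nonneg that)
  qed
  obtain \<epsilon> where \<epsilon>: "0 < \<epsilon>" "(\<Union>x\<in>closure \<Omega>'. cball x \<epsilon>) \<subseteq> \<Omega>"
    using compact_subset_open_imp_cball_epsilon_subset[of "closure \<Omega>'" \<Omega>] assms(15) \<Omega>
    unfolding compactly_contained_def by blast
  define \<gamma> where "\<gamma> = 1 / (1 - l)"
  have \<gamma>: "1 \<le> \<gamma>" using \<open>0 \<le> l\<close> \<open>l < 1\<close> by (simp add: \<gamma>_def)
  \<comment> \<open>Balls of radius \<open>3 r\<close> about points at distance up to \<open>2 r\<close> from \<open>x0\<close> have to stay inside \<open>\<Omega>\<close>.\<close>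
  show ?thesis
  proof (intro exI[of _ "\<epsilon> / 5"] conjI ballI allI impI)
    show "0 < \<epsilon> / 5" using \<epsilon>(1) by simp
    fix x0 r assume x0: "x0 \<in> frontier {x\<in>\<Omega>. 0 < u_inf x} \<inter> \<Omega>'" and r: "0 < r \<and> r < \<epsilon> / 5"
    have ball0: "cball x0 \<epsilon> \<subseteq> \<Omega>" using \<epsilon>(2) x0 closure_subset by blast
    have x0\<Omega>: "x0 \<in> \<Omega>" using ball0 \<epsilon>(1) by auto
    have u_x0: "u_inf x0 = 0"
    proof (rule ccontr)
      assume "u_inf x0 \<noteq> 0"
      then have "0 < u_inf x0" using inf0[OF x0\<Omega>] by simp
      moreover have "open {x\<in>\<Omega>. 0 < u_inf x}"
        using continuous_open_preimage[OF cont \<Omega>, of "{0<..}"] by (simp add: vimage_def Int_def)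
      ultimately show False using x0 x0\<Omega> by (simp add: frontier_def interior_open)
    qed
    \<comment> \<open>The height of the growth bound at distance \<open>2 r\<close>, divided by the radius \<open>r\<close> of the cone.\<close>
    define m where "m = (2 * (1 - l) * r) powr \<gamma> / r"
    have m0: "0 < m" using r \<open>l < 1\<close> by (simp add: m_def)
    have m_eq: "m = 2 * 2 powr (l / (1 - l)) * (1 - l) powr (1 / (1 - l)) * r powr (l / (1 - l))"
    proof -
      have e: "\<gamma> = 1 + l / (1 - l)" using \<open>l < 1\<close> by (simp add: \<gamma>_def field_simps)
      have two: "2 powr \<gamma> = 2 * 2 powr (l / (1 - l))" unfolding e by (subst powr_add) simp
      have rr: "r powr \<gamma> = r * r powr (l / (1 - l))" unfolding e using r by (subst powr_add) simp
      have "m = 2 powr \<gamma> * (1 - l) powr \<gamma> * r powr \<gamma> / r"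
        by (simp only: m_def powr_mult)
      then show ?thesis unfolding two rr using r by (simp add: \<gamma>_def)
    qed
    have growth: "u_inf y \<le> ((1 - l) * norm (x0 - y)) powr \<gamma>" if y: "norm (y - x0) \<le> 2 * r" for y
      unfolding \<gamma>_def
    proof (rule dead_core_growth[OF \<Omega> assms(12,2) lam0 ab(3) nonneg assms(10,11) q0 qlim assms(8,9) unif cont _ _ u_x0])
      show "cball y (3 * r) \<subseteq> \<Omega>"
      proof
        fix z assume "z \<in> cball y (3 * r)"
        then have "norm (z - y) \<le> 3 * r" by (simp add: dist_norm norm_minus_commute)
        then have "norm (z - x0) \<le> \<epsilon>" using y r norm_triangle_ineq[of "z - y" "y - x0"] by simp
        then show "z \<in> \<Omega>" using ball0 by (auto simp: dist_norm norm_minus_commute)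
      qed
      show "norm (x0 - y) < 3 * r" using y r by (simp add: norm_minus_commute)
    qed
    have grad_le: "norm (grad u_inf x) \<le> m" if x: "x \<in> ball x0 r" for x
    proof (rule norm_grad_le_if_cone_above[of r])
      have xr: "norm (x - x0) < r" using x by (simp add: dist_norm norm_minus_commute)
      fix z assume z: "norm (z - x) < r"
      show "u_inf z \<le> u_inf x + m * norm (z - x)"
      proof (rule cone_comparison[OF \<Omega> assms(12,2) lam0 ab(3) nonneg assms(10,11) q0 unif cont _ m0 _ z])
        show "cball x r \<subseteq> \<Omega>"
        proof
          fix y assume "y \<in> cball x r"
          then have "norm (y - x) \<le> r" by (simp add: dist_norm norm_minus_commute)
          then have "norm (y - x0) \<le> \<epsilon>" using xr r norm_triangle_ineq[of "y - x" "x - x0"] by simp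
          then show "y \<in> \<Omega>" using ball0 by (auto simp: dist_norm norm_minus_commute)
        qed
        fix y assume y: "norm (y - x) = r"
        have y2: "norm (y - x0) \<le> 2 * r" using y xr norm_triangle_ineq[of "y - x" "x - x0"] by simp
        have "u_inf y \<le> ((1 - l) * norm (x0 - y)) powr \<gamma>" by (rule growth[OF y2])
        also have "\<dots> \<le> ((1 - l) * (2 * r)) powr \<gamma>"
          using y2 \<open>l < 1\<close> \<gamma> by (intro powr_mono2 mult_left_mono) (auto simp: norm_minus_commute)
        also have "\<dots> = m * r" using r by (simp add: m_def mult_ac)
        also have "\<dots> \<le> u_inf x + m * r"
        proof -
          have "x \<in> \<Omega>" using x ball0 r \<epsilon>(1) by (auto simp: subset_iff)
          then show ?thesis using inf0 by simp
        qed
        finally show "u_inf y \<le> u_inf x + m * r" .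
      qed
    qed (use r m0 in auto)
    have pos: "0 < emeasure lebesgue (ball x0 r)" "emeasure lebesgue (ball x0 r) < \<infinity>"
      using r by (auto simp: emeasure_lborel_ball_finite content_ball_pos emeasure_eq_measure2 less_top)
    have "(\<integral>\<^sup>+x\<in>ball x0 r. ennreal (norm (grad u_inf x)) \<partial>lebesgue) \<le> (\<integral>\<^sup>+x\<in>ball x0 r. ennreal m \<partial>lebesgue)"
      using grad_le by (intro nn_integral_mono) (auto simp: indicator_def intro!: ennreal_leI)
    also have "\<dots> = ennreal m * emeasure lebesgue (ball x0 r)" by (rule nn_integral_cmult_indicator) simp
    finally have "(\<integral>\<^sup>+x\<in>ball x0 r. ennreal (norm (grad u_inf x)) \<partial>lebesgue) / emeasure lebesgue (ball x0 r)
        \<le> ennreal m * emeasure lebesgue (ball x0 r) / emeasure lebesgue (ball x0 r)"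
      by (rule divide_right_mono_ennreal)
    also have "\<dots> = ennreal m" using pos by (simp add: ennreal_mult_divide_eq)
    finally show "(\<integral>\<^sup>+x\<in>ball x0 r. ennreal (norm (grad u_inf x)) \<partial>lebesgue) / emeasure lebesgue (ball x0 r)
             \<le> ennreal (2 * 2 powr (l / (1 - l)) * (1 - l) powr (1 / (1 - l)) * r powr (l / (1 - l)))"
      unfolding m_eq .
  qed
qed

end
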